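(* Let $U$ be any open subset of $\{(t,x,y,z)\in\mathbb{R}^4:x>0\}$. The Riemannian metric $g=dt^2+dx^2+x^3\,dy^2+\frac1x\,dz^2$ on $U$ has Weyl tensor of type C at every point, but is not conformal to a product of surfaces. Moreover, there are only three limiting Carleman weights, which are the coordinate functions $t,y,z$.
   Context: View the Weyl tensor at $q$ as a symmetric operator $W_q$ on $\Lambda^2T_qU$. An eigenflag direction of $W_q$ is a line $\langle v\rangle$, $0\neq v\in T_qU$, with $W_q(v\wedge v^\perp)\subset v\wedge v^\perp$, where $v\wedge v^\perp=\{v\wedge w:w\perp v\}$. $W_q$ has type C if it has at least one eigenflag direction and two eigenspaces, of dimensions four and two. Limiting Carleman weight: a smooth function $\varphi:V\to\mathbb{R}$ on an open Riemannian manifold $(V,g)$ with nowhere vanishing gradient such that for every $q\in V$ and every $\xi\in T_qV$ with $g(\xi,\nabla\varphi)=0$ and $|\xi|_g=|\nabla\varphi|_g$ one has $\nabla^2\varphi(\nabla\varphi,\nabla\varphi)+\nabla^2\varphi(\xi,\xi)=0$.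
   Formalization: "Only three limiting Carleman weights" is read as: on each connected component of U every weight is a·t+b, a·y+b or a·z+b with a≠0 (literally false: 2t is also a weight, and weights may differ between components); U is assumed nonempty. *)

theory Defs
  imports "HOL-Analysis.Analysis"
begin

section \<open>Smooth maps between open subsets of normed spaces\<close>

text \<open>Only meaningful for open \<open>S\<close>; the value of \<open>f\<close> outside \<open>S\<close> is then irrelevant.\<close>

primrec Ck_on :: "nat \<Rightarrow> 'a::real_normed_vector set \<Rightarrow> ('a \<Rightarrow> 'b::real_normed_vector) \<Rightarrow> bool" where
  "Ck_on 0 S f \<longleftrightarrow> continuous_on S f"
| "Ck_on (Suc k) S f \<longleftrightarrow> (\<forall>x\<in>S. f differentiable (at x)) \<and>
     (\<forall>v. Ck_on k S (\<lambda>x. frechet_derivative f (at x) v))"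

definition smooth_on :: "'a::real_normed_vector set \<Rightarrow> ('a \<Rightarrow> 'b::real_normed_vector) \<Rightarrow> bool" where
  "smooth_on S f \<longleftrightarrow> (\<forall>k. Ck_on k S f)"


section \<open>Riemannian geometry in global coordinates\<close>

text \<open>
  A metric on an open subset of \<open>real ^ 'n\<close> is a matrix-valued function \<open>g\<close>, with
  \<open>g p $ i $ j\<close> the coefficient of \<open>dx\<^sup>i dx\<^sup>j\<close> at \<open>p\<close>. Tangent vectors are given by their
  components in the coordinate frame.
\<close>

type_synonym 'n metric = "real^'n \<Rightarrow> real^'n^'n"

definition ip :: "'n::finite metric \<Rightarrow> real^'n \<Rightarrow> real^'n \<Rightarrow> real^'n \<Rightarrow> real" where
  "ip g p v w = v \<bullet> (g p *v w)"

definition gnorm :: "'n::finite metric \<Rightarrow> real^'n \<Rightarrow> real^'n \<Rightarrow> real" where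
  "gnorm g p v = sqrt (ip g p v v)"

definition ginv :: "'n::finite metric \<Rightarrow> real^'n \<Rightarrow> real^'n^'n" where
  "ginv g p = matrix_inv (g p)"

definition pd :: "'n::finite \<Rightarrow> (real^'n \<Rightarrow> real) \<Rightarrow> real^'n \<Rightarrow> real" where
  "pd i f p = frechet_derivative f (at p) (axis i 1)"

text \<open>\<open>christoffel g k i j p\<close> is \<open>\<Gamma>\<^sup>k\<^sub>i\<^sub>j(p)\<close>, for the Levi-Civita connection.\<close>

definition christoffel :: "'n::finite metric \<Rightarrow> 'n \<Rightarrow> 'n \<Rightarrow> 'n \<Rightarrow> real^'n \<Rightarrow> real" where
  "christoffel g k i j p = (1/2) * (\<Sum>l\<in>UNIV. ginv g p $ k $ l *
     (pd i (\<lambda>q. g q $ j $ l) p + pd j (\<lambda>q. g q $ i $ l) p - pd l (\<lambda>q. g q $ i $ j) p))"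

text \<open>
  \<open>riemann_up g i j k l p\<close> is the \<open>i\<close>-th component of \<open>R(\<partial>\<^sub>k, \<partial>\<^sub>l) \<partial>\<^sub>j\<close>, where
  \<open>R(X, Y) = [\<nabla>\<^sub>X, \<nabla>\<^sub>Y] - \<nabla>\<^bsub>[X, Y]\<^esub>\<close>. With this convention a space of constant sectional
  curvature \<open>K\<close> has \<open>R\<^sub>i\<^sub>j\<^sub>k\<^sub>l = K (g\<^sub>i\<^sub>k g\<^sub>j\<^sub>l - g\<^sub>i\<^sub>l g\<^sub>j\<^sub>k)\<close>.
\<close>

definition riemann_up :: "'n::finite metric \<Rightarrow> 'n \<Rightarrow> 'n \<Rightarrow> 'n \<Rightarrow> 'n \<Rightarrow> real^'n \<Rightarrow> real" where
  "riemann_up g i j k l p =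
     pd k (christoffel g i l j) p - pd l (christoffel g i k j) p
     + (\<Sum>m\<in>UNIV. christoffel g i k m p * christoffel g m l j p
                 - christoffel g i l m p * christoffel g m k j p)"

definition riemann :: "'n::finite metric \<Rightarrow> 'n \<Rightarrow> 'n \<Rightarrow> 'n \<Rightarrow> 'n \<Rightarrow> real^'n \<Rightarrow> real" where
  "riemann g i j k l p = (\<Sum>m\<in>UNIV. g p $ i $ m * riemann_up g m j k l p)"

definition ricci :: "'n::finite metric \<Rightarrow> 'n \<Rightarrow> 'n \<Rightarrow> real^'n \<Rightarrow> real" where
  "ricci g j l p = (\<Sum>k\<in>UNIV. riemann_up g k j k l p)"

definition scalar_curvature :: "'n::finite metric \<Rightarrow> real^'n \<Rightarrow> real" where
  "scalar_curvature g p = (\<Sum>j\<in>UNIV. \<Sum>l\<in>UNIV. ginv g p $ j $ l * ricci g j l p)"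

definition weyl :: "'n::finite metric \<Rightarrow> 'n \<Rightarrow> 'n \<Rightarrow> 'n \<Rightarrow> 'n \<Rightarrow> real^'n \<Rightarrow> real" where
  "weyl g i j k l p = (let n = real CARD('n) in
     riemann g i j k l p
     - (ricci g i k p * g p $ j $ l - ricci g i l p * g p $ j $ k
        + ricci g j l p * g p $ i $ k - ricci g j k p * g p $ i $ l) / (n - 2)
     + scalar_curvature g p * (g p $ i $ k * g p $ j $ l - g p $ i $ l * g p $ j $ k)
        / ((n - 1) * (n - 2)))"


section \<open>The Weyl operator on bivectors\<close>

text \<open>A bivector is represented by the skew-symmetric matrix of its contravariant components.\<close>

definition bivectors :: "(real^'n::finite^'n) set" where
  "bivectors = {A. transpose A = - A}"

definition wedge :: "real^'n::finite \<Rightarrow> real^'n \<Rightarrow> real^'n^'n" where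
  "wedge v w = (\<chi> i j. v $ i * w $ j - v $ j * w $ i)"

text \<open>
  The operator is \<open>A \<mapsto> (1/2) W\<^sup>i\<^sup>j\<^sub>k\<^sub>l A\<^sup>k\<^sup>l\<close>; the factor one half compensates for counting each pair
  of indices twice, so that \<open>\<langle>W(a \<and> b), c \<and> d\<rangle> = W(a, b, c, d)\<close> for the usual inner product on
  bivectors, in which \<open>e\<^sub>i \<and> e\<^sub>j\<close> (\<open>i < j\<close>) is orthonormal when \<open>(e\<^sub>i)\<close> is.
\<close>

definition weyl_op :: "'n::finite metric \<Rightarrow> real^'n \<Rightarrow> real^'n^'n \<Rightarrow> real^'n^'n" where
  "weyl_op g p A = (\<chi> i j. (1/2) * (\<Sum>a\<in>UNIV. \<Sum>b\<in>UNIV. \<Sum>k\<in>UNIV. \<Sum>l\<in>UNIV.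
     ginv g p $ i $ a * ginv g p $ j $ b * weyl g a b k l p * A $ k $ l))"

definition weyl_eigenspace :: "'n::finite metric \<Rightarrow> real^'n \<Rightarrow> real \<Rightarrow> (real^'n^'n) set" where
  "weyl_eigenspace g p \<mu> = {A \<in> bivectors. weyl_op g p A = \<mu> *\<^sub>R A}"

definition wedge_perp :: "'n::finite metric \<Rightarrow> real^'n \<Rightarrow> real^'n \<Rightarrow> (real^'n^'n) set" where
  "wedge_perp g p v = {wedge v w | w. ip g p w v = 0}"

text \<open>The vector \<open>v\<close> spans an eigenflag direction at \<open>p\<close>.\<close>

definition eigenflag :: "'n::finite metric \<Rightarrow> real^'n \<Rightarrow> real^'n \<Rightarrow> bool" where
  "eigenflag g p v \<longleftrightarrow> v \<noteq> 0 \<and> weyl_op g p ` wedge_perp g p v \<subseteq> wedge_perp g p v"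

definition weyl_type_C :: "4 metric \<Rightarrow> real^4 \<Rightarrow> bool" where
  "weyl_type_C g p \<longleftrightarrow> (\<exists>v. eigenflag g p v) \<and>
     (\<exists>\<mu> \<nu>. \<mu> \<noteq> \<nu> \<and> {\<kappa>. weyl_eigenspace g p \<kappa> \<noteq> {0}} = {\<mu>, \<nu>} \<and>
        dim (weyl_eigenspace g p \<mu>) = 4 \<and> dim (weyl_eigenspace g p \<nu>) = 2)"


section \<open>Limiting Carleman weights\<close>

definition grad :: "'n::finite metric \<Rightarrow> (real^'n \<Rightarrow> real) \<Rightarrow> real^'n \<Rightarrow> real^'n" where
  "grad g \<phi> p = ginv g p *v (\<chi> i. pd i \<phi> p)"

definition hessian ::
  "'n::finite metric \<Rightarrow> (real^'n \<Rightarrow> real) \<Rightarrow> real^'n \<Rightarrow> real^'n \<Rightarrow> real^'n \<Rightarrow> real" where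
  "hessian g \<phi> p v w = (\<Sum>i\<in>UNIV. \<Sum>j\<in>UNIV.
     (pd i (pd j \<phi>) p - (\<Sum>k\<in>UNIV. christoffel g k i j p * pd k \<phi> p)) * v $ i * w $ j)"

definition limiting_carleman_weight ::
  "'n::finite metric \<Rightarrow> (real^'n) set \<Rightarrow> (real^'n \<Rightarrow> real) \<Rightarrow> bool" where
  "limiting_carleman_weight g V \<phi> \<longleftrightarrow>
     smooth_on V \<phi> \<and>
     (\<forall>q\<in>V. grad g \<phi> q \<noteq> 0) \<and>
     (\<forall>q\<in>V. \<forall>\<xi>. ip g q \<xi> (grad g \<phi> q) = 0 \<and> gnorm g q \<xi> = gnorm g q (grad g \<phi> q) \<longrightarrow>
        hessian g \<phi> q (grad g \<phi> q) (grad g \<phi> q) + hessian g \<phi> q \<xi> \<xi> = 0)"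


section \<open>Riemannian manifolds, products and conformal equivalence\<close>

text \<open>
  A smooth Riemannian manifold modelled on the Euclidean space \<open>'e\<close> is given by a topology and an
  atlas. A chart comes with the coordinate expression of the metric: it is a triple \<open>(D, c, G)\<close> of
  the domain, the coordinate map and a bilinear form \<open>G u\<close> for each \<open>u \<in> c ` D\<close>.
\<close>

type_synonym ('m, 'e) rchart = "'m set \<times> ('m \<Rightarrow> 'e) \<times> ('e \<Rightarrow> 'e \<Rightarrow> 'e \<Rightarrow> real)"

definition metric_on :: "'e::euclidean_space set \<Rightarrow> ('e \<Rightarrow> 'e \<Rightarrow> 'e \<Rightarrow> real) \<Rightarrow> bool" where
  "metric_on S G \<longleftrightarrow>
     (\<forall>v w. smooth_on S (\<lambda>u. G u v w)) \<and>
     (\<forall>u\<in>S. bilinear (G u) \<and> (\<forall>v w. G u v w = G u w v) \<and> (\<forall>v. v \<noteq> 0 \<longrightarrow> G u v v > 0))"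

definition riemannian_manifold ::
  "'m topology \<Rightarrow> ('m, 'e::euclidean_space) rchart set \<Rightarrow> bool" where
  "riemannian_manifold X \<A> \<longleftrightarrow>
     Hausdorff_space X \<and> second_countable X \<and>
     topspace X = (\<Union>(D, c, G)\<in>\<A>. D) \<and>
     (\<forall>(D, c, G)\<in>\<A>. openin X D \<and> open (c ` D) \<and>
        homeomorphic_map (subtopology X D) (top_of_set (c ` D)) c \<and> metric_on (c ` D) G) \<and>
     (\<forall>(D, c, G)\<in>\<A>. \<forall>(E, d, H)\<in>\<A>. let \<tau> = d \<circ> inv_into D c in
        smooth_on (c ` (D \<inter> E)) \<tau> \<and>
        (\<forall>u\<in>c ` (D \<inter> E). \<forall>v w.
           H (\<tau> u) (frechet_derivative \<tau> (at u) v) (frechet_derivative \<tau> (at u) w) = G u v w))"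

definition riemannian_surface :: "'m topology \<Rightarrow> ('m, real^2) rchart set \<Rightarrow> bool" where
  "riemannian_surface X \<A> \<longleftrightarrow> riemannian_manifold X \<A>"

definition product_atlas ::
  "('m, 'e) rchart set \<Rightarrow> ('n, 'f) rchart set \<Rightarrow> ('m \<times> 'n, 'e \<times> 'f) rchart set" where
  "product_atlas \<A> \<B> =
     {(D \<times> E, map_prod c d, \<lambda>u v w. G (fst u) (fst v) (fst w) + H (snd u) (snd v) (snd w)) |
        D c G E d H. (D, c, G) \<in> \<A> \<and> (E, d, H) \<in> \<B>}"

text \<open>The Riemannian manifold \<open>(U, g)\<close>, for \<open>U\<close> open, has the identity as its only chart.\<close>

definition coordinate_atlas ::
  "'n::finite metric \<Rightarrow> (real^'n) set \<Rightarrow> (real^'n, real^'n) rchart set" where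
  "coordinate_atlas g U = {(U, id, ip g)}"

text \<open>
  A conformal diffeomorphism \<open>F\<close>, satisfying \<open>F\<^sup>* h = \<rho> g\<close> for a positive function \<open>\<rho>\<close>.
  Smoothness of \<open>\<rho>\<close> is automatic since \<open>F\<close> and both metrics are smooth.
\<close>

definition conformal_diffeo ::
  "'m topology \<Rightarrow> ('m, 'e::euclidean_space) rchart set \<Rightarrow>
   'n topology \<Rightarrow> ('n, 'f::euclidean_space) rchart set \<Rightarrow> ('m \<Rightarrow> 'n) \<Rightarrow> bool" where
  "conformal_diffeo X \<A> Y \<B> F \<longleftrightarrow>
     homeomorphic_map X Y F \<and>
     (\<exists>\<rho> :: 'm \<Rightarrow> real. (\<forall>q\<in>topspace X. \<rho> q > 0) \<and>
       (\<forall>(D, c, G)\<in>\<A>. \<forall>(E, d, H)\<in>\<B>.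
          let V = {q \<in> D. F q \<in> E};
              \<Phi> = d \<circ> F \<circ> inv_into D c;
              \<Psi> = c \<circ> inv_into (topspace X) F \<circ> inv_into E d
          in smooth_on (c ` V) \<Phi> \<and> smooth_on (d ` F ` V) \<Psi> \<and>
             (\<forall>q\<in>V. \<forall>v w.
                H (\<Phi> (c q)) (frechet_derivative \<Phi> (at (c q)) v) (frechet_derivative \<Phi> (at (c q)) w)
                = \<rho> q * G (c q) v w)))"


section \<open>The metric of the example\<close>

text \<open>
  Coordinates on \<open>real ^ 4\<close> are \<open>t = p $ 1\<close>, \<open>x = p $ 2\<close>, \<open>y = p $ 3\<close>, \<open>z = p $ 4\<close>.
  In the index type \<open>4\<close> the numeral \<open>4\<close> denotes the same element as \<open>0\<close>.
\<close>

definition example_metric :: "4 metric" where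
  "example_metric p = (\<chi> i j. if i \<noteq> j then 0
     else if i = 3 then (p $ 2) ^ 3
     else if i = 4 then 1 / (p $ 2)
     else 1)"

end

theory Submission
  imports Defs
begin

text \<open>
  If \<open>\<phi>\<close> is a limiting Carleman weight, then \<open>d\<phi>\<close> is parallel for the conformally related metric
  \<open>|d\<phi>|\<^sup>2 g\<close>, and so is \<open>K = d\<phi> \<otimes> d\<phi>\<close>. If \<open>g\<close> is conformal to a product, then the pullback \<open>K\<close> of the
  metric of one factor is parallel for the product metric. In both cases the commutator of second
  covariant derivatives of \<open>K\<close> vanishes. The conformal factor enters it only through a symmetric tensor
  of Schouten type, which drops out of suitable combinations; what remains is that the Weyl operator
  of \<open>g\<close> forces \<open>K\<close> to respect the splitting of the tangent space into \<open>\<langle>\<partial>\<^sub>t, \<partial>\<^sub>x\<rangle>\<close> and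
  \<open>\<langle>\<partial>\<^sub>y, \<partial>\<^sub>z\<rangle>\<close>. The latter distribution is not umbilic. For a weight, this and the first-order
  equations leave only \<open>\<partial>\<^sub>t\<close>, \<open>\<partial>\<^sub>y\<close>, \<open>\<partial>\<^sub>z\<close> as gradient directions and make the gradient components
  constant. For a product, the projection \<open>K\<close> would have rank two, which it cannot have.
\<close>

section \<open>Calculus of \<open>C\<^sup>k\<close> maps\<close>

text \<open>The coefficients are powers of x, so the curvature is diagonal on the coordinate
  bivectors and the integrability condition splits into scalar equations. For distinct i, j, k the
  conformal factor enters the relation for K_jk through an expression that does not depend on i.
  Comparing the two possible indices i, l leaves K_jk times
  \<open>sec i j - sec i k - sec l j + sec l k\<close>. The Ricci parts cancel in this combination,
  so it is one of Weyl eigenvalues: 3/2 up to sign if j, k lie in different blocks {1,2} and {3,4},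
  zero if they lie in the same block. These relations thus say nothing about K_12 and K_34. There
  the failure of umbilicity helps: the exponents 3 and -1 of the metric give the shape eigenvalues
  3/(2x) and -1/(2x) in the x-direction, and their difference 2/x never vanishes.\<close>

lemma Ck_on_cong:
  assumes "open S" "\<And>x. x \<in> S \<Longrightarrow> f x = g x"
  shows "Ck_on k S f \<longleftrightarrow> Ck_on k S g"
  using assms(2)
proof (induction k arbitrary: f g)
  case 0
  then show ?case by (simp cong: continuous_on_cong)
next
  case (Suc k)
  have *: "f differentiable (at x) \<longleftrightarrow> g differentiable (at x)" if "x \<in> S" for x
    using that assms(1) Suc.prems unfolding differentiable_def
    by (metis has_derivative_transform_within_open)
  have "frechet_derivative f (at x) v = frechet_derivative g (at x) v"
    if "x \<in> S" "f differentiable (at x)" for x v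
    using frechet_derivative_transform_within_open[OF that(2) assms(1) that(1)] Suc.prems by metis
  then have **: "Ck_on k S (\<lambda>x. frechet_derivative f (at x) v) \<longleftrightarrow>
     Ck_on k S (\<lambda>x. frechet_derivative g (at x) v)" if "\<forall>x\<in>S. f differentiable (at x)" for v
    by (intro Suc.IH) (use that in auto)
  show ?case using * ** by auto
qed

lemma Ck_on_imp_continuous_on: "Ck_on k S f \<Longrightarrow> continuous_on S f"
  by (cases k) (auto intro: differentiable_imp_continuous_on simp: differentiable_on_def
      differentiable_at_withinI)

lemma Ck_on_SucD: "Ck_on (Suc k) S f \<Longrightarrow> Ck_on k S f"
proof (induction k arbitrary: f)
  case 0
  then show ?case using Ck_on_imp_continuous_on by (metis Ck_on.simps(1))
next
  case (Suc k)
  then show ?case by (metis Ck_on.simps(2))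
qed

lemma Ck_on_const: "Ck_on k S (\<lambda>x. c)"
  by (induction k arbitrary: c) auto

lemma Ck_on_SucI:
  assumes "open S" "\<And>x. x \<in> S \<Longrightarrow> (f has_derivative f' x) (at x)" "\<And>v.
      Ck_on k S (\<lambda>x. f' x v)"
  shows "Ck_on (Suc k) S f"
proof -
  have "frechet_derivative f (at x) = f' x" if "x \<in> S" for x
    using assms(2)[OF that] frechet_derivative_at by metis
  then have "Ck_on k S (\<lambda>x. frechet_derivative f (at x) v)" for v
    using Ck_on_cong[OF assms(1), of "\<lambda>x. frechet_derivative f (at x) v" "\<lambda>x. f' x v"] assms(3)
    by auto
  then show ?thesis using assms(2) by (auto simp: differentiable_def)
qed

lemma Ck_on_SucE:
  assumes "Ck_on (Suc k) S f" "x \<in> S"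
  shows "(f has_derivative frechet_derivative f (at x)) (at x)"
  using assms by (simp add: frechet_derivative_works)

lemma Ck_on_bounded_linear:
  assumes "open S" "bounded_linear f"
  shows "Ck_on k S f"
proof (cases k)
  case 0
  then show ?thesis by (simp add: assms(2) linear_continuous_on)
next
  case (Suc k)
  then show ?thesis
    using Ck_on_SucI[OF assms(1), of f "\<lambda>x. f" k] assms(2) Ck_on_const
    by (auto intro: bounded_linear_imp_has_derivative)
qed

lemma Ck_on_add:
  assumes "open S" "Ck_on k S f" "Ck_on k S g"
  shows "Ck_on k S (\<lambda>x. f x + g x)"
  using assms(2,3)
proof (induction k arbitrary: f g)
  case 0
  then show ?case by (simp add: continuous_on_add)
next
  case (Suc k)
  show ?case
  proof (rule Ck_on_SucI[OF assms(1)])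
    show "((\<lambda>x. f x + g x) has_derivative
       (\<lambda>v. frechet_derivative f (at x) v + frechet_derivative g (at x) v)) (at x)" if "x \<in> S" for x
      using Suc.prems that by (intro has_derivative_add Ck_on_SucE)
  next
    show "Ck_on k S (\<lambda>x. frechet_derivative f (at x) v + frechet_derivative g (at x) v)" for v
      using Suc.prems by (intro Suc.IH) auto
  qed
qed

lemma Ck_on_sum:
  assumes "open S" "\<And>i. i \<in> I \<Longrightarrow> Ck_on k S (f i)"
  shows "Ck_on k S (\<lambda>x. \<Sum>i\<in>I. f i x)"
  using assms(2)
  by (induction I rule: infinite_finite_induct) (auto intro: Ck_on_add Ck_on_const assms(1))

lemma Ck_on_bounded_bilinear:
  assumes "open S" "bounded_bilinear B" "Ck_on k S f" "Ck_on k S g"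
  shows "Ck_on k S (\<lambda>x. B (f x) (g x))"
  using assms(3,4)
proof (induction k arbitrary: f g)
  case 0
  then show ?case using bounded_bilinear.continuous_on[OF assms(2)] by simp
next
  case (Suc k)
  show ?case
  proof (rule Ck_on_SucI[OF assms(1)])
    show "((\<lambda>x. B (f x) (g x)) has_derivative
       (\<lambda>v. B (f x) (frechet_derivative g (at x) v) + B (frechet_derivative f (at x) v) (g x))) (at x)"
      if "x \<in> S" for x
      using Suc.prems that by (intro bounded_bilinear.FDERIV[OF assms(2)] Ck_on_SucE)
  next
    show "Ck_on k S (\<lambda>x. B (f x) (frechet_derivative g (at x) v) +
        B (frechet_derivative f (at x) v) (g x))" for v
      using Suc.prems Suc.prems[THEN Ck_on_SucD] by (intro Ck_on_add[OF assms(1)] Suc.IH) auto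
  qed
qed

lemmas Ck_on_mult = Ck_on_bounded_bilinear[OF _ bounded_bilinear_mult]
lemmas Ck_on_scaleR = Ck_on_bounded_bilinear[OF _ bounded_bilinear_scaleR]

text \<open>\<open>Ck_on\<close> controls the derivative of \<open>f\<close> only in constant
  directions, whereas the chain rule evaluates it in the moving direction given by the derivative of
  \<open>g\<close>. Expanding that direction in an orthonormal basis makes the directions constant;
  hence the Euclidean middle space.\<close>

lemma Ck_on_compose:
  fixes g :: "'a::real_normed_vector \<Rightarrow> 'b::euclidean_space"
  assumes "open S" "g ` S \<subseteq> T" "Ck_on k S g" "Ck_on k T f"
  shows "Ck_on k S (\<lambda>x. f (g x))"
  using assms(3,4)
proof (induction k arbitrary: f)
  case 0
  then show ?case using assms(2) continuous_on_compose2 by (metis Ck_on.simps(1))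
next
  case (Suc k)
  show ?case
  proof (rule Ck_on_SucI[OF assms(1)])
    show "((\<lambda>x. f (g x)) has_derivative
       (\<lambda>v. \<Sum>b\<in>Basis. (frechet_derivative g (at x) v \<bullet> b) *\<^sub>R
           frechet_derivative f (at (g x)) b)) (at x)"
      if "x \<in> S" for x
    proof -
      have f: "(f has_derivative frechet_derivative f (at (g x))) (at (g x))"
        using Suc.prems(2) that assms(2) by (intro Ck_on_SucE) auto
      have lin: "linear (frechet_derivative f (at (g x)))"
        using f has_derivative_linear by blast
      have "((\<lambda>x. f (g x)) has_derivative
         (\<lambda>v. frechet_derivative f (at (g x)) (frechet_derivative g (at x) v))) (at x)"
        using has_derivative_compose[OF Ck_on_SucE[OF Suc.prems(1) that] f] .
      moreover have "frechet_derivative f (at (g x)) (frechet_derivative g (at x) v) =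
         (\<Sum>b\<in>Basis. (frechet_derivative g (at x) v \<bullet> b) *\<^sub>R frechet_derivative f
             (at (g x)) b)" for v
        by (subst euclidean_representation[symmetric])
          (simp add: linear_sum[OF lin] linear_scale[OF lin])
      ultimately show ?thesis by simp
    qed
  next
    have "Ck_on k S (\<lambda>x. frechet_derivative g (at x) v \<bullet> b)" for v and b :: 'b
      using Suc.prems(1)
      by (intro Ck_on_bounded_bilinear[OF assms(1) bounded_bilinear_inner _ Ck_on_const]) simp
    then show "Ck_on k S (\<lambda>x. \<Sum>b\<in>Basis. (frechet_derivative g (at x) v \<bullet> b) *\<^sub>R
        frechet_derivative f (at (g x)) b)" for v
      using Suc.prems Suc.prems(1)[THEN Ck_on_SucD] by (intro Ck_on_sum Ck_on_scaleR assms(1) Suc.IH) auto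
  qed
qed

lemma Ck_on_inverse_real: "Ck_on k {x::real. x \<noteq> 0} inverse"
proof (induction k)
  case 0
  then show ?case by (auto intro: continuous_on_inverse)
next
  case (Suc k)
  have op: "open {x::real. x \<noteq> 0}"
    by (simp add: open_Collect_neq)
  show ?case
  proof (rule Ck_on_SucI[OF op])
    show "(inverse has_derivative (\<lambda>v. - 1 * (inverse x * v * inverse x))) (at x)"
      if "x \<in> {x::real. x \<noteq> 0}" for x
      using that has_derivative_inverse'[of x UNIV] by simp
    show "Ck_on k {x::real. x \<noteq> 0} (\<lambda>x. - 1 * (inverse x * v * inverse x))" for v
      by (intro Ck_on_mult op Suc.IH Ck_on_const)
  qed
qed

lemma Ck_on_inverse:
  fixes f :: "'a::real_normed_vector \<Rightarrow> real"
  assumes "open S" "Ck_on k S f" "\<And>x. x \<in> S \<Longrightarrow> f x \<noteq> 0"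
  shows "Ck_on k S (\<lambda>x. inverse (f x))"
  by (rule Ck_on_compose[OF assms(1) _ assms(2) Ck_on_inverse_real]) (use assms(3) in auto)

section \<open>Symmetry of second derivatives\<close>

text \<open>The mean value theorem is applied twice, first along \<open>v\<close> to a difference in
  direction \<open>w\<close>, then along \<open>w\<close> to the derivative in direction
  \<open>v\<close>. The left-hand side is symmetric in \<open>v\<close> and \<open>w\<close>, so it
  links both mixed derivatives.\<close>

lemma second_difference_mean_value:
  fixes f :: "'a::real_normed_vector \<Rightarrow> real"
  assumes f: "\<And>x. x \<in> ball p d \<Longrightarrow> (f has_derivative f' x) (at x)"
    and f': "\<And>x. x \<in> ball p d \<Longrightarrow> ((\<lambda>x. f' x v) has_derivative f'' x) (at x)"
    and h: "0 < h" "h * (norm v + norm w) < d"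
  obtains q where "q \<in> ball p d"
    "f (p + h *\<^sub>R v + h *\<^sub>R w) - f (p + h *\<^sub>R v) - f (p + h *\<^sub>R w) + f p = h *
        h * f'' q w"
proof -
  have in_ball: "p + s *\<^sub>R v + t *\<^sub>R w \<in> ball p d" if "0 \<le> s" "s \<le> h" "0 \<le>
      t" "t \<le> h" for s t
  proof -
    have "norm (s *\<^sub>R v + t *\<^sub>R w) \<le> s * norm v + t * norm w"
      using that by (metis abs_of_nonneg norm_scaleR norm_triangle_ineq)
    also have "\<dots> \<le> h * norm v + h * norm w"
      using that by (intro add_mono mult_right_mono) auto
    also have "\<dots> < d" using h by (simp add: distrib_left)
    finally show ?thesis by (simp add: dist_norm add.assoc norm_minus_commute add.commute)
  qed
  let ?g = "\<lambda>s. f (p + s *\<^sub>R v + h *\<^sub>R w) - f (p + s *\<^sub>R v)"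
  have lin: "linear (f' x)" if "x \<in> ball p d" for x
    using f[OF that] has_derivative_linear by blast
  have lin2: "linear (f'' x)" if "x \<in> ball p d" for x
    using f'[OF that] has_derivative_linear by blast
  have "\<exists>s>0. s < h \<and> ?g h - ?g 0 = (h - 0) * (f' (p + s *\<^sub>R v + h *\<^sub>R w) v -
      f' (p + s *\<^sub>R v) v)"
  proof (rule MVT2)
    show "(?g has_real_derivative f' (p + s *\<^sub>R v + h *\<^sub>R w) v - f' (p + s *\<^sub>R v) v) (at s)"
      if "0 \<le> s" "s \<le> h" for s
    proof -
      have 1: "p + s *\<^sub>R v + h *\<^sub>R w \<in> ball p d" "p + s *\<^sub>R v \<in> ball p d"
        using in_ball[of s h] in_ball[of s 0] that h by auto
      have "(?g has_derivative (\<lambda>r. f' (p + s *\<^sub>R v + h *\<^sub>R w) (r *\<^sub>R v) - f'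
          (p + s *\<^sub>R v) (r *\<^sub>R v))) (at s)"
        by (intro has_derivative_diff
            has_derivative_compose[where f = "\<lambda>s. p + s *\<^sub>R v + h *\<^sub>R w", OF _ f[OF 1(1)]]
            has_derivative_compose[where f = "\<lambda>s. p + s *\<^sub>R v", OF _ f[OF 1(2)]])
          (auto intro!: derivative_eq_intros)
      then show ?thesis
        unfolding has_field_derivative_def
        by (rule has_derivative_eq_rhs)
          (auto simp: linear_scale[OF lin[OF 1(1)]] linear_scale[OF lin[OF 1(2)]] right_diff_distrib
              mult.commute fun_eq_iff)
    qed
  qed (use h in auto)
  then obtain s where s: "0 < s" "s < h"
    "?g h - ?g 0 = h * (f' (p + s *\<^sub>R v + h *\<^sub>R w) v - f' (p + s *\<^sub>R v) v)" by auto
  let ?k = "\<lambda>t. f' (p + s *\<^sub>R v + t *\<^sub>R w) v"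
  have "\<exists>t>0. t < h \<and> ?k h - ?k 0 = (h - 0) * f'' (p + s *\<^sub>R v + t *\<^sub>R w) w"
  proof (rule MVT2)
    show "(?k has_real_derivative f'' (p + s *\<^sub>R v + t *\<^sub>R w) w) (at t)"
      if "0 \<le> t" "t \<le> h" for t
    proof -
      have 1: "p + s *\<^sub>R v + t *\<^sub>R w \<in> ball p d"
        using in_ball[of s t] that s by auto
      have "(?k has_derivative (\<lambda>r. f'' (p + s *\<^sub>R v + t *\<^sub>R w) (r *\<^sub>R w))) (at t)"
        by (intro has_derivative_compose[where f = "\<lambda>t. p + s *\<^sub>R v + t *\<^sub>R w", OF
            _ f'[OF 1]]) (auto intro!: derivative_eq_intros)
      then show ?thesis
        unfolding has_field_derivative_def
        by (rule has_derivative_eq_rhs) (auto simp: linear_scale[OF lin2[OF 1]])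
    qed
  qed (use h in auto)
  then obtain t where t: "0 < t" "t < h" "?k h - ?k 0 = h * f'' (p + s *\<^sub>R v + t *\<^sub>R w) w" by auto
  show ?thesis
  proof (rule that)
    show "p + s *\<^sub>R v + t *\<^sub>R w \<in> ball p d" using in_ball s t by auto
  qed (use s t in \<open>auto simp: algebra_simps\<close>)
qed

lemma frechet_derivative_commute_real:
  fixes f :: "'a::real_normed_vector \<Rightarrow> real"
  assumes S: "open S" "p \<in> S" and f: "Ck_on 2 S f"
  shows "frechet_derivative (\<lambda>x. frechet_derivative f (at x) v) (at p) w =
         frechet_derivative (\<lambda>x. frechet_derivative f (at x) w) (at p) v"
    (is "?c v w p = ?c w v p")
proof (rule ccontr)
  assume ne: "?c v w p \<noteq> ?c w v p"
  \<comment> \<open>Half the gap: values within \<open>e\<close> of the two mixed derivatives at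
    \<open>p\<close> can never coincide.\<close>
  define e where "e = \<bar>?c v w p - ?c w v p\<bar> / 2"
  have e: "e > 0" using ne by (simp add: e_def)
  have f1: "(f has_derivative frechet_derivative f (at x)) (at x)" if "x \<in> S" for x
    using f that by (simp add: numeral_2_eq_2 frechet_derivative_works)
  have f2: "((\<lambda>x. frechet_derivative f (at x) v) has_derivative (\<lambda>w. ?c v w x)) (at x)"
    if "x \<in> S" for x v
    using f that by (simp add: numeral_2_eq_2 flip: frechet_derivative_works)
  have cont: "continuous_on S (?c v w)" for v w
    using f by (simp add: numeral_2_eq_2)
  have ev: "\<forall>\<^sub>F x in at p. x \<in> S" "\<forall>\<^sub>F x in at p. dist (?c v w x) (?c v
      w p) < e"
    "\<forall>\<^sub>F x in at p. dist (?c w v x) (?c w v p) < e"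
    using S cont[of v w] cont[of w v] e
    by (auto simp: eventually_at_topological continuous_on_eq_continuous_at isCont_def tendsto_iff)
  have "\<forall>\<^sub>F x in at p. x \<in> S \<and> dist (?c v w x) (?c v w p) < e \<and> dist (?c w
      v x) (?c w v p) < e"
    by (intro eventually_conj ev)
  then obtain d where d: "d > 0" "\<And>x. x \<in> ball p d \<Longrightarrow> x \<noteq> p \<Longrightarrow>
      x \<in> S \<and> dist (?c v w x) (?c v w p) < e \<and> dist (?c w v x) (?c w v p) < e"
    by (auto simp: eventually_at dist_commute)
  have d': "x \<in> S" "dist (?c v w x) (?c v w p) < e" "dist (?c w v x) (?c w v p) < e"
    if "x \<in> ball p d" for x
    using d(2)[OF that] S e by (cases "x = p"; auto)+
  \<comment> \<open>The summand 1 keeps the divisor of \<open>d\<close> positive.\<close>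
  define n where "n = norm v + norm w + 1"
  have nn: "n > 0" by (simp add: n_def add_nonneg_pos)
  define h where "h = d / n / 2"
  have h: "h > 0" "h * (norm v + norm w) < d" "h * (norm w + norm v) < d"
  proof -
    show "h > 0" using d nn by (simp add: h_def)
    have "h * (norm v + norm w) \<le> h * n" using \<open>h > 0\<close> by (intro mult_left_mono) (auto
        simp: n_def)
    also have "\<dots> = d / 2" using nn by (simp add: h_def)
    also have "\<dots> < d" using d by simp
    finally show "h * (norm v + norm w) < d" .
    then show "h * (norm w + norm v) < d" by (simp add: add.commute)
  qed
  obtain q where q: "q \<in> ball p d"
    "f (p + h *\<^sub>R v + h *\<^sub>R w) - f (p + h *\<^sub>R v) - f (p + h *\<^sub>R w) + f p = h *
        h * ?c v w q"
    using second_difference_mean_value[OF f1[OF d'(1)] f2[OF d'(1)] h(1,2)] by blast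
  obtain r where r: "r \<in> ball p d"
    "f (p + h *\<^sub>R w + h *\<^sub>R v) - f (p + h *\<^sub>R w) - f (p + h *\<^sub>R v) + f p = h *
        h * ?c w v r"
    using second_difference_mean_value[OF f1[OF d'(1)] f2[OF d'(1)] h(1,3)] by blast
  have "h * h * ?c v w q = h * h * ?c w v r"
    using q(2) r(2) by (simp add: algebra_simps)
  then have "?c v w q = ?c w v r" using h(1) by simp
  then show False using d'(2)[OF q(1)] d'(3)[OF r(1)] unfolding e_def dist_real_def
    by (auto simp: abs_if field_simps split: if_splits)
qed

lemma frechet_derivative_bounded_linear:
  assumes "f differentiable (at x)" "bounded_linear L"
  shows "frechet_derivative (\<lambda>x. L (f x)) (at x) v = L (frechet_derivative f (at x) v)"
  using assms bounded_linear.has_derivative[OF assms(2)] frechet_derivative_at frechet_derivative_works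
  by metis

lemma frechet_derivative_commute:
  fixes f :: "'a::real_normed_vector \<Rightarrow> 'b::euclidean_space"
  assumes S: "open S" "p \<in> S" and f: "Ck_on 2 S f"
  shows "frechet_derivative (\<lambda>x. frechet_derivative f (at x) v) (at p) w =
         frechet_derivative (\<lambda>x. frechet_derivative f (at x) w) (at p) v"
proof (rule euclidean_eqI)
  fix b :: 'b assume "b \<in> Basis"
  have d1: "f differentiable (at x)" if "x \<in> S" for x
    using f that by (simp add: numeral_2_eq_2)
  have d2: "(\<lambda>x. frechet_derivative f (at x) v) differentiable (at p)" for v
    using f S by (simp add: numeral_2_eq_2)
  have "Ck_on 2 S (\<lambda>x. f x \<bullet> b)"
    using Ck_on_bounded_bilinear[OF S(1) bounded_bilinear_inner f Ck_on_const] .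
  note * = frechet_derivative_commute_real[OF S this, of v w]
  have **: "frechet_derivative (\<lambda>x. frechet_derivative (\<lambda>x. f x \<bullet> b) (at x) v)
      (at p) w =
     frechet_derivative (\<lambda>x. frechet_derivative f (at x) v) (at p) w \<bullet> b" for v w
  proof -
    have "frechet_derivative (\<lambda>x. frechet_derivative f (at x) v \<bullet> b) (at p) =
        frechet_derivative (\<lambda>x. frechet_derivative (\<lambda>x. f x \<bullet> b) (at x) v) (at p)"
      by (rule frechet_derivative_transform_within_open[OF _ S])
        (simp_all add: d1 d2 frechet_derivative_bounded_linear[OF _ bounded_linear_inner_left]
          differentiable_inner)
    then show ?thesis
      using frechet_derivative_bounded_linear[OF d2 bounded_linear_inner_left] by metis
  qed
  show "frechet_derivative (\<lambda>x. frechet_derivative f (at x) v) (at p) w \<bullet> b =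
         frechet_derivative (\<lambda>x. frechet_derivative f (at x) w) (at p) v \<bullet> b"
    using * ** by simp
qed

section \<open>Coordinate partial derivatives\<close>

lemma pd_eqI: "(f has_derivative D) (at p) \<Longrightarrow> pd i f p = D (axis i 1)"
  unfolding pd_def using frechet_derivative_at by metis

lemma pd_const: "pd i (\<lambda>q. c) p = 0"
  using pd_eqI[OF has_derivative_const] .

lemma pd_component: 
  assumes "(f has_real_derivative D) (at (p $ j))"
  shows "pd i (\<lambda>q. f (q $ j)) p = (if i = j then D else 0)"
proof -
  have "((\<lambda>q. f (q $ j)) has_derivative (\<lambda>v. D * (v $ j))) (at p)"
    by (rule has_derivative_compose[where g = f])
      (use assms in \<open>auto simp: has_field_derivative_def bounded_linear_vec_nth
          bounded_linear_imp_has_derivative\<close>)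
  then have "pd i (\<lambda>q. f (q $ j)) p = D * (axis i 1) $ j" by (rule pd_eqI)
  then show ?thesis by (simp add: axis_def)
qed

lemma pd_cong:
  assumes "open S" "p \<in> S" "\<And>q. q \<in> S \<Longrightarrow> f q = g q"
  shows "pd i f p = pd i g p"
proof -
  have "frechet_derivative f (at p) = frechet_derivative g (at p)"
  proof (cases "f differentiable (at p) \<or> g differentiable (at p)")
    case True
    then show ?thesis
      using frechet_derivative_transform_within_open[OF _ assms(1,2)] assms(3) by metis
  next
    \<comment> \<open>Without differentiability both Frechet derivatives are the same arbitrary
      choice, because the predicates chosen from agree.\<close>
    case False
    have "(f has_derivative D) (at p) \<longleftrightarrow> (g has_derivative D) (at p)" for D
      using has_derivative_transform_within_open assms by metis
    then show ?thesis by (simp add: frechet_derivative_def)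
  qed
  then show ?thesis by (simp add: pd_def)
qed

section \<open>Curvature of the example metric\<close>

lemma matrix_inv_eqI:
  fixes A :: "'a::semiring_1^'n^'n"
  assumes "A ** B = mat 1" "B ** A = mat 1"
  shows "matrix_inv A = B"
proof -
  have "\<exists>B. A ** B = mat 1 \<and> B ** A = mat 1" using assms by blast
  then have "A ** matrix_inv A = mat 1" unfolding matrix_inv_def by (rule someI2_ex) simp
  then have "B ** A ** matrix_inv A = B" by (metis matrix_mul_assoc matrix_mul_rid)
  then show ?thesis using assms(2) by simp
qed

text \<open>All metric coefficients are powers of \<open>x\<close>; \<open>wexp i\<close> is the exponent of the \<open>i\<close>-th.\<close>

definition wt :: "4 \<Rightarrow> real \<Rightarrow> real" where
  "wt i x = (if i = 3 then x ^ 3 else if i = 4 then 1 / x else 1)"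

definition wexp :: "4 \<Rightarrow> real" where
  "wexp i = (if i = 3 then 3 else if i = 4 then - 1 else 0)"

lemma example_metric_nth: "example_metric p $ i $ j = (if i = j then wt i (p $ 2) else 0)"
  by (simp add: example_metric_def wt_def)

lemma wt_pos: "x > 0 \<Longrightarrow> wt i x > 0"
  by (simp add: wt_def)

lemma wt_deriv: "x > 0 \<Longrightarrow> (wt i has_real_derivative wexp i * wt i x / x) (at x)"
  by (cases "i = 3"; cases "i = 4")
    (auto simp: wt_def[abs_def] wexp_def field_simps power2_eq_square eval_nat_numeral intro!:
        derivative_eq_intros)

lemma ginv_nth:
  assumes "p $ 2 > 0"
  shows "ginv example_metric p $ i $ j = (if i = j then 1 / wt i (p $ 2) else 0)"
proof -
  let ?B = "(\<chi> i j. if i = j then 1 / wt i (p $ 2) else 0) :: real^4^4"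
  have nz: "wt i (p $ 2) \<noteq> 0" for i using wt_pos[OF assms, of i] by simp
  have "example_metric p ** ?B = mat 1" "?B ** example_metric p = mat 1"
    using nz by (auto simp: matrix_matrix_mult_def vec_eq_iff mat_def example_metric_nth
        if_distrib[of "\<lambda>a. a * _"] if_distrib[of "\<lambda>a. _ * a"] cong: if_cong)
  then have "matrix_inv (example_metric p) = ?B"
    by (rule matrix_inv_eqI)
  then show ?thesis by (simp add: ginv_def)
qed

lemma pd_example_metric:
  assumes "p $ 2 > 0"
  shows "pd k (\<lambda>q. example_metric q $ i $ j) p =
    (if i = j \<and> k = 2 then wexp i * wt i (p $ 2) / p $ 2 else 0)"
  using pd_component[OF wt_deriv[OF assms], of k i]
  by (cases "i = j") (auto simp: example_metric_nth pd_const)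

text \<open>\<open>chr\<close> and \<open>chr'\<close> are the Christoffel symbols and their \<open>x\<close>-derivatives, as functions of \<open>x\<close>.\<close>

definition chr :: "4 \<Rightarrow> 4 \<Rightarrow> 4 \<Rightarrow> real \<Rightarrow> real" where
  "chr k i j x = ((if i = 2 \<and> j = k then wexp k else 0) + (if j = 2 \<and> i = k then wexp k else 0)
     - (if k = 2 \<and> i = j then wexp i * wt i x else 0)) / (2 * x)"

definition chr' :: "4 \<Rightarrow> 4 \<Rightarrow> 4 \<Rightarrow> real \<Rightarrow> real" where
  "chr' k i j x = - ((if i = 2 \<and> j = k then wexp k else 0) + (if j = 2 \<and> i = k then wexp k else 0)
     + (if k = 2 \<and> i = j then wexp i * (wexp i - 1) * wt i x else 0)) / (2 * x\<^sup>2)"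

lemma christoffel_example:
  assumes "p $ 2 > 0"
  shows "christoffel example_metric k i j p = chr k i j (p $ 2)"
proof -
  have nz: "wt i (p $ 2) \<noteq> 0" for i using wt_pos[OF assms, of i] by simp
  have "wexp 2 = 0" "wt 2 (p $ 2) = 1" by (auto simp: wexp_def wt_def)
  then show ?thesis
    unfolding christoffel_def ginv_nth[OF assms] pd_example_metric[OF assms] chr_def
    using nz[of k] assms
    by (auto simp: if_distrib[of "\<lambda>a. a * _"] diff_divide_distrib add_divide_distrib cong: if_cong)
qed

lemma chr_deriv: 
  assumes "x > 0" shows "(chr k i j has_real_derivative chr' k i j x) (at x)"
proof -
  have 1: "((\<lambda>x. c / (2 * x)) has_real_derivative - c / (2 * x\<^sup>2)) (at x)" for c :: real
    using assms by (auto intro!: derivative_eq_intros simp: field_simps power2_eq_square)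
  have 2: "((\<lambda>x. wexp i * wt i x / (2 * x)) has_real_derivative
      wexp i * (wexp i - 1) * wt i x / (2 * x\<^sup>2)) (at x)"
    using assms by (auto intro!: derivative_eq_intros wt_deriv simp: field_simps power2_eq_square)
  define c where "c = (if i = 2 \<and> j = k then wexp k else 0) + (if j = 2 \<and> i = k then wexp k else 0)"
  have *: "chr k i j = (\<lambda>x. c / (2 * x) - (if k = 2 \<and> i = j then wexp i * wt i x / (2 * x)
      else 0))"
    by (auto simp: chr_def diff_divide_distrib c_def)
  have **: "chr' k i j x =
     - c / (2 * x\<^sup>2) - (if k = 2 \<and> i = j then wexp i * (wexp i - 1) * wt i x / (2 *
         x\<^sup>2) else 0)"
    by (auto simp: chr'_def diff_divide_distrib add_divide_distrib c_def)
  show ?thesis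
  proof (cases "k = 2 \<and> i = j")
    case True
    show ?thesis unfolding * ** if_P[OF True] by (rule DERIV_diff[OF 1 2])
  next
    case False
    show ?thesis unfolding * ** if_not_P[OF False] using 1 by simp
  qed
qed

lemma pd_christoffel_example:
  assumes "p $ 2 > 0"
  shows "pd m (christoffel example_metric k i j) p = (if m = 2 then chr' k i j (p $ 2) else 0)"
proof -
  have "open {q :: real^4. q $ 2 > 0}"
    by (intro open_Collect_less continuous_intros)
  then have "pd m (christoffel example_metric k i j) p = pd m (\<lambda>q. chr k i j (q $ 2)) p"
    using assms by (intro pd_cong[where S = "{q. q $ 2 > 0}"]) (auto simp: christoffel_example)
  then show ?thesis using pd_component[OF chr_deriv[OF assms]] by simp
qed

text \<open>The sectional curvature of the coordinate plane \<open>\<langle>\<partial>\<^sub>i, \<partial>\<^sub>j\<rangle>\<close> is \<open>sec i j / x\<^sup>2\<close>.\<close>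

definition sec :: "4 \<Rightarrow> 4 \<Rightarrow> real" where
  "sec i j = (if i = 1 \<or> j = 1 then 0 else if {i, j} = {3, 4} then 3/4 else - (3/4))"

text \<open>Checked by running through all index values. It is stated for functions of
  \<open>x\<close> alone so that \<open>conf_curvature\<close> can reuse it.\<close>

lemma chr_riemann:
  assumes x: "x > 0"
  shows "(if k = 2 then chr' i l j x else 0) - (if l = 2 then chr' i k j x else 0) +
    (\<Sum>m\<in>UNIV. chr i k m x * chr m l j x - chr i l m x * chr m k j x) =
    sec k l / x\<^sup>2 * ((if i = k \<and> j = l then wt j x else 0) - (if i = l \<and> j = k then wt
        j x else 0))"
proof -
  have c: "chr 1 i j x = 0"
    "chr 2 i j x = (if i = 3 \<and> j = 3 then - 3 * x\<^sup>2 / 2 else if i = 4 \<and> j = 4 then 1 /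
        (2 * x\<^sup>2) else 0)"
    "chr 3 i j x = (if i = 2 \<and> j = 3 \<or> i = 3 \<and> j = 2 then 3 / (2 * x) else 0)"
    "chr 4 i j x = (if i = 2 \<and> j = 4 \<or> i = 4 \<and> j = 2 then - 1 / (2 * x) else 0)" for i j
    using x by (auto simp: chr_def wexp_def wt_def field_simps eval_nat_numeral)
  have c': "chr' 1 i j x = 0"
    "chr' 2 i j x = (if i = 3 \<and> j = 3 then - 3 * x else if i = 4 \<and> j = 4 then - 1 / x ^ 3 else 0)"
    "chr' 3 i j x = (if i = 2 \<and> j = 3 \<or> i = 3 \<and> j = 2 then - 3 / (2 * x\<^sup>2) else 0)"
    "chr' 4 i j x = (if i = 2 \<and> j = 4 \<or> i = 4 \<and> j = 2 then 1 / (2 * x\<^sup>2) else 0)" for i j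
    using x by (auto simp: chr'_def wexp_def wt_def field_simps eval_nat_numeral)
  show ?thesis
    using exhaust_4[of i] exhaust_4[of j] exhaust_4[of k] exhaust_4[of l] x
    by (elim disjE; simp add: c c' sum_4 sec_def wt_def doubleton_eq_iff)
      (simp_all add: field_simps eval_nat_numeral)
qed

lemma riemann_up_example:
  assumes "p $ 2 > 0"
  shows "riemann_up example_metric i j k l p = sec k l / (p $ 2)\<^sup>2 *
    ((if i = k \<and> j = l then wt j (p $ 2) else 0) - (if i = l \<and> j = k then wt j (p $ 2) else 0))"
  unfolding riemann_up_def christoffel_example[OF assms] pd_christoffel_example[OF assms]
  by (rule chr_riemann[OF assms])

lemma ricci_example:
  assumes "p $ 2 > 0"
  shows "ricci example_metric j l p = (if j = 2 \<and> l = 2 then - 3 / (2 * (p $ 2)\<^sup>2) else 0)"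
proof -
  define x where "x = p $ 2"
  have x: "x > 0" using assms by (simp add: x_def)
  have "\<forall>j l. (\<Sum>k\<in>UNIV. sec k l / x\<^sup>2 *
    ((if k = k \<and> j = l then wt j x else 0) - (if k = l \<and> j = k then wt j x else 0))) =
    (if j = 2 \<and> l = 2 then - 3 / (2 * x\<^sup>2) else 0)"
    unfolding forall_4 sum_4 sec_def wt_def using x
    by (simp add: field_simps eval_nat_numeral doubleton_eq_iff)
  then show ?thesis
    unfolding ricci_def riemann_up_example[OF assms] x_def by blast
qed

lemma scalar_curvature_example:
  assumes "p $ 2 > 0"
  shows "scalar_curvature example_metric p = - 3 / (2 * (p $ 2)\<^sup>2)"
  unfolding scalar_curvature_def ginv_nth[OF assms] ricci_example[OF assms]
  using assms by (simp add: sum_4 wt_def)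

text \<open>The Weyl operator is diagonal in the basis \<open>\<partial>\<^sub>i \<and> \<partial>\<^sub>j\<close>, with eigenvalues \<open>wcoef i j / x\<^sup>2\<close>.\<close>

definition wcoef :: "4 \<Rightarrow> 4 \<Rightarrow> real" where
  "wcoef i j = (if i \<in> {1, 2} \<longleftrightarrow> j \<in> {1, 2} then 1/2 else - (1/4))"

lemma weyl_example:
  assumes "p $ 2 > 0"
  shows "weyl example_metric i j k l p = wcoef k l / (p $ 2)\<^sup>2 * wt i (p $ 2) * wt j (p $ 2) *
    ((if i = k \<and> j = l then 1 else 0) - (if i = l \<and> j = k then 1 else 0))"
proof -
  define x where "x = p $ 2"
  have x: "x > 0" using assms by (simp add: x_def)
  have n: "real CARD(4) = 4" by simp
  have riem: "(\<Sum>m\<in>UNIV. (if i = m then wt i x else 0) * f m) = wt i x * f i" for i and f :: "4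
      \<Rightarrow> real"
  proof -
    have "(if i = m then wt i x else 0) * f m = (if i = m then wt i x * f i else 0)" for m by simp
    then show ?thesis by simp
  qed
  have r: "riemann example_metric i j k l p = wt i x * (sec k l / x\<^sup>2 *
    ((if i = k \<and> j = l then wt j x else 0) - (if i = l \<and> j = k then wt j x else 0)))" for i j k l
    unfolding riemann_def riemann_up_example[OF assms] example_metric_nth x_def[symmetric] riem ..
  define ric where "ric i = (if i = 2 then - (3/2) else 0 :: real)" for i :: 4
  have ricci: "ricci example_metric i j p = (if i = j then ric i * wt i x / x\<^sup>2 else 0)" for i j
    unfolding ricci_example[OF assms] ric_def x_def by (simp add: wt_def)
  \<comment> \<open>In dimension 4 the Weyl eigenvalue of a plane is its sectional curvature minus
    half the sum of two Ricci eigenvalues plus one sixth of the scalar curvature. Up to the factor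
    1/x^2 the last term is (-3/2)/6 = -1/4. Diagonal pairs are excluded: there \<open>wcoef\<close>
    has no geometric meaning and only multiplies zero.\<close>
  have "\<forall>k l. k \<noteq> l \<longrightarrow> sec k l - (ric k + ric l) / 2 - 1/4 = wcoef k l"
    unfolding forall_4 by (simp add: sec_def ric_def wcoef_def doubleton_eq_iff)
  then have c: "wcoef k l = sec k l - (ric k + ric l) / 2 - 1/4" if "k \<noteq> l" for k l
    using that by metis
  have S: "scalar_curvature example_metric p = - (3/2) / x\<^sup>2"
    unfolding scalar_curvature_example[OF assms] x_def by simp
  have "weyl example_metric i j k l p =
    wt i x * (sec k l / x\<^sup>2 * ((if i = k \<and> j = l then wt j x else 0) - (if i = l \<and> j =
        k then wt j x else 0)))
    - ((if i = k then ric i * wt i x / x\<^sup>2 else 0) * (if j = l then wt j x else 0)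
      - (if i = l then ric i * wt i x / x\<^sup>2 else 0) * (if j = k then wt j x else 0)
      + (if j = l then ric j * wt j x / x\<^sup>2 else 0) * (if i = k then wt i x else 0)
      - (if j = k then ric j * wt j x / x\<^sup>2 else 0) * (if i = l then wt i x else 0)) / (4 - 2)
    + - (3/2) / x\<^sup>2 * ((if i = k then wt i x else 0) * (if j = l then wt j x else 0)
      - (if i = l then wt i x else 0) * (if j = k then wt j x else 0)) / ((4 - 1) * (4 - 2))"
    unfolding weyl_def Let_def n r ricci S example_metric_nth x_def[symmetric] by (rule refl)
  also have "\<dots> = wcoef k l / x\<^sup>2 * wt i x * wt j x *
    ((if i = k \<and> j = l then 1 else 0) - (if i = l \<and> j = k then 1 else 0))"
  proof (cases "k = l")
    case True
    then show ?thesis by simp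
  next
    case False
    consider "i = k" "j = l" | "i = l" "j = k" | "\<not> (i = k \<and> j = l)" "\<not> (i = l \<and> j
        = k)" by blast
    then show ?thesis
    proof cases
      case 1
      then show ?thesis using False unfolding c[OF False]
        by (simp add: algebra_simps add_divide_distrib diff_divide_distrib)
    next
      case 2
      then show ?thesis using False unfolding c[OF False]
        by (simp add: algebra_simps add_divide_distrib diff_divide_distrib)
    next
      case 3
      then show ?thesis by (cases "i = k"; cases "j = l"; cases "i = l"; cases "j = k") simp_all
    qed
  qed
  finally show ?thesis unfolding x_def .
qed

text \<open>For arbitrary \<open>A\<close> only the skew part survives, by antisymmetry of the Weyl
  tensor in its last two slots.\<close>

lemma weyl_op_example:
  assumes "p $ 2 > 0"
  shows "weyl_op example_metric p A $ i $ j = wcoef i j / (p $ 2)\<^sup>2 * (A $ i $ j - A $ j $ i) / 2"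
proof -
  have nz: "wt i (p $ 2) \<noteq> 0" for i using wt_pos[OF assms, of i] by simp
  have s: "wcoef i j = wcoef j i" by (auto simp: wcoef_def)
  have 1: "(\<Sum>k\<in>UNIV. \<Sum>l\<in>UNIV. (1 / wt i (p $ 2)) * (1 / wt j (p $ 2)) * weyl
      example_metric i j k l p * A $ k $ l)
    = (\<Sum>k\<in>UNIV. \<Sum>l\<in>UNIV. (if i = k then if j = l then wcoef i j / (p $ 2)\<^sup>2 * A
        $ i $ j else 0 else 0) -
       (if j = k then if i = l then wcoef i j / (p $ 2)\<^sup>2 * A $ j $ i else 0 else 0))"
    using nz[of i] nz[of j] assms s unfolding weyl_example[OF assms]
    by (intro sum.cong refl) (auto simp: field_simps)
  define T where "T = (\<Sum>k\<in>UNIV. \<Sum>l\<in>UNIV. (1 / wt i (p $ 2)) * (1 / wt j (p $ 2)) *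
    weyl example_metric i j k l p * A $ k $ l)"
  have "weyl_op example_metric p A $ i $ j =
    1/2 * (\<Sum>a\<in>UNIV. \<Sum>b\<in>UNIV. if i = a then if j = b then T else 0 else 0)"
    unfolding weyl_op_def ginv_nth[OF assms] vec_lambda_beta T_def
    by (intro arg_cong[where f = "\<lambda>a. 1/2 * a"] sum.cong refl) (auto simp: mult.commute)
  also have "(\<Sum>a\<in>UNIV. \<Sum>b\<in>UNIV. if i = a then if j = b then T else 0 else 0) = T"
  proof -
    have "(\<Sum>b\<in>UNIV. if i = a then if j = b then T else 0 else 0) = (if i = a then T else 0)" for a
      by (cases "i = a") simp_all
    then show ?thesis by simp
  qed
  also have "T = wcoef i j / (p $ 2)\<^sup>2 * (A $ i $ j - A $ j $ i)"
  proof -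
    have "(\<Sum>l\<in>UNIV. (if i = k then if j = l then c else 0 else 0) -
       (if j = k then if i = l then d else 0 else 0)) = (if i = k then c else 0) - (if j = k then d else 0)"
      for k and c d :: real
      by (cases "i = k"; cases "j = k") (simp_all add: sum_subtractf sum_negf)
    then show ?thesis unfolding T_def 1 by (simp add: sum_subtractf right_diff_distrib)
  qed
  finally show ?thesis by simp
qed

section \<open>Type C\<close>

lemma weyl_op_example_bivector:
  assumes "p $ 2 > 0" "A \<in> bivectors"
  shows "weyl_op example_metric p A $ i $ j = wcoef i j / (p $ 2)\<^sup>2 * A $ i $ j"
proof -
  have "transpose A $ i $ j = - A $ i $ j" using assms(2) by (simp add: bivectors_def)
  then have "A $ j $ i = - A $ i $ j" by (simp add: transpose_def)
  then show ?thesis unfolding weyl_op_example[OF assms(1)] by simp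
qed

section \<open>The two Weyl eigenspaces\<close>

definition axis_wedge :: "4 \<Rightarrow> 4 \<Rightarrow> real^4^4" where
  "axis_wedge i j = wedge (axis i 1) (axis j 1)"

lemma axis_wedge_nth:
  "axis_wedge i j $ k $ l = (if k = i \<and> l = j then 1 else 0) - (if k = j \<and> l = i then 1 else 0)"
  by (cases "k = i"; cases "l = j"; cases "k = j"; cases "l = i")
    (simp_all add: axis_wedge_def wedge_def axis_def)

lemma bivectors_iff: "A \<in> bivectors \<longleftrightarrow> (\<forall>i j. A $ i $ j + A $ j $ i = 0)"
  by (auto simp: bivectors_def transpose_def vec_eq_iff eq_neg_iff_add_eq_0)

lemma subspace_bivectors: "subspace bivectors"
proof (rule subspaceI)
  show "0 \<in> bivectors" by (simp add: bivectors_iff)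
next
  fix A B :: "real^'a^'a"
  assume "A \<in> bivectors" "B \<in> bivectors"
  then have "(A $ i $ j + A $ j $ i) + (B $ i $ j + B $ j $ i) = 0" for i j
    by (simp add: bivectors_iff)
  then show "A + B \<in> bivectors" by (simp add: bivectors_iff algebra_simps)
next
  fix c and A :: "real^'a^'a"
  assume "A \<in> bivectors"
  then have "c * (A $ i $ j + A $ j $ i) = 0" for i j by (simp add: bivectors_iff)
  then show "c *\<^sub>R A \<in> bivectors" by (simp add: bivectors_iff algebra_simps)
qed

text \<open>The shape of an eigenspace of a diagonal operator: \<open>P\<close> marks the index
  pairs that carry the eigenvalue.\<close>

lemma subspace_bivectors_vanishing: "subspace {A \<in> bivectors. \<forall>i j. P i j \<or> A $ i $ j = 0}"
proof (rule subspaceI)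
  fix A B :: "real^'a^'a"
  assume AB: "A \<in> {A \<in> bivectors. \<forall>i j. P i j \<or> A $ i $ j = 0}"
    "B \<in> {A \<in> bivectors. \<forall>i j. P i j \<or> A $ i $ j = 0}"
  then have "P i j \<or> A $ i $ j = 0" "P i j \<or> B $ i $ j = 0" for i j by blast+
  then have "P i j \<or> (A + B) $ i $ j = 0" for i j by (metis add_0 vector_add_component)
  then show "A + B \<in> {A \<in> bivectors. \<forall>i j. P i j \<or> A $ i $ j = 0}"
    using AB subspace_add[OF subspace_bivectors] by blast
next
  fix c and A :: "real^'a^'a"
  assume A: "A \<in> {A \<in> bivectors. \<forall>i j. P i j \<or> A $ i $ j = 0}"
  then have "P i j \<or> A $ i $ j = 0" for i j by blast
  then have "P i j \<or> (c *\<^sub>R A) $ i $ j = 0" for i j by (metis mult_zero_right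
      vector_scaleR_component real_scaleR_def)
  then show "c *\<^sub>R A \<in> {A \<in> bivectors. \<forall>i j. P i j \<or> A $ i $ j = 0}"
    using A subspace_scale[OF subspace_bivectors] by blast
qed (simp add: subspace_0[OF subspace_bivectors])

lemma axis_wedge_bivector: "axis_wedge i j \<in> bivectors"
  unfolding bivectors_iff axis_wedge_def wedge_def by simp

lemma weyl_eigenspace_example:
  assumes "p $ 2 > 0"
  shows "weyl_eigenspace example_metric p \<kappa> =
    {A \<in> bivectors. \<forall>i j. wcoef i j / (p $ 2)\<^sup>2 = \<kappa> \<or> A $ i $ j = 0}"
proof -
  have "weyl_op example_metric p A = \<kappa> *\<^sub>R A \<longleftrightarrow>
    (\<forall>i j. wcoef i j / (p $ 2)\<^sup>2 = \<kappa> \<or> A $ i $ j = 0)" if "A \<in> bivectors" for A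
    unfolding vec_eq_iff weyl_op_example_bivector[OF assms that] vector_scaleR_component
      real_scaleR_def mult_cancel_right by blast
  then show ?thesis unfolding weyl_eigenspace_def by blast
qed

lemma dim_span_orthogonal_list:
  assumes "pairwise (\<lambda>u v. u \<bullet> v = 0) (set xs)" "distinct xs" "0 \<notin> set xs"
  shows "dim (span (set xs)) = length xs"
  using assms dim_span_eq_card_independent[of "set xs"] distinct_card[of xs]
    pairwise_orthogonal_independent[of "set xs"]
  by (simp add: pairwise_def orthogonal_def)

text \<open>The planes 12 and 34 span the eigenspace of dimension two, the four mixed planes the one
  of dimension four. Since the coefficients 1/2 and -1/4 differ, an eigenvector has no entries of
  the other kind.\<close>

lemma weyl_type_C_example:
  assumes "p $ 2 > 0"
  shows "weyl_type_C example_metric p"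
proof -
  define x where "x = p $ 2"
  have x: "x > 0" using assms by (simp add: x_def)
  let ?E = "weyl_eigenspace example_metric p"
  have ne: "axis_wedge 1 2 \<noteq> 0" "axis_wedge 3 4 \<noteq> 0" "axis_wedge 1 3 \<noteq> 0"
    "axis_wedge 1 4 \<noteq> 0" "axis_wedge 2 3 \<noteq> 0" "axis_wedge 2 4 \<noteq> 0"
    by (auto simp: vec_eq_iff axis_wedge_nth)
  have skew: "A $ i $ j = - A $ j $ i" "A $ i $ i = 0" if "A \<in> bivectors" for A :: "real^4^4" and i j
  proof -
    show "A $ i $ j = - A $ j $ i" for i j using that unfolding bivectors_iff by (simp add: eq_neg_iff_add_eq_0)
    from this[of i i] show "A $ i $ i = 0" by simp
  qed
  have E1: "?E (1/2 / x\<^sup>2) = span (set [axis_wedge 1 2, axis_wedge 3 4])"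
  proof
    show "?E (1/2 / x\<^sup>2) \<subseteq> span (set [axis_wedge 1 2, axis_wedge 3 4])"
    proof
      fix A assume "A \<in> ?E (1/2 / x\<^sup>2)"
      then have A: "A \<in> bivectors" "\<forall>i j. wcoef i j / x\<^sup>2 = 1/2 / x\<^sup>2 \<or> A $
          i $ j = 0"
        by (auto simp: weyl_eigenspace_example[OF assms] x_def)
      then have "wcoef i j = 1/2 \<or> A $ i $ j = 0" for i j
        using x unfolding divide_cancel_right by (metis zero_less_power less_irrefl)
      from this[of 1 3] this[of 1 4] this[of 2 3] this[of 2 4]
      have "A $ 1 $ 3 = 0" "A $ 1 $ 4 = 0" "A $ 2 $ 3 = 0" "A $ 2 $ 4 = 0"
        by (auto simp: wcoef_def)
      then have "A = A $ 1 $ 2 *\<^sub>R axis_wedge 1 2 + A $ 3 $ 4 *\<^sub>R axis_wedge 3 4"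
        unfolding vec_eq_iff forall_4 using skew(1)[OF A(1), of _ 1] skew(1)[OF A(1), of 3 2]
          skew(1)[OF A(1), of 4 2] skew(1)[OF A(1), of 4 3]
        by (simp add: axis_wedge_nth skew(2)[OF A(1)])
      also have "\<dots> \<in> span (set [axis_wedge 1 2, axis_wedge 3 4])"
        by (intro span_add span_scale span_base) auto
      finally show "A \<in> span (set [axis_wedge 1 2, axis_wedge 3 4])" .
    qed
    have "subspace (?E (1/2 / x\<^sup>2))"
      unfolding weyl_eigenspace_example[OF assms] by (rule subspace_bivectors_vanishing)
    moreover have "set [axis_wedge 1 2, axis_wedge 3 4] \<subseteq> ?E (1/2 / x\<^sup>2)"
      unfolding weyl_eigenspace_example[OF assms] using axis_wedge_bivector
      by (auto simp: axis_wedge_nth x_def wcoef_def)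
    ultimately show "span (set [axis_wedge 1 2, axis_wedge 3 4]) \<subseteq> ?E (1/2 / x\<^sup>2)"
      by (rule span_minimal[rotated])
  qed
  let ?ws = "[axis_wedge 1 3, axis_wedge 1 4, axis_wedge 2 3, axis_wedge 2 4]"
  have E2: "?E (- (1/4) / x\<^sup>2) = span (set ?ws)"
  proof
    show "?E (- (1/4) / x\<^sup>2) \<subseteq> span (set ?ws)"
    proof
      fix A assume "A \<in> ?E (- (1/4) / x\<^sup>2)"
      then have A: "A \<in> bivectors" "\<forall>i j. wcoef i j / x\<^sup>2 = - (1/4) / x\<^sup>2 \<or>
          A $ i $ j = 0"
        by (auto simp: weyl_eigenspace_example[OF assms] x_def)
      then have "wcoef i j = - (1/4) \<or> A $ i $ j = 0" for i j
        using x unfolding divide_cancel_right by (metis zero_less_power less_irrefl)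
      from this[of 1 2] this[of 3 4]
      have "A $ 1 $ 2 = 0" "A $ 3 $ 4 = 0" by (auto simp: wcoef_def)
      then have "A = A $ 1 $ 3 *\<^sub>R axis_wedge 1 3 + A $ 1 $ 4 *\<^sub>R axis_wedge 1 4 +
          A $ 2 $ 3 *\<^sub>R axis_wedge 2 3 + A $ 2 $ 4 *\<^sub>R axis_wedge 2 4"
        unfolding vec_eq_iff forall_4 using skew(1)[OF A(1), of _ 1] skew(1)[OF A(1), of 3 2]
          skew(1)[OF A(1), of 4 2] skew(1)[OF A(1), of 4 3]
        by (simp add: axis_wedge_nth skew(2)[OF A(1)])
      also have "\<dots> \<in> span (set ?ws)"
        by (intro span_add span_scale span_base) auto
      finally show "A \<in> span (set ?ws)" .
    qed
    have "subspace (?E (- (1/4) / x\<^sup>2))"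
      unfolding weyl_eigenspace_example[OF assms] by (rule subspace_bivectors_vanishing)
    moreover have "set ?ws \<subseteq> ?E (- (1/4) / x\<^sup>2)"
      unfolding weyl_eigenspace_example[OF assms] using axis_wedge_bivector
      by (auto simp: axis_wedge_nth x_def wcoef_def)
    ultimately show "span (set ?ws) \<subseteq> ?E (- (1/4) / x\<^sup>2)"
      by (rule span_minimal[rotated])
  qed
  have d1: "dim (?E (1/2 / x\<^sup>2)) = 2" unfolding E1
    by (subst dim_span_orthogonal_list)
      (use ne in \<open>auto simp: pairwise_def inner_vec_def sum_4 axis_wedge_nth vec_eq_iff\<close>)
  have d2: "dim (?E (- (1/4) / x\<^sup>2)) = 4" unfolding E2
    by (subst dim_span_orthogonal_list)
      (use ne in \<open>auto simp: pairwise_def inner_vec_def sum_4 axis_wedge_nth vec_eq_iff\<close>)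
  have "?E \<kappa> = {0}" if "\<kappa> \<noteq> 1/2 / x\<^sup>2" "\<kappa> \<noteq> - (1/4) /
      x\<^sup>2" for \<kappa>
  proof -
    have "wcoef i j / x\<^sup>2 \<noteq> \<kappa>" for i j using that by (auto simp: wcoef_def)
    then show ?thesis
      unfolding weyl_eigenspace_example[OF assms] x_def[symmetric]
      using subspace_0[OF subspace_bivectors] by (auto simp: vec_eq_iff)
  qed
  moreover have "?E \<kappa> \<noteq> {0}" if "dim (?E \<kappa>) > 0" for \<kappa>
    using that by fastforce
  then have "?E (1/2 / x\<^sup>2) \<noteq> {0}" "?E (- (1/4) / x\<^sup>2) \<noteq> {0}"
    using d1 d2 by (metis zero_less_numeral)+
  ultimately have "{\<kappa>. ?E \<kappa> \<noteq> {0}} = {- (1/4) / x\<^sup>2, 1/2 / x\<^sup>2}" by blast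
  \<comment> \<open>The operator is diagonal on coordinate bivectors, so it maps a wedge with a
    fixed axis to a wedge with that axis and merely rescales the components of the other
    factor.\<close>
  moreover have "eigenflag example_metric p (axis 1 1)"
  proof -
    have wn: "wedge (axis 1 1) w $ i $ j = (if i = 1 then w $ j else 0) - (if j = 1 then w $ i else 0)"
      for w :: "real^4" and i j by (simp add: wedge_def axis_def)
    have ip: "ip example_metric p w (axis 1 1) = w $ 1" for w
      by (simp add: ip_def inner_vec_def matrix_vector_mult_def sum_4 example_metric_nth axis_def wt_def)
    have "weyl_op example_metric p (wedge (axis 1 1) w) \<in> wedge_perp example_metric p (axis 1 1)"
      if "w $ 1 = 0" for w
    proof -
      have "weyl_op example_metric p (wedge (axis 1 1) w) =
        wedge (axis 1 1) (\<chi> j. wcoef 1 j / x\<^sup>2 * w $ j)"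
        unfolding vec_eq_iff weyl_op_example[OF assms] wn x_def
        by (auto simp: wcoef_def)
      moreover have "ip example_metric p (\<chi> j. wcoef 1 j / x\<^sup>2 * w $ j) (axis 1 1) = 0"
        using that by (simp add: ip)
      ultimately show ?thesis unfolding wedge_perp_def by blast
    qed
    then show ?thesis
      unfolding eigenflag_def by (auto simp: wedge_perp_def ip)
  qed
  moreover have "- (1/4) / x\<^sup>2 \<noteq> 1/2 / x\<^sup>2"
    using x unfolding divide_cancel_right by simp
  ultimately show ?thesis unfolding weyl_type_C_def using d1 d2 by blast
qed

section \<open>Tensors parallel for a conformally related metric\<close>

lemma pd_add: "f differentiable (at p) \<Longrightarrow> g differentiable (at p) \<Longrightarrow>
  pd i (\<lambda>q. f q + g q) p = pd i f p + pd i g p"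
  unfolding frechet_derivative_works by (drule (1) has_derivative_add, drule pd_eqI) (simp add: pd_def)

lemma pd_diff: "f differentiable (at p) \<Longrightarrow> g differentiable (at p) \<Longrightarrow>
  pd i (\<lambda>q. f q - g q) p = pd i f p - pd i g p"
  unfolding frechet_derivative_works by (drule (1) has_derivative_diff, drule pd_eqI) (simp add: pd_def)

lemma pd_mult: "f differentiable (at p) \<Longrightarrow> g differentiable (at p) \<Longrightarrow>
  pd i (\<lambda>q. f q * g q) p = f p * pd i g p + pd i f p * g p"
  unfolding frechet_derivative_works by (drule (1) has_derivative_mult, drule pd_eqI) (simp add: pd_def)

lemma pd_sum: "(\<And>a. a \<in> I \<Longrightarrow> f a differentiable (at p)) \<Longrightarrow>
  pd i (\<lambda>q. \<Sum>a\<in>I. f a q) p = (\<Sum>a\<in>I. pd i (f a) p)"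
  by (induction I rule: infinite_finite_induct) (auto simp: pd_const pd_add differentiable_sum)

lemma pd_commute:
  assumes "open S" "p \<in> S" "Ck_on 2 S f"
  shows "pd i (pd j f) p = pd j (pd i f) p"
  using frechet_derivative_commute[OF assms, of "axis j 1" "axis i 1"] by (simp add: pd_def[abs_def])

lemma differentiable_component:
  "f differentiable (at (p $ j)) \<Longrightarrow> (\<lambda>q. f (q $ j)) differentiable (at p)" for f
      :: "real \<Rightarrow> real"
  unfolding differentiable_def
  using has_derivative_compose[OF bounded_linear_imp_has_derivative[OF bounded_linear_vec_nth]] by blast

text \<open>
  Christoffel symbols of \<open>e\<^sup>2\<^sup>f g\<close> in terms of \<open>s = df\<close>, and their partial derivatives in terms of
  \<open>ds i j = \<partial>\<^sub>i s\<^sub>j\<close>.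
\<close>

definition conf_chr :: "(4 \<Rightarrow> real) \<Rightarrow> 4 \<Rightarrow> 4 \<Rightarrow> 4
    \<Rightarrow> real \<Rightarrow> real" where
  "conf_chr s l k i x = chr l k i x + (if l = k then s i else 0) + (if l = i then s k else 0)
     - (if k = i then wt k x / wt l x * s l else 0)"

definition conf_chr' :: "(4 \<Rightarrow> real) \<Rightarrow> (4 \<Rightarrow> 4 \<Rightarrow> real)
    \<Rightarrow> 4 \<Rightarrow> 4 \<Rightarrow> 4 \<Rightarrow> 4 \<Rightarrow> real \<Rightarrow> real" where
  "conf_chr' s ds m l k i x = (if m = 2 then chr' l k i x else 0) + (if l = k then ds m i else 0)
     + (if l = i then ds m k else 0)
     - (if k = i then wt k x / wt l x * (ds m l + (if m = 2 then (wexp k - wexp l) / x * s l else 0)) else 0)"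

text \<open>The Schouten tensors of \<open>g\<close> and \<open>e\<^sup>2\<^sup>f g\<close> differ by this tensor.\<close>

definition schouten_shift :: "(4 \<Rightarrow> real) \<Rightarrow> (4 \<Rightarrow> 4 \<Rightarrow>
    real) \<Rightarrow> 4 \<Rightarrow> 4 \<Rightarrow> real \<Rightarrow> real" where
  "schouten_shift s ds i j x = ds i j - (\<Sum>a\<in>UNIV. chr a i j x * s a) - s i * s j
     + (if i = j then wt i x * (\<Sum>a\<in>UNIV. (s a)\<^sup>2 / wt a x) / 2 else 0)"

lemma chr_sym: "chr k i j x = chr k j i x"
  by (cases "i = j") (simp_all add: chr_def)

text \<open>This is the compatibility of the connection with the metric: the right-hand side is the
  derivative in direction \<open>m\<close> of the metric coefficient with indices \<open>l\<close>,
  \<open>a\<close>.\<close>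

lemma chr_compatible:
  assumes x: "x > 0"
  shows "wt l x * chr l m a x + wt a x * chr a m l x =
    (if l = a then if m = 2 then wexp l * wt l x / x else 0 else 0)"
proof -
  have "wt 2 x = 1" "wexp 2 = 0" by (auto simp: wt_def wexp_def)
  then show ?thesis
    using x by (cases "m = 2"; cases "l = 2"; cases "a = 2"; cases "l = a"; cases "m = a"; cases "m = l")
      (simp_all add: chr_def field_simps)
qed

text \<open>The classical transformation law: with one index raised, the curvature of e^(2f) g is
  that of g minus the Kulkarni-Nomizu product of g with the Schouten shift.\<close>

lemma conf_curvature:
  assumes x: "x > 0" and ds: "\<And>i j. ds i j = ds j i"
  shows "conf_chr' s ds m l k i x - conf_chr' s ds k l m i x +
    (\<Sum>a\<in>UNIV. conf_chr s l m a x * conf_chr s a k i x - conf_chr s l k a x * conf_chr s a m i x) =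
    sec m k / x\<^sup>2 * ((if l = m \<and> i = k then wt i x else 0) - (if l = k \<and> i = m then wt
        i x else 0))
    + (if l = k then schouten_shift s ds i m x else 0) - (if l = m then schouten_shift s ds i k x else 0)
    - (if k = i then wt i x / wt l x * schouten_shift s ds m l x else 0)
    + (if m = i then wt i x / wt l x * schouten_shift s ds k l x else 0)"
proof -
  \<comment> \<open>A numerical Kronecker delta turns the case distinctions into factors that can be
    multiplied out.\<close>
  define dl :: "4 \<Rightarrow> 4 \<Rightarrow> real" where "dl i j = (if i = j then 1 else 0)" for i j
  define G where "G l k i = chr l k i x" for l k i :: 4
  define W where "W i = wt i x" for i
  define h where "h l = s l / W l" for l
  define D where "D m l = (if m = 2 then wexp l * W l / x else 0)" for m l :: 4
  define n2 where "n2 = (\<Sum>a\<in>UNIV. s a * h a)"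
  have W: "W i \<noteq> 0" "W i * h i = s i" for i using wt_pos[OF x, of i] by (auto simp: W_def h_def)
  have G_sym: "G l k i = G l i k" for l k i unfolding G_def by (rule chr_sym)
  have compat: "W l * G l m a + W a * G a m l = dl l a * D m l" for l m a
    using chr_compatible[OF x, of l m a] by (simp add: G_def W_def D_def dl_def)
  have dl_sum: "(\<Sum>a\<in>UNIV. f a * (dl a k * c)) = f k * c" "(\<Sum>a\<in>UNIV. dl k a * c * f a)
      = c * f k"
    "(\<Sum>a\<in>UNIV. dl k a * f a) = f k" for f k c
    by (simp_all add: dl_def if_distrib if_distribR cong: if_cong)
  define C where "C l k i = G l k i + dl l k * s i + dl l i * s k - dl k i * (W k * h l)" for l k i
  have conf: "conf_chr s l k i x = C l k i" for l k i
    by (simp add: conf_chr_def C_def dl_def h_def G_def W_def)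
  define C' where "C' m l k i = (if m = 2 then chr' l k i x else 0) + dl l k * ds m i + dl l i * ds m k
      - dl k i * (W k / W l * ds m l + h l * (D m k - W k * (D m l / W l)))" for m l k i
  have conf': "conf_chr' s ds m l k i x = C' m l k i" for m l k i
    using W x by (simp add: conf_chr'_def C'_def dl_def h_def D_def flip: W_def) (simp add: field_simps)
  \<comment> \<open>\<open>right\<close> and \<open>left\<close> contract the conformal symbols with
    an arbitrary vector or covector, so that the quadratic terms need no expansion into index
    cases.\<close>
  have right: "(\<Sum>a\<in>UNIV. X a * C a k i) =
    (\<Sum>a\<in>UNIV. X a * G a k i) + X k * s i + X i * s k - dl k i * W k * (\<Sum>a\<in>UNIV. X a *
        h a)" for X k i
  proof -
    have e: "X a * (dl k i * (W k * h a)) = dl k i * W k * (X a * h a)" for a by simp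
    show ?thesis unfolding C_def distrib_left right_diff_distrib sum.distrib sum_subtractf dl_sum e
      by (simp only: sum_distrib_left)
  qed
  have left: "(\<Sum>a\<in>UNIV. C l m a * Y a) =
    (\<Sum>a\<in>UNIV. G l m a * Y a) + dl l m * (\<Sum>a\<in>UNIV. s a * Y a) + s m * Y l - W m * h l
        * Y m" for Y l m
  proof -
    have e: "dl l m * s a * Y a = dl l m * (s a * Y a)" "dl m a * (W m * h l) * Y a = dl m a * (W m * h
        l * Y a)"
      for a by simp_all
    show ?thesis
      unfolding C_def distrib_right left_diff_distrib sum.distrib sum_subtractf dl_sum e
      by (simp only: sum_distrib_left)
  qed
  have quad: "(\<Sum>a\<in>UNIV. C l m a * C a k i) =
    (\<Sum>a\<in>UNIV. G l m a * G a k i) + dl l m * (\<Sum>a\<in>UNIV. s a * G a k i) + s m * G l k i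
        - W m * h l * G m k i
    + C l m k * s i + C l m i * s k - dl k i * W k * ((\<Sum>a\<in>UNIV. G l m a * h a) + dl l m * n2)"
        for l m k i
    unfolding right left n2_def using W(2)[of m] by (simp add: algebra_simps)
  define P where "P l m = (\<Sum>a\<in>UNIV. s a * G a m l)" for l m
  \<comment> \<open>Metric compatibility trades the contraction of a lower slot with the raised
    covector \<open>h\<close> for \<open>P\<close>, the contraction of the upper slot with
    \<open>s\<close>.\<close>
  have Gh: "(\<Sum>a\<in>UNIV. G l m a * h a) = h l * D m l / W l - P l m / W l" for l m
  proof -
    have "W l * (G l m a * h a) + s a * G a m l = dl l a * (D m l * h a)" for a
      using compat[of l m a] W(2)[of a] by algebra
    then have "(\<Sum>a\<in>UNIV. W l * (G l m a * h a) + s a * G a m l) = D m l * h l"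
      by (simp add: dl_sum)
    then have "W l * (\<Sum>a\<in>UNIV. G l m a * h a) + P l m = h l * D m l"
      by (simp add: sum.distrib sum_distrib_left P_def mult.commute)
    then show ?thesis using W(1)[of l] by (simp add: field_simps)
  qed
  have P_sym: "P l m = P m l" for l m by (simp add: P_def G_sym)
  have B: "schouten_shift s ds i j x = ds i j - P i j - s i * s j + dl j i * W j * n2 / 2" for i j
  proof -
    have "(\<Sum>a\<in>UNIV. chr a i j x * s a) = P i j"
      using P_sym[of i j] by (simp add: P_def G_def mult.commute)
    moreover have "(\<Sum>a\<in>UNIV. (s a)\<^sup>2 / wt a x) = n2"
      by (simp add: n2_def h_def W_def power2_eq_square)
    ultimately show ?thesis by (simp add: schouten_shift_def dl_def W_def)
  qed
  have WB: "W k / W l * schouten_shift s ds m l x =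
    W k / W l * ds m l - W k / W l * P m l - W k * h l * s m + dl l m * W k * n2 / 2" for k l m
    using W(1)[of l] by (simp add: B h_def field_simps)
  have curv: "(if m = 2 then chr' l k i x else 0) - (if k = 2 then chr' l m i x else 0) +
    (\<Sum>a\<in>UNIV. G l m a * G a k i - G l k a * G a m i) =
    sec m k / x\<^sup>2 * ((if l = m \<and> i = k then W i else 0) - (if l = k \<and> i = m then W i else 0))"
    unfolding G_def W_def by (rule chr_riemann[OF x])
  have main: "C' m l k i - C' k l m i + ((\<Sum>a\<in>UNIV. C l m a * C a k i) - (\<Sum>a\<in>UNIV. C l
      k a * C a m i)) =
    ((if m = 2 then chr' l k i x else 0) - (if k = 2 then chr' l m i x else 0) +
      ((\<Sum>a\<in>UNIV. G l m a * G a k i) - (\<Sum>a\<in>UNIV. G l k a * G a m i)))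
    + dl l k * schouten_shift s ds i m x - dl l m * schouten_shift s ds i k x
    - dl k i * (W k / W l * schouten_shift s ds m l x) + dl m i * (W m / W l * schouten_shift s ds k l x)"
  proof -
    \<comment> \<open>Rewriting the metric derivatives \<open>D\<close> by Christoffel symbols makes
      all terms with first derivatives of the metric cancel.\<close>
    have c: "h l * (W k * G k m i) + h l * (W i * G i m k) = h l * (dl k i * D m k)"
      "h l * (W m * G m k i) + h l * (W i * G i m k) = h l * (dl m i * D k m)"
      using compat[of k m i] compat[of m k i] G_sym[of i k m] by algebra+
    have dl_swap: "W k * (h l * (s i * dl k m)) = W m * (h l * (s i * dl m k))"
      by (simp add: dl_def)
    have 1: "C' m l k i = (if m = 2 then chr' l k i x else 0) + dl l k * ds m i + dl l i * ds m k
      - dl k i * (W k / W l * ds m l) - h l * (dl k i * D m k) + dl k i * h l * W k * (D m l / W l)" for m k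
      by (simp add: C'_def algebra_simps)
    show ?thesis
      unfolding quad
      unfolding 1 c[symmetric] Gh WB C_def P_def[symmetric]
      unfolding B
      using ds[of m k] ds[of i m] ds[of i k] G_sym[of l m k] G_sym[of i m k] P_sym[of k i] P_sym[of m i]
        P_sym[of l m] P_sym[of k l] dl_swap
      by (simp add: algebra_simps)
  qed
  have e: "dl k i * (wt k x / wt l x * z) = (if k = i then wt i x / wt l x * z else 0)"
    "dl l k * z = (if l = k then z else 0)" for k z
    by (simp_all add: dl_def)
  show ?thesis
    unfolding conf conf' sum_subtractf main curv[unfolded sum_subtractf] W_def e ..
qed

lemma schouten_shift_sym: "(\<And>i j. ds i j = ds j i) \<Longrightarrow> schouten_shift s ds i j x =
    schouten_shift s ds j i x"
  using chr_sym[of _ i j] by (cases "i = j") (simp_all add: schouten_shift_def mult.commute)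

lemma pd_if: "pd i (\<lambda>q. if b then f q else 0) p = (if b then pd i f p else 0)"
  by (simp add: pd_const)

lemma differentiable_if: "f differentiable F \<Longrightarrow> (\<lambda>q. if b then f q else 0)
    differentiable F"
  by (cases b) simp_all

lemma wt_ratio_deriv:
  assumes "x > 0"
  shows "((\<lambda>x. wt k x / wt l x) has_real_derivative (wexp k - wexp l) / x * (wt k x / wt l x)) (at x)"
proof -
  have "wt k x \<noteq> 0" "wt l x \<noteq> 0" using wt_pos[OF assms, of k] wt_pos[OF assms, of l] by auto
  then have *: "(wexp k * wt k x / x * wt l x - wt k x * (wexp l * wt l x / x)) / (wt l x * wt l x) =
      (wexp k - wexp l) / x * (wt k x / wt l x)"
    using assms by (simp add: field_simps)
  show ?thesis
    using DERIV_divide[OF wt_deriv[OF assms, of k] wt_deriv[OF assms, of l] \<open>wt l x \<noteq> 0\<close>]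
    unfolding * .
qed

text \<open>
  \<open>K\<close> is a symmetric covariant 2-tensor that is parallel for the conformally related metric
  \<open>e\<^sup>2\<^sup>f g\<close>, where \<open>s = df\<close>.
\<close>

locale conf_parallel =
  fixes V :: "(real^4) set" and K :: "4 \<Rightarrow> 4 \<Rightarrow> real^4 \<Rightarrow> real" and s
      :: "4 \<Rightarrow> real^4 \<Rightarrow> real"
  assumes open_V: "open V"
    and pos: "p \<in> V \<Longrightarrow> p $ 2 > 0"
    and K_sym: "p \<in> V \<Longrightarrow> K i j p = K j i p"
    and K_C2: "Ck_on 2 V (K i j)"
    and s_diff: "p \<in> V \<Longrightarrow> s i differentiable (at p)"
    and s_closed: "p \<in> V \<Longrightarrow> pd i (s j) p = pd j (s i) p"
    and parallel: "p \<in> V \<Longrightarrow> pd k (K i j) p =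
      (\<Sum>l\<in>UNIV. conf_chr (\<lambda>i. s i p) l k i (p $ 2) * K l j p + conf_chr (\<lambda>i. s
          i p) l k j (p $ 2) * K l i p)"
begin

section \<open>Consequences of parallelism at a point\<close>

lemma conf_chr_deriv:
  assumes "p \<in> V"
  shows "(\<lambda>q. conf_chr (\<lambda>i. s i q) l k i (q $ 2)) differentiable (at p)"
    and "pd m (\<lambda>q. conf_chr (\<lambda>i. s i q) l k i (q $ 2)) p =
      conf_chr' (\<lambda>i. s i p) (\<lambda>m i. pd m (s i) p) m l k i (p $ 2)"
proof -
  note x = pos[OF assms]
  have d: "(\<lambda>q. chr l k i (q $ 2)) differentiable (at p)" "(\<lambda>q. wt k (q $ 2) / wt l (q
      $ 2)) differentiable (at p)"
    using differentiable_component[of "chr l k i" p 2] chr_deriv[OF x, of l k i]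
      differentiable_component[of "\<lambda>x. wt k x / wt l x" p 2] wt_ratio_deriv[OF x, of k l]
    unfolding real_differentiable_def by blast+
  note d = d s_diff[OF assms]
  have d': "(\<lambda>q. chr l k i (q $ 2) + (if l = k then s i q else 0)) differentiable (at p)"
    "(\<lambda>q. chr l k i (q $ 2) + (if l = k then s i q else 0) + (if l = i then s k q else 0))
        differentiable (at p)"
    "(\<lambda>q. if k = i then wt k (q $ 2) / wt l (q $ 2) * s l q else 0) differentiable (at p)"
    by (intro differentiable_add differentiable_if differentiable_mult d)+
  show "(\<lambda>q. conf_chr (\<lambda>i. s i q) l k i (q $ 2)) differentiable (at p)"
    unfolding conf_chr_def by (intro differentiable_diff d')
  have "pd m (\<lambda>q. conf_chr (\<lambda>i. s i q) l k i (q $ 2)) p =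
    (if m = 2 then chr' l k i (p $ 2) else 0) + (if l = k then pd m (s i) p else 0) + (if l = i then pd
        m (s k) p else 0)
     - (if k = i then wt k (p $ 2) / wt l (p $ 2) * pd m (s l) p +
         (if m = 2 then (wexp k - wexp l) / p $ 2 * (wt k (p $ 2) / wt l (p $ 2)) else 0) * s l p else 0)"
    unfolding conf_chr_def
    by (simp only: pd_diff pd_add pd_mult pd_if d d' differentiable_if pd_component[OF chr_deriv[OF x]]
      pd_component[OF wt_ratio_deriv[OF x]])
  then show "pd m (\<lambda>q. conf_chr (\<lambda>i. s i q) l k i (q $ 2)) p =
      conf_chr' (\<lambda>i. s i p) (\<lambda>m i. pd m (s i) p) m l k i (p $ 2)"
    by (auto simp: conf_chr'_def algebra_simps)
qed

lemma K_diff: "p \<in> V \<Longrightarrow> K i j differentiable (at p)"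
  using K_C2[of i j] by (simp add: numeral_2_eq_2)

text \<open>The Ricci identity: the curvature of the conformally related metric annihilates a
  parallel \<open>K\<close>. Here \<open>B\<close> is the Schouten shift and \<open>T\<close> its
  contraction with \<open>K\<close>; only the symmetry of \<open>B\<close> is passed on, since later
  arguments eliminate it.\<close>

lemma integrability:
  assumes p: "p \<in> V"
  obtains B T where "\<And>i j. B i j = B j i"
    "\<And>j m. T j m = (\<Sum>l\<in>UNIV. B m l * K l j p / wt l (p $ 2))"
    "\<And>i j m k. sec m k / (p $ 2)\<^sup>2 *
      ((if k = i then wt i (p $ 2) * K m j p else 0) - (if m = i then wt i (p $ 2) * K k j p else 0) +
       (if k = j then wt j (p $ 2) * K m i p else 0) - (if m = j then wt j (p $ 2) * K k i p else 0))
      + B i m * K k j p - B i k * K m j p + B j m * K k i p - B j k * K m i p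
      - (if k = i then wt i (p $ 2) * T j m else 0) + (if m = i then wt i (p $ 2) * T j k else 0)
      - (if k = j then wt j (p $ 2) * T i m else 0) + (if m = j then wt j (p $ 2) * T i k else 0) = 0"
proof -
  define x where "x = p $ 2"
  define ds where "ds m i = pd m (s i) p" for m i
  define c where "c l k i = conf_chr (\<lambda>i. s i p) l k i x" for l k i
  define c' where "c' m l k i = conf_chr' (\<lambda>i. s i p) ds m l k i x" for m l k i
  define B where "B i j = schouten_shift (\<lambda>i. s i p) ds i j x" for i j
  define T where "T j m = (\<Sum>l\<in>UNIV. B m l * K l j p / wt l x)" for j m
  have ds: "ds i j = ds j i" for i j using s_closed[OF p] by (simp add: ds_def)
  have x: "x > 0" using pos[OF p] by (simp add: x_def)
  define X where "X m k i j = (\<Sum>l\<in>UNIV. \<Sum>a\<in>UNIV. c l k i * c a m l * K a j p)" for m k i j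
  define Z where "Z m k i j = (\<Sum>l\<in>UNIV. \<Sum>a\<in>UNIV. c l k i * c a m j * K a l p)" for m k i j
  \<comment> \<open>\<open>Z\<close> collects the terms in which the two derivatives hit different
    slots of \<open>K\<close>. By this symmetry they cancel in the commutator, while the
    \<open>X\<close> terms supply the quadratic part of the curvature.\<close>
  have Z_swap: "Z m k i j = Z k m j i" for m k i j
    unfolding Z_def by (subst sum.swap) (simp add: K_sym[OF p] mult.commute mult.left_commute)
  have X_eq: "X m k i j = (\<Sum>l\<in>UNIV. (\<Sum>a\<in>UNIV. c l m a * c a k i) * K l j p)" for m k i j
    unfolding X_def by (subst sum.swap) (simp add: sum_distrib_left mult_ac)
  have cK: "(\<Sum>l\<in>UNIV. c l k i * pd m (K l j) p) = X m k i j + Z m k i j" for m k i j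
    unfolding parallel[OF p] X_def Z_def x_def[symmetric] c_def[symmetric]
    by (simp add: sum_distrib_left sum.distrib distrib_left mult.assoc)
  have second: "pd m (pd k (K i j)) p =
    (\<Sum>l\<in>UNIV. c' m l k i * K l j p) + (\<Sum>l\<in>UNIV. c' m l k j * K l i p) + X m k i j + Z
        m k i j + X m k j i + Z m k j i"
    for m k i j
  proof -
    have "pd m (pd k (K i j)) p = pd m (\<lambda>q. \<Sum>l\<in>UNIV.
      conf_chr (\<lambda>i. s i q) l k i (q $ 2) * K l j q + conf_chr (\<lambda>i. s i q) l k j (q $ 2)
          * K l i q) p"
      by (rule pd_cong[OF open_V p parallel])
    also have "\<dots> = (\<Sum>l\<in>UNIV. (c l k i * pd m (K l j) p + c' m l k i * K l j p) +
        (c l k j * pd m (K l i) p + c' m l k j * K l i p))"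
      by (simp only: pd_sum pd_add pd_mult conf_chr_deriv[OF p] K_diff[OF p] differentiable_add
        differentiable_mult c_def c'_def x_def ds_def[abs_def])
    also have "\<dots> = (\<Sum>l\<in>UNIV. c' m l k i * K l j p) + (\<Sum>l\<in>UNIV. c' m l k j * K l i p)
        + (\<Sum>l\<in>UNIV. c l k i * pd m (K l j) p) + (\<Sum>l\<in>UNIV. c l k j * pd m (K l i) p)"
      by (simp add: sum.distrib)
    finally show ?thesis by (simp add: cK)
  qed
  have F0: "(\<Sum>l\<in>UNIV. (c' m l k i - c' k l m i + (\<Sum>a\<in>UNIV. c l m a * c a k i - c l k
      a * c a m i)) * K l j p)
    + (\<Sum>l\<in>UNIV. (c' m l k j - c' k l m j + (\<Sum>a\<in>UNIV. c l m a * c a k j - c l k a * c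
        a m j)) * K l i p) = 0"
    for m k i j
    using pd_commute[OF open_V p K_C2[of i j], of m k] Z_swap[of m k i j] Z_swap[of m k j i]
    unfolding second X_eq by (simp add: distrib_right left_diff_distrib sum.distrib sum_subtractf)
  have F: "(\<Sum>l\<in>UNIV. (c' m l k i - c' k l m i + (\<Sum>a\<in>UNIV. c l m a * c a k i - c l k a
      * c a m i)) * K l j p) =
    sec m k / x\<^sup>2 * ((if k = i then wt i x * K m j p else 0) - (if m = i then wt i x * K k j p else 0))
    + B i m * K k j p - B i k * K m j p
    - (if k = i then wt i x * T j m else 0) + (if m = i then wt i x * T j k else 0)" for m k i j
  proof -
    have d: "(\<Sum>l\<in>UNIV. (if l = k then z else 0) * K l j p) = z * K k j p" for z k
    proof -
      have "(if l = k then z else 0) * K l j p = (if l = k then z * K k j p else 0)" for l by simp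
      then show ?thesis by simp
    qed
    have t: "(\<Sum>l\<in>UNIV. (if b then wt i x / wt l x * B m l else 0) * K l j p) = (if b then wt i
        x * T j m else 0)" for b m
      by (simp add: T_def sum_distrib_left mult_ac)
    have r: "sec m k / x\<^sup>2 * ((if l = m \<and> i = k then wt i x else 0) - (if l = k \<and> i = m
        then wt i x else 0))
      = (if l = m then if k = i then sec m k / x\<^sup>2 * wt i x else 0 else 0) -
        (if l = k then if m = i then sec m k / x\<^sup>2 * wt i x else 0 else 0)" for l
      by auto
    show ?thesis
      unfolding c_def c'_def conf_curvature[of x ds "\<lambda>i. s i p", OF x ds] B_def[symmetric]
      unfolding r distrib_right left_diff_distrib sum.distrib sum_subtractf d t
      by (simp add: algebra_simps)
  qed
  show thesis
  proof (rule that[of B T])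
    show "B i j = B j i" for i j unfolding B_def using ds by (rule schouten_shift_sym)
    show "T j m = (\<Sum>l\<in>UNIV. B m l * K l j p / wt l (p $ 2))" for j m by (simp add: T_def x_def)
    fix i j m k
    show "sec m k / (p $ 2)\<^sup>2 *
      ((if k = i then wt i (p $ 2) * K m j p else 0) - (if m = i then wt i (p $ 2) * K k j p else 0) +
       (if k = j then wt j (p $ 2) * K m i p else 0) - (if m = j then wt j (p $ 2) * K k i p else 0))
      + B i m * K k j p - B i k * K m j p + B j m * K k i p - B j k * K m i p
      - (if k = i then wt i (p $ 2) * T j m else 0) + (if m = i then wt i (p $ 2) * T j k else 0)
      - (if k = j then wt j (p $ 2) * T i m else 0) + (if m = j then wt j (p $ 2) * T i k else 0) = 0"
      using F0[of m k i j] unfolding F x_def[symmetric] by (simp add: algebra_simps)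
  qed
qed

text \<open>The right-hand side of the auxiliary relation below is free of \<open>i\<close>.
  Inserting the two indices other than \<open>j\<close> and \<open>k\<close> therefore gives two
  expressions for the same quantity, and the difference of their coefficients of
  \<open>K j k p\<close> is 3/2 up to sign, divided by x^2.\<close>

lemma K_offdiag:
  assumes p: "p \<in> V" and jk: "j \<in> {1, 2}" "k \<in> {3, 4}"
  shows "K j k p = 0"
proof -
  define x where "x = p $ 2"
  have x: "x > 0" using pos[OF p] by (simp add: x_def)
  obtain B T where B: "\<And>i j. B i j = B j i"
    and "\<And>j m. T j m = (\<Sum>l\<in>UNIV. B m l * K l j p / wt l x)"
    and E: "\<And>i j m k. sec m k / x\<^sup>2 *
      ((if k = i then wt i x * K m j p else 0) - (if m = i then wt i x * K k j p else 0) +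
       (if k = j then wt j x * K m i p else 0) - (if m = j then wt j x * K k i p else 0))
      + B i m * K k j p - B i k * K m j p + B j m * K k i p - B j k * K m i p
      - (if k = i then wt i x * T j m else 0) + (if m = i then wt i x * T j k else 0)
      - (if k = j then wt j x * T i m else 0) + (if m = j then wt j x * T i k else 0) = 0"
    using integrability[OF p, folded x_def] by blast
  have *: "(sec i j - sec i k) / x\<^sup>2 * K j k p = T k j - T j k" if "i \<noteq> j" "i \<noteq> k"
      "j \<noteq> k" for i j k
  proof -
    have 1: "- sec i k / x\<^sup>2 * (wt i x * K k j p) + B i i * K k j p - B i k * K i j p + B j i * K k i p
      - B j k * K i i p + wt i x * T j k = 0"
      using E[where i=i and j=j and m=i and k=k] that by simp
    have 2: "- sec i j / x\<^sup>2 * (wt i x * K j k p) + B i i * K j k p - B i j * K i k p + B k i * K j i p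
      - B k j * K i i p + wt i x * T k j = 0"
      using E[where i=i and j=k and m=i and k=j] that by simp
    \<comment> \<open>The repeated pair \<open>i\<close>, \<open>i\<close> makes the curvature and
      trace terms drop out; what remains cancels the products of \<open>B\<close> and
      \<open>K\<close> in the difference of 1 and 2.\<close>
    have 3: "2 * (B i j * K k i p - B i k * K j i p) = 0"
      using E[where i=i and j=i and m=j and k=k] that by simp
    have "wt i x * ((sec i j - sec i k) / x\<^sup>2 * K j k p) = wt i x * (T k j - T j k)"
      using 1 2 3 B[of i j] B[of i k] B[of j k] K_sym[OF p, of i j] K_sym[OF p, of i k] K_sym[OF p, of j k]
      by (simp add: algebra_simps diff_divide_distrib)
    then show ?thesis unfolding mult_cancel_left using wt_pos[OF x, of i] by simp
  qed
  have x2: "x\<^sup>2 \<noteq> 0" using x by simp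
  have **: "K j k p = 0"
    if "i \<noteq> j" "i \<noteq> k" "j \<noteq> k" "l \<noteq> j" "l \<noteq> k" "sec i j - sec i k
        \<noteq> sec l j - sec l k" for i l
  proof -
    have "(sec i j - sec i k) / x\<^sup>2 * K j k p = (sec l j - sec l k) / x\<^sup>2 * K j k p"
      using *[of i j k] *[of l j k] that(1-5) by simp
    then show ?thesis
      unfolding times_divide_eq_left divide_cancel_right mult_cancel_right using x2 that(6) by blast
  qed
  show ?thesis
    using jk **[of 2 4] **[of 2 3] **[of 1 4] **[of 1 3]
    by (auto simp: sec_def doubleton_eq_iff)
qed

text \<open>The mixed components of \<open>K\<close> vanish on all of \<open>V\<close>, so their
  derivatives vanish too, and \<open>parallel\<close> turns each such derivative into an algebraic
  relation between \<open>s\<close> and \<open>K\<close> at \<open>p\<close>.\<close>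

lemma first_order:
  assumes p: "p \<in> V"
  defines "x \<equiv> p $ 2"
  shows "(3 / (2 * x) + s 2 p) * K 3 4 p = 0" "(- 1 / (2 * x) + s 2 p) * K 3 4 p = 0"
    "s 1 p * K 3 3 p - 3 / 2 * x\<^sup>2 * K 1 2 p - x ^ 3 * (s 1 p * K 1 1 p + s 2 p * K 1 2 p) = 0"
    "s 1 p * K 4 4 p + K 1 2 p / (2 * x\<^sup>2) - (s 1 p * K 1 1 p + s 2 p * K 1 2 p) / x = 0"
    "(3 / (2 * x) + s 2 p) * K 3 3 p - 3 / 2 * x\<^sup>2 * K 2 2 p - x ^ 3 * (s 1 p * K 1 2 p + s 2 p *
        K 2 2 p) = 0"
    "(- 1 / (2 * x) + s 2 p) * K 4 4 p + K 2 2 p / (2 * x\<^sup>2) - (s 1 p * K 1 2 p + s 2 p * K 2 2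
        p) / x = 0"
proof -
  have x: "x > 0" "p $ 2 = x" using pos[OF p] by (simp_all add: x_def)
  have K0: "K 1 3 p = 0" "K 1 4 p = 0" "K 2 3 p = 0" "K 2 4 p = 0"
    "K 3 1 p = 0" "K 4 1 p = 0" "K 3 2 p = 0" "K 4 2 p = 0"
    using K_offdiag[OF p] K_sym[OF p] by auto
  have d0: "pd k (K i j) p = 0" if "i \<in> {1, 2}" "j \<in> {3, 4}" for i j k
    using pd_cong[OF open_V p K_offdiag[OF _ that], where i = k] by (simp add: pd_const)
  have K21: "K 2 1 p = K 1 2 p" "K 4 3 p = K 3 4 p" using K_sym[OF p] by auto
  note simps = conf_chr_def chr_def wexp_def wt_def sum_4 K0 K21 parallel[OF p] x(2)
  show "(3 / (2 * x) + s 2 p) * K 3 4 p = 0"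
    using d0[of 2 4 3] by (simp add: simps)
  show "(- 1 / (2 * x) + s 2 p) * K 3 4 p = 0"
    using d0[of 2 3 4] by (simp add: simps)
  have "pd 3 (K 1 3) p = s 1 p * K 3 3 p - 3 / 2 * x\<^sup>2 * K 1 2 p - x ^ 3 * (s 1 p * K 1 1 p + s 2
      p * K 1 2 p)"
    using x(1) by (simp add: simps) (simp add: field_simps eval_nat_numeral)
  then show "s 1 p * K 3 3 p - 3 / 2 * x\<^sup>2 * K 1 2 p - x ^ 3 * (s 1 p * K 1 1 p + s 2 p * K 1 2 p) = 0"
    using d0 by simp
  have "pd 4 (K 1 4) p = s 1 p * K 4 4 p + K 1 2 p / (2 * x\<^sup>2) - (s 1 p * K 1 1 p + s 2 p * K 1 2 p) / x"
    using x(1) by (simp add: simps) (simp add: field_simps eval_nat_numeral)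
  then show "s 1 p * K 4 4 p + K 1 2 p / (2 * x\<^sup>2) - (s 1 p * K 1 1 p + s 2 p * K 1 2 p) / x = 0"
    using d0 by simp
  have "pd 3 (K 2 3) p = (3 / (2 * x) + s 2 p) * K 3 3 p - 3 / 2 * x\<^sup>2 * K 2 2 p - x ^ 3 * (s 1 p
      * K 1 2 p + s 2 p * K 2 2 p)"
    using x(1) by (simp add: simps) (simp add: field_simps eval_nat_numeral)
  then show "(3 / (2 * x) + s 2 p) * K 3 3 p - 3 / 2 * x\<^sup>2 * K 2 2 p - x ^ 3 * (s 1 p * K 1 2 p +
      s 2 p * K 2 2 p) = 0"
    using d0 by simp
  have "pd 4 (K 2 4) p = (- 1 / (2 * x) + s 2 p) * K 4 4 p + K 2 2 p / (2 * x\<^sup>2) - (s 1 p * K 1 2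
      p + s 2 p * K 2 2 p) / x"
    using x(1) by (simp add: simps) (simp add: field_simps eval_nat_numeral)
  then show "(- 1 / (2 * x) + s 2 p) * K 4 4 p + K 2 2 p / (2 * x\<^sup>2) - (s 1 p * K 1 2 p + s 2 p *
      K 2 2 p) / x = 0"
    using d0 by simp
qed

text \<open>The two factors in front of \<open>K 3 4 p\<close> differ by 2/x and so cannot both
  vanish.\<close>

lemma K_34: "p \<in> V \<Longrightarrow> K 3 4 p = 0"
  using first_order(1,2)[of p] pos[of p] by (auto simp: field_simps)

text \<open>The distribution \<open>\<langle>\<partial>\<^sub>y, \<partial>\<^sub>z\<rangle>\<close> is not umbilic, so \<open>K\<close> cannot be a multiple of the metric on it
  without \<open>\<partial>\<^sub>x\<close> being an eigenvector with the same eigenvalue.\<close>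

lemma K_umbilic:
  assumes p: "p \<in> V" and eq: "K 3 3 p / (p $ 2) ^ 3 = p $ 2 * K 4 4 p"
  shows "K 1 2 p = 0" "K 2 2 p = p $ 2 * K 4 4 p"
proof -
  define x where "x = p $ 2"
  have x: "x > 0" using pos[OF p] by (simp add: x_def)
  \<comment> \<open>The common eigenvalue of \<open>K\<close>, taken relative to the metric, on the
    y- and z-axes.\<close>
  define d where "d = x * K 4 4 p"
  have K: "K 4 4 p = d / x" "K 3 3 p = x ^ 3 * d"
    using eq x by (auto simp: d_def x_def field_simps)
  define A where "A = s 1 p * K 1 1 p + s 2 p * K 1 2 p"
  define B where "B = s 1 p * K 1 2 p + s 2 p * K 2 2 p"
  note f = first_order(3-6)[OF p, folded x_def, unfolded K, folded A_def B_def]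
  have "x ^ 3 * (s 1 p * d - 3 / (2 * x) * K 1 2 p - A) = 0"
    using f(1) x by (simp add: field_simps eval_nat_numeral)
  then have 1: "s 1 p * d - 3 / (2 * x) * K 1 2 p - A = 0" using x by simp
  have "s 1 p * d + K 1 2 p / (2 * x) - A = x * (s 1 p * (d / x) + K 1 2 p / (2 * x\<^sup>2) - A / x)"
    using x by (simp add: field_simps power2_eq_square)
  then have 2: "s 1 p * d + K 1 2 p / (2 * x) - A = 0"
    using f(2) by simp
  have "x ^ 3 * ((3 / (2 * x) + s 2 p) * d - 3 / (2 * x) * K 2 2 p - B) = 0"
    using f(3) x by (simp add: field_simps eval_nat_numeral)
  then have 3: "(3 / (2 * x) + s 2 p) * d - 3 / (2 * x) * K 2 2 p - B = 0" using x by simp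
  have "(- 1 / (2 * x) + s 2 p) * d + K 2 2 p / (2 * x) - B =
    x * ((- 1 / (2 * x) + s 2 p) * (d / x) + K 2 2 p / (2 * x\<^sup>2) - B / x)"
    using x by (simp add: field_simps power2_eq_square)
  then have 4: "(- 1 / (2 * x) + s 2 p) * d + K 2 2 p / (2 * x) - B = 0"
    using f(4) by simp
  \<comment> \<open>Subtracting the y-relation from the z-relation eliminates \<open>s\<close>
    together with \<open>A\<close>; the factor 2/x is the difference of the shape
    eigenvalues.\<close>
  have "K 1 2 p * (2 / x) = (s 1 p * d + K 1 2 p / (2 * x) - A) - (s 1 p * d - 3 / (2 * x) * K 1 2 p - A)"
    using x by (simp add: field_simps)
  then have "K 1 2 p * (2 / x) = 0" unfolding 1 2 by (simp only: diff_zero)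
  then show "K 1 2 p = 0" using x by simp
  have "(K 2 2 p - d) * (2 / x) = ((- 1 / (2 * x) + s 2 p) * d + K 2 2 p / (2 * x) - B)
    - ((3 / (2 * x) + s 2 p) * d - 3 / (2 * x) * K 2 2 p - B)"
    using x by (simp add: field_simps)
  then have "(K 2 2 p - d) * (2 / x) = 0" unfolding 3 4 by (simp only: diff_zero)
  then show "K 2 2 p = p $ 2 * K 4 4 p" using x by (simp add: d_def x_def)
qed

text \<open>Excludes eigenplanes of \<open>K\<close> that meet both \<open>\<langle>\<partial>\<^sub>t, \<partial>\<^sub>x\<rangle>\<close> and \<open>\<langle>\<partial>\<^sub>y, \<partial>\<^sub>z\<rangle>\<close> in a line, by comparing Weyl
  eigenvalues of the two kinds.\<close>

lemma K_not_split:
  assumes p: "p \<in> V" and tr: "K 1 1 p + K 2 2 p = K 3 3 p / (p $ 2) ^ 3 + p $ 2 * K 4 4 p"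
    and ne: "K 1 2 p \<noteq> 0 \<or> K 1 1 p \<noteq> K 2 2 p"
  shows "K 3 3 p / (p $ 2) ^ 3 = p $ 2 * K 4 4 p"
proof -
  define x where "x = p $ 2"
  have x: "x > 0" using pos[OF p] by (simp add: x_def)
  obtain B T where B: "\<And>i j. B i j = B j i"
    and T: "\<And>j m. T j m = (\<Sum>l\<in>UNIV. B m l * K l j p / wt l x)"
    and E: "\<And>i j m k. sec m k / x\<^sup>2 *
      ((if k = i then wt i x * K m j p else 0) - (if m = i then wt i x * K k j p else 0) +
       (if k = j then wt j x * K m i p else 0) - (if m = j then wt j x * K k i p else 0))
      + B i m * K k j p - B i k * K m j p + B j m * K k i p - B j k * K m i p
      - (if k = i then wt i x * T j m else 0) + (if m = i then wt i x * T j k else 0)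
      - (if k = j then wt j x * T i m else 0) + (if m = j then wt j x * T i k else 0) = 0"
    using integrability[OF p, folded x_def] by blast
  have K0: "K 1 3 p = 0" "K 1 4 p = 0" "K 2 3 p = 0" "K 2 4 p = 0"
    "K 3 1 p = 0" "K 4 1 p = 0" "K 3 2 p = 0" "K 4 2 p = 0" "K 3 4 p = 0" "K 4 3 p = 0"
    using K_offdiag[OF p] K_sym[OF p] K_34[OF p] by auto
  have sym: "K 2 1 p = K 1 2 p" "B 2 1 = B 1 2" "B 3 1 = B 1 3" "B 3 2 = B 2 3" "B 4 1 = B 1 4"
    "B 4 2 = B 2 4" "B 4 3 = B 3 4"
    using K_sym[OF p] B by auto
  \<comment> \<open>Eigenvalues of \<open>K\<close> on the y- and z-axes relative to the metric, and
    the corresponding normalised entries of \<open>B\<close>.\<close>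
  define a b b3 b4 where "a = K 3 3 p / x ^ 3" "b = x * K 4 4 p" "b3 = B 3 3 / x ^ 3" "b4 = x * B 4 4"
  note ab = this
  have K: "K 3 3 p = x ^ 3 * a" "K 4 4 p = b / x" "B 3 3 = x ^ 3 * b3" "B 4 4 = b4 / x"
    using x by (simp_all add: ab)
  have T': "T 1 1 = B 1 1 * K 1 1 p + B 1 2 * K 1 2 p" "T 2 2 = B 1 2 * K 1 2 p + B 2 2 * K 2 2 p"
    "T 1 2 = B 1 2 * K 1 1 p + B 2 2 * K 1 2 p"
    "T 3 3 = x ^ 3 * (b3 * a)" "T 4 4 = b4 * b / x"
    unfolding T using x by (simp_all add: sum_4 K0 sym K wt_def)
  have w: "wt 1 x = 1" "wt 2 x = 1" "wt 3 x = x ^ 3" "wt 4 x = 1 / x" by (auto simp: wt_def)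
  have sec: "sec 3 4 = 3/4" "sec 1 2 = 0" "sec 1 3 = 0" "sec 1 4 = 0" "sec 2 3 = - (3/4)" "sec 2 4 = - (3/4)"
    by (auto simp: sec_def doubleton_eq_iff)
  define r where "r = 3 / (4 * x\<^sup>2)"
  have r: "r > 0" using x by (simp add: r_def)
  have r': "3/4 / x\<^sup>2 = r" "- (3/4) / x\<^sup>2 = - r" by (simp_all add: r_def)
  note E' = E[where i=3 and j=4 and m=3 and k=4] E[where i=1 and j=1 and m=1 and k=2]
    E[where i=1 and j=2 and m=1 and k=2] E[where i=1 and j=3 and m=1 and k=3]
    E[where i=2 and j=3 and m=2 and k=3] E[where i=1 and j=4 and m=1 and k=4]
    E[where i=2 and j=4 and m=2 and k=4]
  note E' = E'[unfolded w sec r' T' K K0 sym]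
  have 1: "(a - b) * (r - b3 - b4) = 0"
  proof -
    have "x\<^sup>2 * ((a - b) * (r - b3 - b4)) = 0"
      using E'(1) x by (simp add: field_simps eval_nat_numeral)
    then show ?thesis using x by simp
  qed
  have 2: "(B 1 1 + B 2 2) * K 1 2 p = 0" using E'(2) by (simp add: algebra_simps)
  have 3: "(B 1 1 + B 2 2) * (K 2 2 p - K 1 1 p) = 0" using E'(3) by (simp add: algebra_simps)
  \<comment> \<open>By 2 and 3 this trace annihilates the trace-free part of \<open>K\<close> on the
    block {1,2}, which is nonzero by \<open>ne\<close>.\<close>
  have S: "B 1 1 + B 2 2 = 0" using 2 3 ne by auto
  have 4: "B 1 1 * a - b3 * K 1 1 p + b3 * a - T 1 1 = 0"
  proof -
    have "x ^ 3 * (B 1 1 * a - b3 * K 1 1 p + b3 * a - T 1 1) = 0"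
      using E'(4) unfolding T' by (simp add: algebra_simps)
    then show ?thesis using x by simp
  qed
  have 5: "- r * (K 2 2 p - a) + B 2 2 * a - b3 * K 2 2 p + b3 * a - T 2 2 = 0"
  proof -
    have "x ^ 3 * (- r * (K 2 2 p - a) + B 2 2 * a - b3 * K 2 2 p + b3 * a - T 2 2) = 0"
      using E'(5) unfolding T' by (simp add: algebra_simps)
    then show ?thesis using x by simp
  qed
  have 6: "B 1 1 * b - b4 * K 1 1 p + b4 * b - T 1 1 = 0"
  proof -
    have "(B 1 1 * b - b4 * K 1 1 p + b4 * b - T 1 1) / x = 0"
      using E'(6) unfolding T' by (simp add: algebra_simps diff_divide_distrib add_divide_distrib)
    then show ?thesis using x by simp
  qed
  have 7: "- r * (K 2 2 p - b) + B 2 2 * b - b4 * K 2 2 p + b4 * b - T 2 2 = 0"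
  proof -
    have "(- r * (K 2 2 p - b) + B 2 2 * b - b4 * K 2 2 p + b4 * b - T 2 2) / x = 0"
      using E'(7) unfolding T' by (simp add: algebra_simps diff_divide_distrib add_divide_distrib)
    then show ?thesis using x by simp
  qed
  have tr': "K 1 1 p + K 2 2 p = a + b" using tr by (simp add: ab x_def)
  \<comment> \<open>Subtracting 6 + 7 from 4 + 5 removes \<open>K 2 2 p\<close> from the curvature
    terms and also the trace of \<open>T\<close>; the trace hypothesis replaces
    \<open>K 1 1 p + K 2 2 p\<close> by \<open>a + b\<close>.\<close>
  have "(a - b) * (r + b3 + b4) = 0" using 4 5 6 7 S tr' by algebra
  \<comment> \<open>Because \<open>sec 3 4\<close> and \<open>sec 2 3\<close>,
    \<open>sec 2 4\<close> have opposite signs, adding 1 cancels \<open>b3 + b4\<close> and doubles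
    \<open>r\<close>.\<close>
  then have "(a - b) * r = 0" using 1 by algebra
  then show ?thesis using r by (simp add: ab x_def)
qed

end

section \<open>Limiting Carleman weights\<close>

text \<open>Scaling extends the hypothesis to every vector orthogonal to \<open>n\<close>,
  polarisation extends it to pairs of such vectors, and splitting off the components along
  \<open>n\<close> gives the formula. With \<open>h\<close> the Hessian of a weight and
  \<open>n\<close> its gradient, this is the parallelism of its differential in tensor form.\<close>

lemma bilinear_scaled_form:
  fixes g h :: "'a::real_vector \<Rightarrow> 'a \<Rightarrow> real"
  assumes g: "bilinear g" "\<And>v w. g v w = g w v" "\<And>v. v \<noteq> 0 \<Longrightarrow> g v v > 0"
    and h: "bilinear h" "\<And>v w. h v w = h w v"
    and n: "n \<noteq> 0"
    and *: "\<And>\<xi>. g \<xi> n = 0 \<Longrightarrow> g \<xi> \<xi> = g n n \<Longrightarrow> h n n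
        + h \<xi> \<xi> = 0"
  shows "g n n * h v w = h n v * g n w + h n w * g n v - g v w * h n n"
proof -
  note bl = bilinear_ladd bilinear_radd bilinear_lmul bilinear_rmul bilinear_lsub bilinear_rsub
    bilinear_lneg bilinear_rneg
  note bg = bl[OF g(1)] and bh = bl[OF h(1)]
  define N where "N = g n n"
  have N: "N > 0" using g(3)[OF n] by (simp add: N_def)
  have q: "N * h \<xi> \<xi> = - g \<xi> \<xi> * h n n" if "g \<xi> n = 0" for \<xi>
  proof (cases "\<xi> = 0")
    case True
    then show ?thesis using bilinear_lzero[OF g(1)] bilinear_lzero[OF h(1)] by simp
  next
    case False
    then have p: "g \<xi> \<xi> > 0" by (rule g(3))
    \<comment> \<open>Rescales \<open>\<xi>\<close> to the length of \<open>n\<close>.\<close>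
    define c where "c = sqrt (N / g \<xi> \<xi>)"
    have c: "c * c = N / g \<xi> \<xi>" using N p by (simp add: c_def)
    have c2: "c * c * g \<xi> \<xi> = N" unfolding c using p by simp
    have "h n n + c * c * h \<xi> \<xi> = 0"
      using *[of "c *\<^sub>R \<xi>"] that c2 by (simp add: bg bh N_def mult.assoc)
    then show ?thesis using p unfolding c by (simp add: field_simps)
  qed
  have q2: "N * h \<xi> \<eta> = - g \<xi> \<eta> * h n n" if "g \<xi> n = 0" "g \<eta> n = 0" for \<xi> \<eta>
  proof -
    have "g (\<xi> + \<eta>) n = 0" using that by (simp add: bg)
    from q[OF this] q[OF that(1)] q[OF that(2)] show ?thesis
      by (simp add: bg bh g(2)[of \<eta> \<xi>] h(2)[of \<eta> \<xi>] algebra_simps)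
  qed
  define a b where "a = g n v / N" "b = g n w / N"
  have a: "g n v = a * N" "g n w = b * N" using N by (auto simp: a_b_def)
  define \<xi> \<eta> where "\<xi> = v - a *\<^sub>R n" "\<eta> = w - b *\<^sub>R n"
  have perp: "g \<xi> n = 0" "g \<eta> n = 0"
    using a g(2)[of v n] g(2)[of w n] by (auto simp: \<xi>_\<eta>_def bg N_def[symmetric])
  have vw: "v = \<xi> + a *\<^sub>R n" "w = \<eta> + b *\<^sub>R n" by (auto simp: \<xi>_\<eta>_def)
  have "g n \<xi> = 0" "g n \<eta> = 0" using perp g(2) by auto
  then show ?thesis
    using q2[OF perp] unfolding vw
    by (simp add: bg bh perp h(2)[of \<xi> n] N_def[symmetric] algebra_simps)
qed

text \<open>\<open>s\<close> is the differential of f = (1/2) log r, so that e^(2f) = r. Working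
  with the quotient avoids the logarithm, and closedness comes from commuting second derivatives of
  \<open>r\<close>.\<close>

lemma half_log_derivative:
  fixes r :: "real^'n \<Rightarrow> real"
  assumes S: "open S" and r: "Ck_on 2 S r" "\<And>p. p \<in> S \<Longrightarrow> r p > 0" and p: "p \<in> S"
  defines "s \<equiv> \<lambda>i p. pd i r p / (2 * r p)"
  shows "s i differentiable (at p)" and "pd i (s j) p = pd j (s i) p"
proof -
  have d: "r differentiable (at p)" "pd i r differentiable (at p)" for i
    using r(1) p by (simp_all add: numeral_2_eq_2 pd_def[abs_def])
  have d2: "(\<lambda>p. 1 / (2 * r p)) differentiable (at p)"
    using d(1) r(2)[OF p] by (intro differentiable_divide differentiable_mult differentiable_const) auto
  have s: "s i = (\<lambda>p. pd i r p * (1 / (2 * r p)))" for i by (simp add: s_def)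
  show "s i differentiable (at p)" unfolding s by (intro differentiable_mult d d2)
  have i: "pd i (\<lambda>p. 1 / (2 * r p)) p = - pd i r p / (2 * (r p)\<^sup>2)" for i
  proof -
    have "((\<lambda>p. 1 / (2 * r p)) has_derivative
       (\<lambda>v. - (frechet_derivative r (at p) v) / (2 * (r p)\<^sup>2))) (at p)"
      using d(1)[unfolded frechet_derivative_works] r(2)[OF p]
      by (auto intro!: derivative_eq_intros simp: field_simps power2_eq_square)
    from pd_eqI[OF this, of i] show ?thesis by (simp add: pd_def)
  qed
  show "pd i (s j) p = pd j (s i) p"
    unfolding s pd_mult[OF d(2) d2] i pd_commute[OF S p r(1), of i j] by (simp add: mult.commute)
qed

section \<open>Metric, gradient and Hessian of the example\<close>

lemma sum_delta_mult: "(\<Sum>j\<in>UNIV. (if i = j then f j else 0) * h j) = f i * h i"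
  for f h :: "'a::finite \<Rightarrow> real"
proof -
  have "(if i = j then f j else 0) * h j = (if i = j then f i * h i else 0)" for j by simp
  then show ?thesis by simp
qed

lemma ip_example: "ip example_metric p v w = (\<Sum>i\<in>UNIV. wt i (p $ 2) * v $ i * w $ i)"
  unfolding ip_def inner_vec_def matrix_vector_mult_def example_metric_nth
  by (simp add: sum_delta_mult) (simp add: mult_ac)

lemma ip_example_pos:
  assumes "p $ 2 > 0" "v \<noteq> 0"
  shows "ip example_metric p v v > 0"
proof -
  note w = wt_pos[OF assms(1)]
  obtain i where "v $ i \<noteq> 0" using assms(2) by (auto simp: vec_eq_iff)
  moreover have "wt j (p $ 2) * v $ j * v $ j \<ge> 0" for j
    using w[of j] by (metis less_imp_le mult.assoc mult_nonneg_nonneg zero_le_square)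
  ultimately show ?thesis
    unfolding ip_example
    using w[of i] by (intro sum_pos2[where i = i]) (auto simp: mult.assoc zero_less_mult_iff)
qed

lemma grad_example: "p $ 2 > 0 \<Longrightarrow> grad example_metric \<phi> p $ i = pd i \<phi> p / wt
    i (p $ 2)"
  unfolding grad_def matrix_vector_mult_def by (simp add: ginv_nth sum_delta_mult)

lemma bilinear_coefficients:
  "bilinear (\<lambda>v w :: real^'n::finite. \<Sum>i\<in>UNIV. \<Sum>j\<in>UNIV. a i j * v $ i * w $ j)"
  unfolding bilinear_def
  by (auto intro!: linearI simp: algebra_simps sum.distrib sum_distrib_left)

lemma bilinear_ip: "bilinear (ip g p)"
  using bilinear_coefficients[of "\<lambda>i j. g p $ i $ j"]
  by (simp add: bilinear_def ip_def[abs_def] inner_vec_def matrix_vector_mult_def sum_distrib_left mult_ac)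

lemma bilinear_hessian: "bilinear (hessian g \<phi> p)"
  unfolding hessian_def[abs_def] by (rule bilinear_coefficients)

text \<open>The Hessian of coordinate \<open>k\<close> is minus a Christoffel symbol, which pairs
  only the directions 2 and \<open>k\<close>. The gradient has no component 2 and an orthogonal
  \<open>\<xi>\<close> has no component \<open>k\<close>, so both Hessian terms vanish
  separately.\<close>

lemma limiting_carleman_weight_coordinate:
  assumes U: "open U" "U \<subseteq> {p. p $ 2 > 0}" and k: "k \<in> {1, 3, 4}"
  shows "limiting_carleman_weight example_metric U (\<lambda>p. p $ k)"
  unfolding limiting_carleman_weight_def
proof (intro conjI ballI allI impI)
  show "smooth_on U (\<lambda>p. p $ k)"
    unfolding smooth_on_def by (auto intro: Ck_on_bounded_linear U bounded_linear_vec_nth)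
  fix p assume "p \<in> U"
  then have x: "p $ 2 > 0" using U by auto
  have pd: "pd i (\<lambda>p. p $ k) = (\<lambda>p. if i = k then 1 else 0)" for i
    by (intro ext) (simp add: pd_component[OF DERIV_ident])
  have w: "wt i (p $ 2) \<noteq> 0" for i using wt_pos[OF x, of i] by simp
  have gr: "grad example_metric (\<lambda>p. p $ k) p $ i = (if i = k then 1 / wt k (p $ 2) else 0)" for i
    by (simp add: grad_example[OF x] pd)
  show "grad example_metric (\<lambda>p. p $ k) p \<noteq> 0"
    using gr[of k] w[of k] by (metis divide_eq_0_iff zero_index zero_neq_one)
  have chr: "chr k i j (p $ 2) * v $ i * v $ j = 0" if "v $ 2 = 0 \<or> v $ k = 0" for v :: "real^4" and i j
    using k that by (auto simp: chr_def)
  have H: "hessian example_metric (\<lambda>p. p $ k) p v v = 0" if "v $ 2 = 0 \<or> v $ k = 0" for v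
  proof -
    have e: "(pd i (pd j (\<lambda>p. p $ k)) p - (\<Sum>l\<in>UNIV. christoffel example_metric l i j p
        * pd l (\<lambda>p. p $ k) p))
       * v $ i * v $ j = 0" for i j
      using chr[OF that, of i j]
      by (simp add: pd pd_const christoffel_example[OF x] if_distrib[of "\<lambda>a. _ * a"] cong: if_cong)
    show ?thesis unfolding hessian_def e by simp
  qed
  fix \<xi> assume "ip example_metric p \<xi> (grad example_metric (\<lambda>p. p $ k) p) = 0 \<and>
    gnorm example_metric p \<xi> = gnorm example_metric p (grad example_metric (\<lambda>p. p $ k) p)"
  then have "\<xi> $ k = 0"
    using w[of k] by (simp add: ip_example gr if_distrib[of "\<lambda>a. _ * a"] cong: if_cong)
  moreover have "grad example_metric (\<lambda>p. p $ k) p $ 2 = 0"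
    unfolding gr using k by auto
  ultimately show "hessian example_metric (\<lambda>p. p $ k) p (grad example_metric (\<lambda>p. p $ k) p)
      (grad example_metric (\<lambda>p. p $ k) p) + hessian example_metric (\<lambda>p. p $ k) p \<xi>
          \<xi> = 0"
    using H by simp
qed

lemma linear_axis_expansion:
  fixes f :: "real^'n::finite \<Rightarrow> 'b::real_vector"
  assumes "linear f"
  shows "f v = (\<Sum>i\<in>UNIV. v $ i *\<^sub>R f (axis i 1))"
proof -
  have "f v = f (\<Sum>i\<in>UNIV. v $ i *s axis i 1)" by (simp only: basis_expansion)
  also have "\<dots> = (\<Sum>i\<in>UNIV. v $ i *\<^sub>R f (axis i 1))"
    by (simp add: scalar_mult_eq_scaleR linear_sum[OF assms] linear_scale[OF assms])
  finally show ?thesis .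
qed

lemma constant_if_pd_zero:
  fixes f :: "real^'n::finite \<Rightarrow> real"
  assumes C: "open C" "connected C"
    and f: "\<And>p. p \<in> C \<Longrightarrow> f differentiable (at p)" "\<And>p i. p \<in> C
        \<Longrightarrow> pd i f p = 0"
  obtains c where "\<And>p. p \<in> C \<Longrightarrow> f p = c"
proof -
  have *: "(f has_derivative (\<lambda>_. 0)) (at p)" if p: "p \<in> C" for p
  proof -
    have d: "(f has_derivative frechet_derivative f (at p)) (at p)"
      using f(1)[OF p] by (simp add: frechet_derivative_works)
    have "frechet_derivative f (at p) = (\<lambda>_. 0)"
    proof
      fix v :: "real^'n"
      have lin: "linear (frechet_derivative f (at p))" using d has_derivative_linear by blast
      show "frechet_derivative f (at p) v = 0"
        by (subst linear_axis_expansion[OF lin]) (use f(2)[OF p] in \<open>simp add: pd_def\<close>)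
    qed
    then show ?thesis using d by simp
  qed
  show thesis
  proof (cases "C = {}")
    case False
    then obtain p where "p \<in> C" by blast
    then show ?thesis using that[of "f p"] has_derivative_zero_unique_connected[OF C *] by blast
  qed (use that in blast)
qed

lemma conf_chr_sum:
  assumes "x > 0"
  shows "(\<Sum>l\<in>UNIV. conf_chr s l k i x * u l) = (\<Sum>l\<in>UNIV. chr l k i x * u l) + s i * u
      k + s k * u i
    - (if k = i then wt k x * (\<Sum>l\<in>UNIV. s l * u l / wt l x) else 0)"
proof -
  have 1: "(\<Sum>l\<in>UNIV. (if l = k then z else 0) * u l) = z * u k" for z k
    using sum_delta_mult[of k "\<lambda>_. z" u] by (simp add: eq_commute)
  have 2: "(\<Sum>l\<in>UNIV. (if k = i then wt k x / wt l x * s l else 0) * u l) =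
    (if k = i then wt k x * (\<Sum>l\<in>UNIV. s l * u l / wt l x) else 0)"
    by (simp add: sum_distrib_left mult_ac)
  show ?thesis
    unfolding conf_chr_def distrib_right left_diff_distrib sum.distrib sum_subtractf 1 2 ..
qed

lemma Ck_on_pd: "Ck_on (Suc k) S f \<Longrightarrow> Ck_on k S (pd i f)"
  by (simp add: pd_def[abs_def])

lemma Ck_on_wt:
  fixes S :: "(real^4) set"
  assumes S: "open S" "S \<subseteq> {p. p $ 2 > 0}"
  shows "Ck_on k S (\<lambda>p. wt i (p $ 2))" "Ck_on k S (\<lambda>p. 1 / wt i (p $ 2))"
proof -
  have x: "Ck_on k S (\<lambda>p :: real^4. p $ 2)"
    by (intro Ck_on_bounded_linear S bounded_linear_vec_nth)
  have 1: "Ck_on k S (\<lambda>p. inverse (p $ 2))"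
    using S x by (intro Ck_on_inverse) auto
  have 3: "Ck_on k S (\<lambda>p. p $ 2 * (p $ 2 * p $ 2))"
    by (intro Ck_on_mult S x)
  show w: "Ck_on k S (\<lambda>p. wt i (p $ 2))"
    using 1 3 by (cases "i = 3"; cases "i = 4")
      (simp_all add: wt_def Ck_on_const power3_eq_cube divide_inverse mult.assoc)
  show "Ck_on k S (\<lambda>p. 1 / wt i (p $ 2))"
    using Ck_on_inverse[OF S(1) w] S(2) wt_pos[of _ i] by (force simp: divide_inverse)
qed

text \<open>Here \<open>r\<close> is the squared length of the differential. The Hessian paired with
  the gradient is dr/2; inserting this into \<open>bilinear_scaled_form\<close> and dividing by
  \<open>r\<close> gives the conformal transformation law of the Hessian with left-hand side
  zero.\<close>

lemma carleman_hessian: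
  assumes U: "open U" "U \<subseteq> {p. p $ 2 > 0}"
    and \<phi>: "limiting_carleman_weight example_metric U \<phi>"
  defines "r \<equiv> \<lambda>p. \<Sum>j\<in>UNIV. pd j \<phi> p * pd j \<phi> p * (1 / wt j (p $ 2))"
  assumes p: "p \<in> U"
  shows "r p > 0"
    and "pd k (pd i \<phi>) p =
      (\<Sum>l\<in>UNIV. conf_chr (\<lambda>i. pd i r p / (2 * r p)) l k i (p $ 2) * pd l \<phi> p)"
proof -
  define x where "x = p $ 2"
  define u where "u i = pd i \<phi> p" for i
  define n where "n = grad example_metric \<phi> p"
  define g where "g = ip example_metric p"
  define h where "h = hessian example_metric \<phi> p"
  have x: "x > 0" using U p by (auto simp: x_def)
  have w: "wt i x > 0" "wt i x \<noteq> 0" for i using wt_pos[OF x, of i] by auto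
  have C3: "Ck_on (Suc 2) U \<phi>" using \<phi> by (simp add: limiting_carleman_weight_def smooth_on_def)
  have du: "pd i \<phi> differentiable (at p)" for i
    using Ck_on_pd[OF C3, of i] p by (simp add: numeral_2_eq_2)
  have nn: "n \<noteq> 0" using \<phi> p by (simp add: limiting_carleman_weight_def n_def)
  have n_nth: "n $ i = u i / wt i x" for i
    using x by (simp add: n_def grad_example u_def x_def)
  have g_sym: "g v w = g w v" for v w by (simp add: g_def ip_example mult_ac)
  have g_pos: "g v v > 0" if "v \<noteq> 0" for v
    unfolding g_def using ip_example_pos[OF _ that] x by (simp add: x_def)
  have rp: "r p = g n n"
    using w by (simp add: r_def g_def ip_example n_nth u_def x_def[symmetric])
  show rpos: "r p > 0" unfolding rp by (rule g_pos[OF nn])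
  define a where "a i j = pd i (pd j \<phi>) p - (\<Sum>l\<in>UNIV. chr l i j x * u l)" for i j
  have C2: "Ck_on 2 U \<phi>" by (rule Ck_on_SucD[OF C3])
  have a_sym: "a i j = a j i" for i j
    unfolding a_def pd_commute[OF U(1) p C2, of i j] by (simp add: chr_sym[of _ i j])
  have h_eq: "h v w = (\<Sum>i\<in>UNIV. \<Sum>j\<in>UNIV. a i j * v $ i * w $ j)" for v w
    using x unfolding h_def hessian_def a_def u_def x_def by (simp add: christoffel_example)
  have h_sym: "h v w = h w v" for v w
    unfolding h_eq by (subst sum.swap) (simp add: a_sym mult_ac)
  have h_axis: "h v (axis i 1) = (\<Sum>j\<in>UNIV. a j i * v $ j)" for v i
    by (simp add: h_eq axis_def if_distrib[of "\<lambda>z. _ * z"] cong: if_cong)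
  have g_axis: "g v (axis i 1) = wt i x * v $ i" for v i
    by (simp add: g_def ip_example axis_def x_def if_distrib[of "\<lambda>z. _ * z"] cong: if_cong)
  have dr: "pd i r p = 2 * h n (axis i 1)" for i
  proof -
    have dw: "pd i (\<lambda>q. 1 / wt j (q $ 2)) p = (if i = 2 then - wexp j / (x * wt j x) else 0)"
      "(\<lambda>q. 1 / wt j (q $ 2)) differentiable (at p)" for j
    proof -
      have "((\<lambda>z. 1 / wt j z) has_real_derivative - wexp j / (x * wt j x)) (at x)"
        using w[of j] x by (auto intro!: derivative_eq_intros wt_deriv simp: field_simps)
      from pd_component[OF this[unfolded x_def], of i]
        differentiable_component[of "\<lambda>z. 1 / wt j z" p 2] this
      show "pd i (\<lambda>q. 1 / wt j (q $ 2)) p = (if i = 2 then - wexp j / (x * wt j x) else 0)"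
      "(\<lambda>q. 1 / wt j (q $ 2)) differentiable (at p)"
        by (auto simp: x_def real_differentiable_def)
    qed
    have "pd i r p = (\<Sum>j\<in>UNIV. u j * u j * pd i (\<lambda>q. 1 / wt j (q $ 2)) p +
        (u j * pd i (pd j \<phi>) p + pd i (pd j \<phi>) p * u j) * (1 / wt j x))"
      unfolding r_def u_def x_def
      by (simp only: pd_sum pd_mult du dw(2) differentiable_mult)
    also have "\<dots> = 2 * (\<Sum>j\<in>UNIV. a i j * n $ j)"
    proof -
      \<comment> \<open>Pairing \<open>f l j\<close> with \<open>f j l\<close> lets
        \<open>chr_compatible\<close> convert the Christoffel terms into derivatives of the inverse
        metric.\<close>
      define f where "f l j = chr l i j x * u l * (u j / wt j x)" for l j
      have f: "f l j + f j l = (if l = j then if i = 2 then wexp j * u j * u j / (x * wt j x) else 0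
          else 0)" for l j
      proof -
        have "f l j + f j l = (wt l x * chr l i j x + wt j x * chr j i l x) * (u l / wt l x * (u j / wt j x))"
          using w(2)[of l] w(2)[of j] by (simp add: f_def field_simps)
        then show ?thesis unfolding chr_compatible[OF x] using w(2)[of j] by simp
      qed
      have "2 * (\<Sum>j\<in>UNIV. (\<Sum>l\<in>UNIV. chr l i j x * u l) * (u j / wt j x)) =
          2 * (\<Sum>j\<in>UNIV. \<Sum>l\<in>UNIV. f l j)"
        by (simp only: f_def sum_distrib_right)
      also have "\<dots> = (\<Sum>j\<in>UNIV. \<Sum>l\<in>UNIV. f l j + f j l)"
        using sum.swap[of f UNIV UNIV] by (simp add: sum.distrib)
      also have "\<dots> = (\<Sum>j\<in>UNIV. - (u j * u j * (if i = 2 then - wexp j / (x * wt j x) else 0)))"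
        unfolding f by (intro sum.cong refl) simp
      finally have e: "2 * (\<Sum>j\<in>UNIV. (\<Sum>l\<in>UNIV. chr l i j x * u l) * (u j / wt j x)) =
         - (\<Sum>j\<in>UNIV. u j * u j * (if i = 2 then - wexp j / (x * wt j x) else 0))"
        by (simp only: sum_negf)
      have "2 * (\<Sum>j\<in>UNIV. a i j * n $ j) = 2 * (\<Sum>j\<in>UNIV. pd i (pd j \<phi>) p * (u j
          / wt j x)) -
        2 * (\<Sum>j\<in>UNIV. (\<Sum>l\<in>UNIV. chr l i j x * u l) * (u j / wt j x))"
        by (simp only: a_def n_nth left_diff_distrib sum_subtractf right_diff_distrib)
      then show ?thesis
        unfolding e dw by (simp add: sum.distrib distrib_right sum_distrib_left mult_ac)
    qed
    finally show ?thesis by (simp add: h_axis a_sym)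
  qed
  have eq: "g n n * h v w = h n v * g n w + h n w * g n v - g v w * h n n" for v w
  proof (rule bilinear_scaled_form)
    show "bilinear g" "bilinear h" unfolding g_def h_def by (rule bilinear_ip bilinear_hessian)+
    fix \<xi> assume "g \<xi> n = 0" "g \<xi> \<xi> = g n n"
    then show "h n n + h \<xi> \<xi> = 0"
      using \<phi> p unfolding limiting_carleman_weight_def gnorm_def g_def h_def n_def by metis
  qed (use g_sym g_pos h_sym nn in auto)
  define s where "s i = pd i r p / (2 * r p)" for i
  have hn: "h n (axis i 1) = r p * s i" for i using rpos by (simp add: s_def dr)
  have hnn: "h n n = r p * (\<Sum>l\<in>UNIV. s l * u l / wt l x)"
  proof -
    have "h n n = (\<Sum>l\<in>UNIV. h n (axis l 1) * n $ l)"
      unfolding h_axis unfolding h_eq by (subst sum.swap) (simp add: sum_distrib_left mult_ac)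
    then show ?thesis by (simp add: hn n_nth sum_distrib_left mult_ac)
  qed
  have gn: "g n (axis i 1) = u i" for i using w by (simp add: g_axis n_nth)
  have gg: "g (axis k 1) (axis i 1) = (if k = i then wt k x else 0)" for k i
    unfolding g_axis by (simp add: axis_def)
  have "r p * a k i = r p * (s k * u i + s i * u k - (if k = i then wt k x * (\<Sum>l\<in>UNIV. s l * u
      l / wt l x) else 0))"
  proof -
    have "h (axis k 1) (axis i 1) = a k i"
      unfolding h_axis by (simp add: axis_def if_distrib[of "\<lambda>z. _ * z"] cong: if_cong)
    then show ?thesis
      using eq[of "axis k 1" "axis i 1"] by (cases "k = i") (simp_all add: rp[symmetric] hn gn gg hnn
          algebra_simps)
  qed
  then have "a k i = s k * u i + s i * u k - (if k = i then wt k x * (\<Sum>l\<in>UNIV. s l * u l / wt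
      l x) else 0)"
    using rpos by simp
  then have "pd k (pd i \<phi>) p = (\<Sum>l\<in>UNIV. conf_chr s l k i x * u l)"
    unfolding conf_chr_sum[OF x] by (simp add: a_def)
  then show "pd k (pd i \<phi>) p =
      (\<Sum>l\<in>UNIV. conf_chr (\<lambda>i. pd i r p / (2 * r p)) l k i (p $ 2) * pd l \<phi> p)"
    by (simp add: s_def[abs_def] u_def x_def)
qed

lemma carleman_weight_affine:
  assumes U: "open U" "U \<subseteq> {p. p $ 2 > 0}"
    and \<phi>: "limiting_carleman_weight example_metric U \<phi>"
    and C: "C \<in> components U"
  shows "\<exists>!k. k \<in> {1, 3, 4} \<and> (\<exists>a b. a \<noteq> 0 \<and> (\<forall>p\<in>C.
      \<phi> p = a * p $ k + b))"
proof -
  define u where "u i = pd i \<phi>" for i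
  define r where "r = (\<lambda>p. \<Sum>j\<in>UNIV. pd j \<phi> p * pd j \<phi> p * (1 / wt j (p $ 2)))"
  define s where "s = (\<lambda>i p. pd i r p / (2 * r p))"
  note hess = carleman_hessian[OF U \<phi>]
  have r_pos: "r p > 0" if "p \<in> U" for p using hess(1)[OF that] by (simp add: r_def)
  have C3: "Ck_on (Suc 2) U \<phi>" using \<phi> by (simp add: limiting_carleman_weight_def smooth_on_def)
  have u2: "Ck_on 2 U (u i)" for i unfolding u_def by (rule Ck_on_pd[OF C3])
  have du: "u i differentiable (at p)" if "p \<in> U" for i p
    using u2[of i] that by (simp add: numeral_2_eq_2)
  have r2: "Ck_on 2 U r"
    unfolding r_def using u2 unfolding u_def by (intro Ck_on_sum Ck_on_mult U Ck_on_wt)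
  have dds: "pd k (u i) p = (\<Sum>l\<in>UNIV. conf_chr (\<lambda>i. s i p) l k i (p $ 2) * u l p)" if
      "p \<in> U" for k i p
    using hess(2)[OF that] unfolding u_def s_def r_def .
  interpret conf_parallel U "\<lambda>i j p. u i p * u j p" s
  proof
    fix p i j k assume p: "p \<in> U"
    show "s i differentiable at p" "pd i (s j) p = pd j (s i) p"
      unfolding s_def by (rule half_log_derivative[OF U(1) r2 r_pos p]; assumption)+
    show "pd k (\<lambda>p. u i p * u j p) p = (\<Sum>l\<in>UNIV. conf_chr (\<lambda>i. s i p) l k i (p
        $ 2) * (u l p * u j p) +
          conf_chr (\<lambda>i. s i p) l k j (p $ 2) * (u l p * u i p))"
      unfolding pd_mult[OF du[OF p] du[OF p]] dds[OF p]
      by (simp add: sum.distrib sum_distrib_left sum_distrib_right mult_ac)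
  qed (use U in \<open>auto intro: Ck_on_mult u2\<close>)
  have one: "\<exists>k\<in>{1,3,4}. u k p \<noteq> 0 \<and> (\<forall>i. i \<noteq> k
      \<longrightarrow> u i p = 0)" if p: "p \<in> U" for p
  proof -
    have "u 1 p * u 3 p = 0" "u 1 p * u 4 p = 0" "u 2 p * u 3 p = 0" "u 2 p * u 4 p = 0" "u 3 p * u 4 p = 0"
      using K_offdiag[OF p] K_34[OF p] by auto
    \<comment> \<open>With both components zero the hypothesis of \<open>K_umbilic\<close> reads 0 =
      0, and its conclusion says that the square of \<open>u 2 p\<close> is zero.\<close>
    moreover have "u 2 p = 0" if "u 3 p = 0" "u 4 p = 0"
      using K_umbilic(2)[OF p] that by simp
    moreover have "\<exists>i. u i p \<noteq> 0"
    proof (rule ccontr)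
      assume "\<nexists>i. u i p \<noteq> 0"
      then show False using r_pos[OF p] by (simp add: r_def u_def)
    qed
    then have "u 1 p \<noteq> 0 \<or> u 2 p \<noteq> 0 \<or> u 3 p \<noteq> 0 \<or> u 4 p \<noteq> 0"
      by (metis exhaust_4)
    ultimately show ?thesis unfolding forall_4 by auto
  qed
  have uniq: "i = j" if "p \<in> U" "u i p \<noteq> 0" "u j p \<noteq> 0" for i j p
    using one[OF that(1)] that(2,3) by metis
  have C': "C \<subseteq> U" "connected C" "C \<noteq> {}" "open C"
    using in_components_subset[OF C] in_components_connected[OF C] in_components_nonempty[OF C]
      open_components[OF U(1) C] by auto
  obtain p0 where p0: "p0 \<in> C" using C'(3) by blast
  obtain k where k: "k \<in> {1,3,4}" "u k p0 \<noteq> 0" using one p0 C'(1) by blast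
  have op: "open {p \<in> U. u i p \<noteq> 0}" for i
  proof -
    have "open (U \<inter> u i -` (- {0}))"
      using Ck_on_imp_continuous_on[OF u2[of i]] U(1) by (rule continuous_open_preimage) (rule
          open_Compl closed_singleton)+
    then show ?thesis by (simp add: vimage_def Collect_conj_eq)
  qed
  \<comment> \<open>Exactly one component is nonzero at each point, and being nonzero is an open
    condition; connectedness of \<open>C\<close> therefore fixes the index.\<close>
  have other: "u i p = 0" if p: "p \<in> C" and i: "i \<noteq> k" for i p
  proof -
    let ?A = "{p \<in> U. u k p \<noteq> 0}" and ?B = "\<Union>i\<in>- {k}. {p \<in> U. u i p \<noteq> 0}"
    have "?A \<inter> ?B \<inter> C = {}" using uniq by blast
    moreover have "C \<subseteq> ?A \<union> ?B"
    proof
      fix q assume "q \<in> C"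
      then have q: "q \<in> U" using C'(1) by blast
      then obtain i where "u i q \<noteq> 0" using one by blast
      then show "q \<in> ?A \<union> ?B" using q by (cases "i = k") auto
    qed
    moreover have "open ?A" "open ?B" using op by blast+
    moreover have "?A \<inter> C \<noteq> {}" using k p0 C'(1) by blast
    ultimately have "?B \<inter> C = {}" using connectedD[OF C'(2), of ?A ?B] by metis
    then show ?thesis using p i C'(1) by blast
  qed
  have k0: "u k p \<noteq> 0" if p: "p \<in> C" for p
  proof -
    obtain i where "u i p \<noteq> 0" using one p C'(1) by blast
    then show ?thesis using other[OF p, of i] by (cases "i = k") auto
  qed
  have du0: "pd i (u j) p = 0" if p: "p \<in> C" for i j p
  proof -
    have pU: "p \<in> U" using p C' by blast
    have x: "p $ 2 > 0" by (rule pos[OF pU])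
    have c: "pd i (u j) p = conf_chr (\<lambda>i. s i p) k i j (p $ 2) * u k p" for i j
    proof -
      define f where "f l = conf_chr (\<lambda>i. s i p) l i j (p $ 2) * u l p" for l
      have "(\<Sum>l\<in>UNIV. f l) = (\<Sum>l\<in>UNIV. if l = k then f k else 0)"
        using other[OF p] by (intro sum.cong refl) (auto simp: f_def)
      then show ?thesis unfolding dds[OF pU] by (simp add: f_def)
    qed
    have 1: "pd i (u j) p = 0" if "j \<noteq> k" for i j
      using pd_cong[OF C'(4) p other[OF _ that], where i = i] by (simp add: pd_const)
    \<comment> \<open>For an index i other than \<open>k\<close>, \<open>u i\<close> vanishes on
      \<open>C\<close>, and its i-th derivative sees only the conformal term, a nonzero multiple of
      \<open>s k p * u k p\<close>. The index i = 1 serves unless \<open>k\<close> is 1; then i = 2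
      does.\<close>
    have "s k p = 0"
    proof (cases "k = 1")
      case True
      have "pd 2 (u 2) p = - (s k p * u k p)"
        unfolding c unfolding True by (simp add: conf_chr_def chr_def wexp_def wt_def)
      then show ?thesis using 1[of 2 2] k0[OF p] True by simp
    next
      case False
      have "pd 1 (u 1) p = - (1 / wt k (p $ 2) * s k p * u k p)"
        unfolding c using False k(1) by (auto simp: conf_chr_def chr_def wexp_def wt_def)
      then show ?thesis using 1[of 1 1] k0[OF p] False wt_pos[OF x, of k] by simp
    qed
    moreover have "chr k k k (p $ 2) = 0" using k(1) by (auto simp: chr_def)
    ultimately have "pd k (u k) p = 0" unfolding c by (simp add: conf_chr_def)
    \<comment> \<open>Commuting the derivatives of \<open>\<phi>\<close> reduces this to the
      vanishing component \<open>u i\<close>.\<close>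
    moreover have "pd i (u k) p = 0" if "i \<noteq> k" for i
      using pd_commute[OF U(1) pU Ck_on_SucD[OF C3], of i k] 1[OF that, of k] by (simp add: u_def)
    ultimately show ?thesis using 1 by metis
  qed
  obtain a where a: "\<And>p. p \<in> C \<Longrightarrow> u k p = a"
    using constant_if_pd_zero[OF C'(4,2), of "u k"] du du0 C'(1) by (metis subsetD)
  have a0: "a \<noteq> 0" using a k0 p0 by blast
  have lin: "pd i (\<lambda>q. a * q $ j + b) p = (if i = j then a else 0)" "(\<lambda>q. a * q $ j +
      b) differentiable (at p)"
    for i j :: 4 and a b and p :: "real^4"
  proof -
    have "((\<lambda>z. a * z + b) has_real_derivative a) (at (p $ j))" by (auto intro!: derivative_eq_intros)
    from pd_component[OF this] differentiable_component[of "\<lambda>z. a * z + b" p j] this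
    show "pd i (\<lambda>q. a * q $ j + b) p = (if i = j then a else 0)" "(\<lambda>q. a * q $ j + b)
        differentiable (at p)"
      by (auto simp: real_differentiable_def)
  qed
  have d\<phi>: "\<phi> differentiable (at p)" if "p \<in> C" for p
    using Ck_on_SucE[OF C3, of p] that C'(1) by (auto simp: differentiable_def)
  have "(\<lambda>p. \<phi> p - (a * p $ k + 0)) differentiable at p"
    "pd i (\<lambda>p. \<phi> p - (a * p $ k + 0)) p = 0" if p: "p \<in> C" for p i
  proof -
    show "(\<lambda>p. \<phi> p - (a * p $ k + 0)) differentiable at p"
      by (intro differentiable_diff d\<phi> lin p)
    show "pd i (\<lambda>p. \<phi> p - (a * p $ k + 0)) p = 0"
      unfolding pd_diff[OF d\<phi>[OF p] lin(2)] lin(1) using a[OF p] other[OF p, of i] by (auto simp: u_def)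
  qed
  then obtain b where b: "\<And>p. p \<in> C \<Longrightarrow> \<phi> p - (a * p $ k + 0) = b"
    using constant_if_pd_zero[OF C'(4,2), of "\<lambda>p. \<phi> p - (a * p $ k + 0)"] by blast
  have eq: "\<forall>p\<in>C. \<phi> p = a * p $ k + b" using b by force
  show ?thesis
  proof (rule ex1I[of _ k])
    show "k \<in> {1, 3, 4} \<and> (\<exists>a b. a \<noteq> 0 \<and> (\<forall>p\<in>C. \<phi> p = a *
        p $ k + b))"
      using k a0 eq by blast
    fix k' assume "k' \<in> {1, 3, 4} \<and> (\<exists>a b. a \<noteq> 0 \<and> (\<forall>p\<in>C.
        \<phi> p = a * p $ k' + b))"
    then obtain a' b' where *: "a' \<noteq> 0" "\<And>p. p \<in> C \<Longrightarrow> \<phi> p = a' * p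
        $ k' + b'" by blast
    then have "pd k' \<phi> p0 = a'" using pd_cong[OF C'(4) p0 *(2), where i = k'] by (simp add: lin)
    then show "k' = k" using other[OF p0, of k'] *(1) by (auto simp: u_def)
  qed
qed

section \<open>Products of surfaces\<close>

definition pullback :: "('e \<Rightarrow> 'e \<Rightarrow> 'e \<Rightarrow> real) \<Rightarrow>
    (real^'n::finite \<Rightarrow> 'e::euclidean_space) \<Rightarrow> 'n \<Rightarrow> 'n \<Rightarrow>
    real^'n \<Rightarrow> real" where
  "pullback G P i j q = G (P q) (frechet_derivative P (at q) (axis i 1)) (frechet_derivative P (at q)
      (axis j 1))"

lemma bilinear_expansion:
  fixes g :: "'e::euclidean_space \<Rightarrow> 'e \<Rightarrow> real"
  assumes "bilinear g"
  shows "g v w = (\<Sum>a\<in>Basis. \<Sum>b\<in>Basis. g a b * ((v \<bullet> a) * (w \<bullet> b)))"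
proof -
  have "g v w = g (\<Sum>a\<in>Basis. (v \<bullet> a) *\<^sub>R a) (\<Sum>b\<in>Basis. (w \<bullet> b)
      *\<^sub>R b)"
    by (simp only: euclidean_representation)
  also have "\<dots> = (\<Sum>(a, b)\<in>Basis \<times> Basis. g ((v \<bullet> a) *\<^sub>R a) ((w
      \<bullet> b) *\<^sub>R b))"
    by (rule bilinear_sum[OF assms])
  finally show ?thesis
    by (simp add: sum.cartesian_product[symmetric] bilinear_lmul[OF assms] bilinear_rmul[OF assms] mult_ac)
qed

context
  fixes V :: "(real^'n::finite) set" and P :: "real^'n \<Rightarrow> 'e::euclidean_space" and S and G
  assumes V: "open V" and P: "smooth_on V P" "P ` V \<subseteq> S" and G: "metric_on S G"
begin

text \<open>\<open>metric_on\<close> gives smoothness only for constant vector arguments; the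
  expansion separates the moving base point from the moving arguments.\<close>

lemma pullback_expansion:
  assumes "q \<in> V"
  shows "pullback G P i j q = (\<Sum>a\<in>Basis. \<Sum>b\<in>Basis. G (P q) a b *
    ((frechet_derivative P (at q) (axis i 1) \<bullet> a) * (frechet_derivative P (at q) (axis j 1)
        \<bullet> b)))"
proof -
  have "bilinear (G (P q))" using G P(2) assms by (auto simp: metric_on_def)
  then show ?thesis unfolding pullback_def by (rule bilinear_expansion)
qed

lemma Ck_on_derivative: "Ck_on k V (\<lambda>q. frechet_derivative P (at q) v)"
  using P(1) unfolding smooth_on_def by (metis Ck_on.simps(2))

lemma Ck_on_pullback: "Ck_on k V (pullback G P i j)"
proof -
  have "Ck_on k V (\<lambda>q. G (P q) a b)" for a b
    using Ck_on_compose[OF V P(2), of k "\<lambda>u. G u a b"] P(1) G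
    by (auto simp: metric_on_def smooth_on_def)
  moreover have "Ck_on k V (\<lambda>q. frechet_derivative P (at q) v \<bullet> a)" for v a
    by (rule Ck_on_bounded_bilinear[OF V bounded_bilinear_inner Ck_on_derivative Ck_on_const])
  ultimately have "Ck_on k V (\<lambda>q. \<Sum>a\<in>Basis. \<Sum>b\<in>Basis. G (P q) a b *
    ((frechet_derivative P (at q) (axis i 1) \<bullet> a) * (frechet_derivative P (at q) (axis j 1)
        \<bullet> b)))"
    by (intro Ck_on_sum V Ck_on_mult)
  then show ?thesis using Ck_on_cong[OF V, of "pullback G P i j", OF pullback_expansion] by blast
qed

text \<open>
  The left-hand side is twice a Christoffel symbol of the first kind of \<open>P\<^sup>*G\<close>; the point is that
  its slot \<open>j\<close> only sees the derivative of \<open>P\<close>.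
\<close>

lemma pullback_first_kind:
  assumes p: "p \<in> V"
  obtains L where "\<And>k i. linear (L k i)"
    "\<And>k i j. pd k (pullback G P i j) p + pd i (pullback G P k j) p - pd j (pullback G P k i) p =
      L k i (frechet_derivative P (at p) (axis j 1))"
proof -
  define D where "D i = frechet_derivative P (at p) (axis i 1)" for i
  define DD where "DD k i = frechet_derivative (\<lambda>q. frechet_derivative P (at q) (axis i 1)) (at
      p) (axis k 1)" for k i
  define dG where "dG c v w = (\<Sum>a\<in>Basis. \<Sum>b\<in>Basis.
      frechet_derivative (\<lambda>u. G u a b) (at (P p)) c * ((v \<bullet> a) * (w \<bullet> b)))" for c v w
  define g where "g = G (P p)"
  have Pp: "P p \<in> S" using P(2) p by auto
  have bl: "bilinear g" and g_sym: "g v w = g w v" for v w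
    using G Pp by (auto simp: metric_on_def g_def)
  have G_diff: "(\<lambda>u. G u a b) differentiable (at (P p))" for a b
    using G Pp by (auto simp: metric_on_def smooth_on_def) (metis Ck_on.simps(2))
  have P_diff: "P differentiable (at p)" using P(1) p unfolding smooth_on_def by (metis Ck_on.simps(2))
  have D_diff: "(\<lambda>q. frechet_derivative P (at q) v) differentiable (at p)" for v
    using Ck_on_derivative[of "Suc 0" v] p by simp
  have sym: "DD k i = DD i k" for k i
    unfolding DD_def using frechet_derivative_commute[OF V p] P(1) by (auto simp: smooth_on_def)
  have dP: "pd k (\<lambda>q. G (P q) a b) p = frechet_derivative (\<lambda>u. G u a b) (at (P p)) (D k)"
      "(\<lambda>q. G (P q) a b) differentiable (at p)" for k a b
  proof -
    have "((\<lambda>q. G (P q) a b) has_derivative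
       (\<lambda>v. frechet_derivative (\<lambda>u. G u a b) (at (P p)) (frechet_derivative P (at p)
           v))) (at p)"
      using has_derivative_compose[OF P_diff[unfolded frechet_derivative_works] G_diff[unfolded
          frechet_derivative_works]] .
    from pd_eqI[OF this] this
    show "pd k (\<lambda>q. G (P q) a b) p = frechet_derivative (\<lambda>u. G u a b) (at (P p)) (D k)"
      "(\<lambda>q. G (P q) a b) differentiable (at p)"
      by (auto simp: D_def differentiable_def)
  qed
  have dD: "pd k (\<lambda>q. frechet_derivative P (at q) (axis i 1) \<bullet> a) p = DD k i \<bullet> a"
    "(\<lambda>q. frechet_derivative P (at q) (axis i 1) \<bullet> a) differentiable (at p)" for k i a
    using frechet_derivative_bounded_linear[OF D_diff bounded_linear_inner_left] D_diff
    by (auto simp: pd_def DD_def intro: differentiable_inner)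
  have first: "pd k (pullback G P i j) p = dG (D k) (D i) (D j) + g (DD k i) (D j) + g (D i) (DD k j)" for k i j
  proof -
    define t where "t a b q = G (P q) a b * ((frechet_derivative P (at q) (axis i 1) \<bullet> a) *
      (frechet_derivative P (at q) (axis j 1) \<bullet> b))" for a b q
    have t: "t a b differentiable (at p)"
      "pd k (t a b) p = g a b * ((D i \<bullet> a) * (DD k j \<bullet> b) + (DD k i \<bullet> a) * (D j
          \<bullet> b))
        + frechet_derivative (\<lambda>u. G u a b) (at (P p)) (D k) * ((D i \<bullet> a) * (D j
            \<bullet> b))" for a b
      unfolding t_def[abs_def] g_def D_def
      by (intro differentiable_mult dP dD) (simp only: pd_mult differentiable_mult dP dD D_def)
    have "pd k (pullback G P i j) p = pd k (\<lambda>q. \<Sum>a\<in>Basis. \<Sum>b\<in>Basis. t a b q) p"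
      unfolding t_def by (rule pd_cong[OF V p pullback_expansion])
    also have "\<dots> = (\<Sum>a\<in>Basis. \<Sum>b\<in>Basis. pd k (t a b) p)"
      using t(1) by (simp add: pd_sum differentiable_sum)
    finally show ?thesis
      unfolding t dG_def bilinear_expansion[OF bl, of "DD k i"] bilinear_expansion[OF bl, of "D i"]
      by (simp add: sum.distrib distrib_left)
  qed
  \<comment> \<open>In the Koszul combination the symmetric second derivative \<open>DD k i\<close>
    survives twice, paired with slot \<open>j\<close>; the other second derivatives cancel.\<close>
  define L where "L k i w = dG (D k) (D i) w + dG (D i) (D k) w - dG w (D k) (D i) + 2 * g (DD k i) w" for k i w
  show thesis
  proof (rule that[of L])
    have "linear (\<lambda>w. dG (D k) (D i) w)" for k i
      unfolding dG_def by (rule linearI) (simp_all add: algebra_simps inner_add_left sum.distrib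
          sum_distrib_left)
    moreover have "linear (\<lambda>w. dG w (D k) (D i))" for k i
      unfolding dG_def
      by (rule linearI) (simp_all add: linear_add[OF linear_frechet_derivative[OF G_diff]]
          linear_scale[OF linear_frechet_derivative[OF G_diff]] algebra_simps sum.distrib sum_distrib_left)
    moreover have "linear (\<lambda>w. 2 * g (DD k i) w)" for k i
      by (rule linearI) (simp_all add: bilinear_radd[OF bl] bilinear_rmul[OF bl] algebra_simps)
    ultimately show "linear (L k i)" for k i
      unfolding L_def[abs_def] by (intro linear_compose_add linear_compose_sub)
    show "pd k (pullback G P i j) p + pd i (pullback G P k j) p - pd j (pullback G P k i) p =
      L k i (frechet_derivative P (at p) (axis j 1))" for k i j
      unfolding first L_def D_def[symmetric]
      using sym[of i k] sym[of j k] sym[of i j] g_sym[of "DD j k" "D i"] by simp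
  qed
qed

end

section \<open>Exclusion of a local product structure\<close>

lemma ex_4: "(\<exists>i::4. P i) \<longleftrightarrow> P 1 \<or> P 2 \<or> P 3 \<or> P 4"
  by (metis exhaust_4)

lemma not_onto_plane_if_axes_vanish:
  fixes A :: "real^4 \<Rightarrow> real^2"
  assumes "linear A" "surj A" "\<And>i. i \<noteq> m \<Longrightarrow> A (axis i 1) = 0"
  shows False
proof -
  have "A v \<in> span {A (axis m 1)}" for v
  proof -
    have "A v = (\<Sum>i\<in>UNIV. v $ i *\<^sub>R A (axis i 1))" by (rule linear_axis_expansion[OF assms(1)])
    also have "\<dots> = (\<Sum>i\<in>UNIV. if i = m then v $ m *\<^sub>R A (axis m 1) else 0)"
      using assms(3) by (intro sum.cong refl) auto
    finally show ?thesis by (simp add: span_base span_scale)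
  qed
  then have "span {A (axis m 1)} = UNIV" using assms(2) by (metis UNIV_eq_I surjD)
  then have "dim {A (axis m 1)} = DIM(real^2)" by (metis dim_UNIV dim_span)
  moreover have "dim {A (axis m 1)} \<le> 1" using dim_le_card'[of "{A (axis m 1)}"] by simp
  ultimately show False by simp
qed

text \<open>Koszul's formula for r g. It identifies \<open>conf_chr\<close> as the Levi-Civita
  connection of the product metric, whose first-kind symbols split into contributions of the
  factors.\<close>

lemma first_kind_example:
  assumes x: "p $ 2 > 0" and r: "r differentiable (at p)" "r p > 0"
  shows "pd k (\<lambda>q. r q * example_metric q $ i $ j) p + pd i (\<lambda>q. r q * example_metric q
      $ k $ j) p
      - pd j (\<lambda>q. r q * example_metric q $ k $ i) p =
    2 * (r p * wt j (p $ 2) * conf_chr (\<lambda>i. pd i r p / (2 * r p)) j k i (p $ 2))"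
proof -
  define w where "w i = wt i (p $ 2)" for i
  define D where "D m l = (if m = 2 then wexp l * w l / p $ 2 else 0)" for m l :: 4
  define G where "G l k i = chr l k i (p $ 2)" for l k i
  define s where "s i = pd i r p / (2 * r p)" for i
  have w: "w i \<noteq> 0" for i using wt_pos[OF x, of i] by (simp add: w_def)
  have s: "pd i r p = 2 * r p * s i" for i using r(2) by (simp add: s_def)
  have d: "pd k (\<lambda>q. r q * example_metric q $ i $ j) p =
     (if i = j then r p * D k i + pd k r p * w i else 0)" for k i j
  proof (cases "i = j")
    case True
    have "(\<lambda>q. wt i (q $ 2)) differentiable (at p)"
      using differentiable_component[of "wt i" p 2] wt_deriv[OF x, of i]
      unfolding real_differentiable_def by blast
    then show ?thesis
      using True pd_component[OF wt_deriv[OF x], of k i]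
      by (simp add: example_metric_nth pd_mult[OF r(1)] D_def w_def)
  qed (simp add: example_metric_nth pd_const)
  have c: "w l * G l m a + w a * G a m l = (if l = a then D m l else 0)" for l m a
    unfolding w_def G_def chr_compatible[OF x] by (simp add: D_def w_def)
  have G: "G l k i = G l i k" for l k i unfolding G_def by (rule chr_sym)
  have "(if i = j then D k i else 0) + (if k = j then D i k else 0) - (if k = i then D j k else 0) = 2
      * w j * G j k i"
    unfolding c[symmetric] using G[of i j k] G[of k i j] G[of j i k] by (simp add: algebra_simps)
  then have "r p * ((if i = j then D k i else 0) + (if k = j then D i k else 0) - (if k = i then D j k else 0))
      = r p * (2 * w j * G j k i)" by simp
  moreover have m: "r p * (w j * conf_chr s j k i (p $ 2)) = r p * (w j * G j k i + (if j = k then w j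
      * s i else 0) +
      (if j = i then w j * s k else 0) - (if k = i then w k * s j else 0))"
    using w[of j] by (simp add: conf_chr_def G_def w_def[symmetric] algebra_simps)
  moreover have sf: "(\<lambda>i. pd i r p / (2 * r p)) = s" by (simp add: s_def[abs_def])
  ultimately show ?thesis
    unfolding d sf unfolding s w_def[symmetric] mult.assoc m
    by (cases "i = j"; cases "k = j"; cases "k = i") (simp_all add: algebra_simps)
qed

text \<open>\<open>K\<close> and \<open>L\<close> are the pullbacks of the two factor metrics.
  Relative to r g, \<open>K\<close> is the orthogonal projection onto the tangent spaces of the
  first factor, so its eigenvalues 0 and 1 must each have multiplicity two; the lemmas on parallel
  tensors rule this out.\<close>

lemma no_local_product:
  fixes \<Phi> :: "real^4 \<Rightarrow> (real^2) \<times> (real^2)"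
  assumes V: "open V" "p0 \<in> V" "V \<subseteq> {p. p $ 2 > 0}"
    and \<Phi>: "smooth_on V \<Phi>" "\<Phi> ` V \<subseteq> S \<times> T" and G: "metric_on S G" and
        H: "metric_on T H"
    and \<rho>: "\<And>q. q \<in> V \<Longrightarrow> \<rho> q > 0"
    and eq: "\<And>q v w. q \<in> V \<Longrightarrow>
      G (fst (\<Phi> q)) (fst (frechet_derivative \<Phi> (at q) v)) (fst (frechet_derivative \<Phi> (at q) w)) +
      H (snd (\<Phi> q)) (snd (frechet_derivative \<Phi> (at q) v)) (snd (frechet_derivative \<Phi> (at q) w)) =
      \<rho> q * ip example_metric q v w"
  shows False
proof -
  define P where "P q = fst (\<Phi> q)" for q
  define Q where "Q q = snd (\<Phi> q)" for q
  have \<Phi>_diff: "\<Phi> differentiable (at q)" if "q \<in> V" for q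
    using \<Phi>(1) that unfolding smooth_on_def by (metis Ck_on.simps(2))
  have "Ck_on k V P" "Ck_on k V Q" for k
    unfolding P_def Q_def
    using Ck_on_compose[OF V(1) subset_UNIV, of k \<Phi> fst] Ck_on_compose[OF V(1) subset_UNIV, of k
        \<Phi> snd]
      \<Phi>(1) Ck_on_bounded_linear[OF open_UNIV bounded_linear_fst] Ck_on_bounded_linear[OF open_UNIV
          bounded_linear_snd]
    by (auto simp: smooth_on_def)
  then have P: "smooth_on V P" and Q: "smooth_on V Q" by (auto simp: smooth_on_def)
  have PS: "P ` V \<subseteq> S" and QT: "Q ` V \<subseteq> T"
    using \<Phi>(2) by (auto simp: P_def Q_def mem_Times_iff)
  have dP: "frechet_derivative P (at q) v = fst (frechet_derivative \<Phi> (at q) v)"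
    and dQ: "frechet_derivative Q (at q) v = snd (frechet_derivative \<Phi> (at q) v)" if "q \<in> V" for q v
    unfolding P_def Q_def
    by (rule frechet_derivative_bounded_linear \<Phi>_diff that bounded_linear_fst bounded_linear_snd)+
  define K where "K = pullback G P"
  define L where "L = pullback H Q"
  \<comment> \<open>Equals \<open>\<rho>\<close> on \<open>V\<close>, since dt^2 has coefficient 1.
    Written through the pullbacks it is visibly smooth, which is not assumed of
    \<open>\<rho>\<close>.\<close>
  define r where "r q = K 1 1 q + L 1 1 q" for q
  have KL: "K i j q + L i j q = \<rho> q * example_metric q $ i $ j" if "q \<in> V" for i j q
  proof -
    have "ip example_metric q (axis i 1) (axis j 1) = example_metric q $ i $ j"
      unfolding ip_example example_metric_nth
      by (simp add: axis_def if_distrib[of "\<lambda>z. _ * z"] cong: if_cong)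
    then show ?thesis
      using eq[OF that, of "axis i 1" "axis j 1"]
      by (simp add: K_def L_def pullback_def dP[OF that] dQ[OF that]) (simp add: P_def Q_def)
  qed
  have r: "r q = \<rho> q" if "q \<in> V" for q
    using KL[OF that, of 1 1] by (simp add: r_def example_metric_nth wt_def)
  have r_pos: "r q > 0" if "q \<in> V" for q using r \<rho> that by simp
  have K_Ck: "Ck_on k V (K i j)" and L_Ck: "Ck_on k V (L i j)" for k i j
    unfolding K_def L_def by (rule Ck_on_pullback V P PS G Q QT H)+
  have r2: "Ck_on 2 V r" unfolding r_def[abs_def] by (intro Ck_on_add V K_Ck L_Ck)
  have r_diff: "r differentiable (at q)" if "q \<in> V" for q
    using r2 that by (simp add: numeral_2_eq_2)
  have K_diff: "K i j differentiable (at q)" and L_diff: "L i j differentiable (at q)" if "q \<in> V" for i j q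
    using K_Ck[of "Suc 0" i j] L_Ck[of "Suc 0" i j] that by simp_all
  define A where "A q = frechet_derivative P (at q)" for q
  define B where "B q = frechet_derivative Q (at q)" for q
  have Gbl: "bilinear (G (P q))" "G (P q) v w = G (P q) w v" "v \<noteq> 0 \<Longrightarrow> G (P q) v
      v > 0" if "q \<in> V" for q v w
    using G PS that by (auto simp: metric_on_def)
  have Hbl: "bilinear (H (Q q))" "H (Q q) v w = H (Q q) w v" "v \<noteq> 0 \<Longrightarrow> H (Q q) v
      v > 0" if "q \<in> V" for q v w
    using H QT that by (auto simp: metric_on_def)
  have linA: "linear (A q)" and linB: "linear (B q)" if "q \<in> V" for q
    using P Q that unfolding smooth_on_def A_def B_def
    by (metis Ck_on.simps(2) linear_frechet_derivative)+
  have AB: "G (P q) (A q v) (A q w) + H (Q q) (B q v) (B q w) = r q * ip example_metric q v w" if "q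
      \<in> V" for q v w
    using eq[OF that, of v w] unfolding A_def B_def dP[OF that] dQ[OF that] r[OF that] by (simp add:
        P_def Q_def)
  \<comment> \<open>Positivity makes the differential injective, and both sides have dimension four.
    This supplies vectors tangent to one factor with a prescribed image in it.\<close>
  have surj: "\<exists>v. A q v = a \<and> B q v = b" if q: "q \<in> V" for q a b
  proof -
    define f where "f v = (A q v, B q v)" for v
    have lin: "linear f"
      using linA[OF q] linB[OF q] by (auto intro!: linearI simp: f_def linear_add linear_scale)
    have "v = 0" if "f v = 0" for v
    proof (rule ccontr)
      assume "v \<noteq> 0"
      then have "r q * ip example_metric q v v > 0"
        using ip_example_pos r_pos[OF q] V(3) q by auto
      moreover have "A q v = 0" "B q v = 0" using that by (simp_all add: f_def zero_prod_def)
      ultimately show False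
        using AB[OF q, of v v] bilinear_lzero[OF Gbl(1)[OF q]] bilinear_lzero[OF Hbl(1)[OF q]] by auto
    qed
    then have "inj f" using linear_injective_0[OF lin] by blast
    then have "dim (range f) = dim (UNIV :: (real^4) set)"
      by (intro dim_image_eq lin) (simp add: inj_on_def)
    then have "dim (range f) = DIM((real^2) \<times> (real^2))" by simp
    then have "span (range f) = UNIV" using dim_eq_full by blast
    then have "range f = UNIV" using linear_subspace_image[OF lin subspace_UNIV] span_eq_iff by blast
    then have "(a, b) \<in> range f" by simp
    then show ?thesis by (auto simp: f_def)
  qed
  have K_eq: "K i j q = G (P q) (A q (axis i 1)) (A q (axis j 1))"
    and L_eq: "L i j q = H (Q q) (B q (axis i 1)) (B q (axis j 1))" for i j q
    by (simp_all add: K_def L_def pullback_def A_def B_def)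
  define s where "s i q = pd i r q / (2 * r q)" for i q
  interpret conf_parallel V K s
  proof
    show "open V" by (rule V)
    fix q assume q: "q \<in> V"
    show x: "q $ 2 > 0" using V q by auto
    show "K i j q = K j i q" for i j unfolding K_eq by (rule Gbl(2)[OF q])
    show "s i differentiable at q" "pd i (s j) q = pd j (s i) q" for i j
      unfolding s_def[abs_def] by (rule half_log_derivative[OF V(1) r2 r_pos q]; assumption)+
    fix i j k
    obtain M where M: "\<And>k i. linear (M k i)"
      "\<And>k i j. pd k (K i j) q + pd i (K k j) q - pd j (K k i) q = M k i (A q (axis j 1))"
      using pullback_first_kind[OF V(1) P PS G q] unfolding K_def A_def by blast
    obtain N where N: "\<And>k i. linear (N k i)"
      "\<And>k i j. pd k (L i j) q + pd i (L k j) q - pd j (L k i) q = N k i (B q (axis j 1))"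
      using pullback_first_kind[OF V(1) Q QT H q] unfolding L_def B_def by blast
    define c where "c k i = (\<chi> l. conf_chr (\<lambda>i. s i q) l k i (q $ 2))" for k i
    have pd_r: "pd k (\<lambda>q. r q * example_metric q $ i $ j) q = pd k (K i j) q + pd k (L i j) q" for k i j
    proof -
      have "pd k (\<lambda>q. r q * example_metric q $ i $ j) q = pd k (\<lambda>q. K i j q + L i j q) q"
        by (rule pd_cong[OF V(1) q]) (simp add: KL r)
      then show ?thesis by (simp add: pd_add K_diff[OF q] L_diff[OF q])
    qed
    have c: "2 * (r q * wt j (q $ 2) * c k i $ j) = M k i (A q (axis j 1)) + N k i (B q (axis j 1))" for k i j
      using first_kind_example[OF x r_diff[OF q] r_pos[OF q], of k i j]
      unfolding pd_r M(2)[symmetric] N(2)[symmetric] c_def s_def by simp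
    have c': "2 * (r q * ip example_metric q (c k i) v) = M k i (A q v) + N k i (B q v)" for k i v
    proof -
      have "linear (\<lambda>v. M k i (A q v) + N k i (B q v))"
        using linear_compose[OF linA[OF q] M(1)] linear_compose[OF linB[OF q] N(1)]
        by (intro linear_compose_add) (simp_all add: o_def)
      from linear_axis_expansion[OF this, of v] show ?thesis
        unfolding c[symmetric] ip_example by (simp add: sum_distrib_left mult_ac)
    qed
    \<comment> \<open>Testing against a vector killed by \<open>B q\<close> removes the second
      factor and leaves the first-kind symbol of \<open>K\<close>. Adding the version with
      \<open>i\<close> and \<open>j\<close> exchanged yields twice the derivative of
      \<open>K i j\<close>.\<close>
    have half: "2 * (\<Sum>l\<in>UNIV. conf_chr (\<lambda>i. s i q) l k i (q $ 2) * K l j q) =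
        pd k (K i j) q + pd i (K k j) q - pd j (K k i) q" for k i j
    proof -
      obtain v where v: "A q v = A q (axis j 1)" "B q v = 0" using surj[OF q] by blast
      have "linear (\<lambda>z. G (P q) (A q z) (A q (axis j 1)))"
        using Gbl(1)[OF q] linA[OF q] by (auto intro!: linearI simp: linear_add linear_scale
            bilinear_ladd bilinear_lmul)
      from linear_axis_expansion[OF this, of "c k i"]
      have "(\<Sum>l\<in>UNIV. c k i $ l * K l j q) = G (P q) (A q (c k i)) (A q v)"
        by (simp add: K_eq v)
      also have "\<dots> = r q * ip example_metric q (c k i) v"
        using AB[OF q, of "c k i" v] bilinear_rzero[OF Hbl(1)[OF q]] by (simp add: v)
      also have "2 * \<dots> = M k i (A q (axis j 1))"
        unfolding c' v using linear_0[OF N(1)] by simp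
      finally show ?thesis by (simp add: M c_def)
    qed
    have "pd k (K j i) q = pd k (K i j) q" for i j k
      by (rule pd_cong[OF V(1)  q]) (simp add: K_eq Gbl(2))
    then show "pd k (K i j) q = (\<Sum>l\<in>UNIV. conf_chr (\<lambda>i. s i q) l k i (q $ 2) * K l j q +
          conf_chr (\<lambda>i. s i q) l k j (q $ 2) * K l i q)"
      using half[of k i j] half[of k j i] by (simp add: sum.distrib)
  qed (rule K_Ck)
  define x where "x = p0 $ 2"
  define R where "R = r p0"
  note p0 = V(2)
  have x: "x > 0" using pos[OF p0] by (simp add: x_def)
  have R: "R > 0" using r_pos[OF p0] by (simp add: R_def)
  \<comment> \<open>Relative to the metric, \<open>K\<close> divided by \<open>R\<close> is
    idempotent; \<open>v\<close> is the projection of the i-th axis to the first factor.\<close>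
  have proj: "(\<Sum>l\<in>UNIV. K i l p0 * K l j p0 / wt l x) = R * K i j p0" for i j
  proof -
    obtain v where v: "A p0 v = A p0 (axis i 1)" "B p0 v = 0" using surj[OF p0] by blast
    have vl: "R * wt l x * v $ l = K i l p0" for l
    proof -
      have "ip example_metric p0 v (axis l 1) = wt l x * v $ l"
        unfolding ip_example x_def by (simp add: axis_def if_distrib[of "\<lambda>z. _ * z"] cong: if_cong)
      then show ?thesis
        using AB[OF p0, of v "axis l 1"] bilinear_lzero[OF Hbl(1)[OF p0]] by (simp add: v K_eq R_def)
    qed
    have "linear (\<lambda>z. G (P p0) (A p0 z) (A p0 (axis j 1)))"
      using Gbl(1)[OF p0] linA[OF p0]
      by (auto intro!: linearI simp: linear_add linear_scale bilinear_ladd bilinear_lmul)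
    from linear_axis_expansion[OF this, of v]
    have "K i j p0 = (\<Sum>l\<in>UNIV. v $ l * K l j p0)" by (simp add: K_eq v)
    moreover have "K i l p0 * K l j p0 / wt l x = R * (v $ l * K l j p0)" for l
      unfolding vl[symmetric] using wt_pos[OF x, of l] by simp
    ultimately show ?thesis by (simp add: sum_distrib_left)
  qed
  have K0: "K 1 3 p0 = 0" "K 1 4 p0 = 0" "K 2 3 p0 = 0" "K 2 4 p0 = 0"
    "K 3 1 p0 = 0" "K 4 1 p0 = 0" "K 3 2 p0 = 0" "K 4 2 p0 = 0" "K 3 4 p0 = 0" "K 4 3 p0 = 0"
    using K_offdiag[OF p0] K_sym[OF p0] K_34[OF p0] by auto
  define a b where "a = K 3 3 p0 / x ^ 3" "b = x * K 4 4 p0"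
  note ab = this
  have K34: "K 3 3 p0 = x ^ 3 * a" "K 4 4 p0 = b / x" using x by (simp_all add: ab)
  have K21: "K 2 1 p0 = K 1 2 p0" by (rule K_sym[OF p0])
  have w: "wt 1 x = 1" "wt 2 x = 1" "wt 3 x = x ^ 3" "wt 4 x = 1 / x" by (auto simp: wt_def)
  have a: "a = 0 \<or> a = R" using proj[of 3 3] x by (simp add: sum_4 K0 K34 w)
  have b: "b = 0 \<or> b = R" using proj[of 4 4] x by (simp add: sum_4 K0 K34 w)
  have q: "K 1 1 p0 * K 1 1 p0 + K 1 2 p0 * K 1 2 p0 = R * K 1 1 p0"
    "K 1 2 p0 * (K 1 1 p0 + K 2 2 p0 - R) = 0"
    "K 1 2 p0 * K 1 2 p0 + K 2 2 p0 * K 2 2 p0 = R * K 2 2 p0"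
    using proj[of 1 1] proj[of 1 2] proj[of 2 2] by (simp_all add: sum_4 K0 K21 w algebra_simps)
  have A0: "A p0 (axis i 1) = 0" if "K i i p0 = 0" for i
    using Gbl(3)[OF p0, of "A p0 (axis i 1)"] that by (auto simp: K_eq)
  have B0: "B p0 (axis i 1) = 0" if "K i i p0 = R * wt i x" for i
  proof -
    have "L i i p0 = 0" using KL[OF p0, of i i] that by (simp add: R_def r[OF p0] example_metric_nth x_def)
    then show ?thesis using Hbl(3)[OF p0, of "B p0 (axis i 1)"] by (auto simp: L_eq)
  qed
  have surjA: "surj (A p0)" and surjB: "surj (B p0)"
    using surj[OF p0] unfolding surj_def by metis+
  \<comment> \<open>\<open>A p0\<close> and \<open>B p0\<close> both have rank two, so neither can
    kill three coordinate axes.\<close>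
  have noA: "\<exists>i. i \<noteq> m \<and> K i i p0 \<noteq> 0" for m
    using not_onto_plane_if_axes_vanish[OF linA[OF p0] surjA, of m] A0 by blast
  have noB: "\<exists>i. i \<noteq> m \<and> K i i p0 \<noteq> R * wt i x" for m
    using not_onto_plane_if_axes_vanish[OF linB[OF p0] surjB, of m] B0 by blast
  show False
  proof (cases "a = b")
    \<comment> \<open>The x-, y- and z-axes then share one eigenvalue, 0 or \<open>R\<close>, so one
      of the two differentials kills all three.\<close>
    case True
    then have K2: "K 1 2 p0 = 0" "K 2 2 p0 = b"
      using K_umbilic[OF p0] by (simp_all add: ab x_def)
    show False
      using noA[of 1] noB[of 1] b True x unfolding ex_4 by (auto simp: K2 K34 w)
  next
    case False
    have tr: "a + b = R" using a b False R by auto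
    \<comment> \<open>If \<open>K\<close> is not scalar on the block {1,2}, its eigenvalues there
      are 0 and \<open>R\<close>, so the traces on both blocks agree and \<open>K_not_split\<close>
      applies. If it is scalar, its total rank is one or three.\<close>
    have "K 1 2 p0 = 0 \<and> K 1 1 p0 = K 2 2 p0"
    proof (rule ccontr)
      assume ne: "\<not> ?thesis"
      have "K 1 1 p0 + K 2 2 p0 = R"
      proof (cases "K 1 2 p0 = 0")
        case True
        then have "K 1 1 p0 = 0 \<or> K 1 1 p0 = R" "K 2 2 p0 = 0 \<or> K 2 2 p0 = R" using q by auto
        then show ?thesis using ne True by auto
      qed (use q(2) in auto)
      then show False using K_not_split[OF p0] ne tr False by (simp add: ab x_def)
    qed
    then have K12: "K 1 2 p0 = 0" "K 1 1 p0 = K 2 2 p0" by auto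
    then have K22: "K 2 2 p0 = 0 \<or> K 2 2 p0 = R" using q by auto
    show False
      using noA[of 3] noA[of 4] noB[of 3] noB[of 4] a b False K22 x unfolding ex_4
      by (auto simp: K12 K34 w)
  qed
qed

text \<open>The contradiction is local: choose a product chart around the image of one point and
  restrict to its open preimage, where the coordinate map of \<open>U\<close> is the
  identity.\<close>

lemma not_conformal_to_product:
  assumes U: "open U" "U \<noteq> {}" "U \<subseteq> {p. p $ 2 > 0}"
    and X: "riemannian_surface X \<A>" and Y: "riemannian_surface Y \<B>"
    and F: "conformal_diffeo (top_of_set U) (coordinate_atlas example_metric U)
      (prod_topology X Y) (product_atlas \<A> \<B>) F"
  shows False
proof -
  obtain q0 where q0: "q0 \<in> U" using U(2) by blast
  have "homeomorphic_map (top_of_set U) (prod_topology X Y) F"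
    using F by (simp add: conformal_diffeo_def)
  then have cont: "continuous_map (top_of_set U) (prod_topology X Y) F"
    by (rule homeomorphic_imp_continuous_map)
  then have "F q0 \<in> topspace X \<times> topspace Y"
    using q0 by (auto simp: continuous_map_def)
  moreover have "topspace X = (\<Union>(D, c, G)\<in>\<A>. D)" "topspace Y = (\<Union>(D, c, G)\<in>\<B>. D)"
    using X Y by (auto simp: riemannian_surface_def riemannian_manifold_def)
  ultimately obtain D c G E d H where charts: "(D, c, G) \<in> \<A>" "(E, d, H) \<in> \<B>"
    and Fq0: "F q0 \<in> D \<times> E"
    by (auto simp: mem_Times_iff)
  have G: "openin X D" "metric_on (c ` D) G" and H: "openin Y E" "metric_on (d ` E) H"
    using X Y charts by (auto simp: riemannian_surface_def riemannian_manifold_def)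
  define V where "V = {q \<in> U. F q \<in> D \<times> E}"
  define \<Phi> where "\<Phi> = map_prod c d \<circ> F \<circ> inv_into U id"
  have "openin (top_of_set U) V"
    using openin_continuous_map_preimage[OF cont, of "D \<times> E"] G(1) H(1)
    by (simp add: V_def openin_prod_Times_iff)
  then have V: "open V" using U(1) openin_open_trans by blast
  have inv: "inv_into U id q = q" if "q \<in> U" for q
    using inv_into_f_f[of id U q] that by simp
  have idV: "id ` V = V" by simp
  obtain \<rho> where \<rho>: "\<And>q. q \<in> U \<Longrightarrow> \<rho> q > 0"
    and *: "\<forall>(D, c, G)\<in>coordinate_atlas example_metric U. \<forall>(E, d,
        H)\<in>product_atlas \<A> \<B>.
          let V = {q \<in> D. F q \<in> E};
              \<Phi> = d \<circ> F \<circ> inv_into D c;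
              \<Psi> = c \<circ> inv_into (topspace (top_of_set U)) F \<circ> inv_into E d
          in smooth_on (c ` V) \<Phi> \<and> smooth_on (d ` F ` V) \<Psi> \<and>
             (\<forall>q\<in>V. \<forall>v w.
                H (\<Phi> (c q)) (frechet_derivative \<Phi> (at (c q)) v) (frechet_derivative \<Phi>
                    (at (c q)) w)
                = \<rho> q * G (c q) v w)"
    using F unfolding conformal_diffeo_def by auto
  have "(U, id, ip example_metric) \<in> coordinate_atlas example_metric U"
    by (simp add: coordinate_atlas_def)
  note ** = bspec[OF * this, unfolded prod.case]
  have "(D \<times> E, map_prod c d, \<lambda>u v w. G (fst u) (fst v) (fst w) + H (snd u) (snd v) (snd w))
      \<in> product_atlas \<A> \<B>"
    unfolding product_atlas_def using charts by blast
  note *** = bspec[OF ** this, unfolded prod.case Let_def, folded V_def \<Phi>_def, unfolded idV id_apply]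
  show False
  proof (rule no_local_product)
    show "open V" by (rule V)
    show "q0 \<in> V" using q0 Fq0 by (simp add: V_def)
    show "V \<subseteq> {p. p $ 2 > 0}" using U(3) by (auto simp: V_def)
    show "smooth_on V \<Phi>" using *** by blast
    show "\<Phi> ` V \<subseteq> c ` D \<times> d ` E"
      unfolding \<Phi>_def by (auto simp: V_def inv map_prod_def split: prod.splits)
    show "metric_on (c ` D) G" "metric_on (d ` E) H" by (rule G H)+
    show "\<rho> q > 0" if "q \<in> V" for q using \<rho> that by (simp add: V_def)
    show "G (fst (\<Phi> q)) (fst (frechet_derivative \<Phi> (at q) v)) (fst (frechet_derivative \<Phi>
        (at q) w)) +
      H (snd (\<Phi> q)) (snd (frechet_derivative \<Phi> (at q) v)) (snd (frechet_derivative \<Phi> (at q) w)) =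
      \<rho> q * ip example_metric q v w" if "q \<in> V" for q v w
      using *** that by blast
  qed
qed

text \<open>Composing a weight with a nonconstant affine function gives a weight again, and
  different components of \<open>U\<close> may use different coordinates. Hence the classification
  is per component and up to such affine changes.\<close>

theorem theorem7p1:
  fixes U :: "(real^4) set"
  assumes "open U" and "U \<noteq> {}" and "U \<subseteq> {p. p $ 2 > 0}"
  shows "(\<forall>q\<in>U. weyl_type_C example_metric q) \<and>
    \<not> (\<exists>(X :: 'a topology) \<A> (Y :: 'b topology) \<B> F.
          riemannian_surface X \<A> \<and> riemannian_surface Y \<B> \<and>
          conformal_diffeo (top_of_set U) (coordinate_atlas example_metric U)
            (prod_topology X Y) (product_atlas \<A> \<B>) F) \<and>
    (\<forall>k\<in>{1, 3, 4}. limiting_carleman_weight example_metric U (\<lambda>p. p $ k)) \<and>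
    (\<forall>\<phi>. limiting_carleman_weight example_metric U \<phi> \<longrightarrow>
       (\<forall>C\<in>components U. \<exists>!k. k \<in> {1, 3, 4} \<and>
          (\<exists>a b. a \<noteq> 0 \<and> (\<forall>p\<in>C. \<phi> p = a * p $ k + b))))"
proof (intro conjI ballI allI impI notI)
  show "weyl_type_C example_metric q" if "q \<in> U" for q
    using that assms(3) by (intro weyl_type_C_example) auto
  show False if "\<exists>(X :: 'a topology) \<A> (Y :: 'b topology) \<B> F.
          riemannian_surface X \<A> \<and> riemannian_surface Y \<B> \<and>
          conformal_diffeo (top_of_set U) (coordinate_atlas example_metric U)
            (prod_topology X Y) (product_atlas \<A> \<B>) F"
    using that not_conformal_to_product[OF assms] by blast
  show "limiting_carleman_weight example_metric U (\<lambda>p. p $ k)" if "k \<in> {1, 3, 4}" for k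
    using limiting_carleman_weight_coordinate[OF assms(1,3) that] .
  show "\<exists>!k. k \<in> {1, 3, 4} \<and> (\<exists>a b. a \<noteq> 0 \<and> (\<forall>p\<in>C.
      \<phi> p = a * p $ k + b))"
    if "limiting_carleman_weight example_metric U \<phi>" "C \<in> components U" for \<phi> C
    using carleman_weight_affine[OF assms(1,3) that] .
qed

end
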